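(* Let $X=(x_1,\dots,x_n)\in\mathbb{R}^{d_x\times n}$ and $Y=(y_1,\dots,y_n)\in\mathbb{R}^{d_y\times n}$. Let $L\ge 2$ and $m\ge\max\{d_x,d_y\}$ be integers. Consider the $L$-layer linear network $f(x;W_1,\dots,W_L)=\alpha W_LW_{L-1}\cdots W_1x$ with $W_1\in\mathbb{R}^{m\times d_x}$, $W_i\in\mathbb{R}^{m\times m}$ for $2\le i\le L-1$, $W_L\in\mathbb{R}^{d_y\times m}$, and $\alpha=\frac{1}{\sqrt{m^{L-1}d_y}}$, trained on the loss $$\ell(W_1,\dots,W_L)=\tfrac12\|\alpha W_L\cdots W_1X-Y\|_F^2$$ by gradient descent $W_i(t+1)=W_i(t)-\eta\,\frac{\partial\ell}{\partial W_i}(W_1(t),\dots,W_L(t))$, $i\in[L]$, $t=0,1,2,\dots$, where the initial matrices $W_1(0),\dots,W_L(0)$ are independent and each $W_i(0)$ is drawn uniformly from the set of matrices satisfying $W_1^\top(0)W_1(0)=mI_{d_x}$; $W_i^\top(0)W_i(0)=W_i(0)W_i^\top(0)=mI_m$ for $2\le i\le L-1$; $W_L(0)W_L^\top(0)=mI_{d_y}$. Let $W^*\in\arg\min_{W\in\mathbb{R}^{d_y\times d_x}}\|WX-Y\|_F$, $\ell^*=\frac12\|W^*X-Y\|_F^2$, $r=\mathrm{rank}(X)$, $\kappa=\lambda_{\max}(X^\top X)/\lambda_r(X^\top X)$ and $\tilde r=\|X\|_F^2/\|X\|^2$. There exist universal constants $C>0$ and $C'>0$ such that the following holds. Let $\delta\in(0,1)$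 and suppose $$m\ge C\,\tilde r\,\kappa^2\big(d_y(1+\|W^*\|^2)+\log(r/\delta)\big)\quad\text{and}\quad m\ge d_x,$$ and let the learning rate satisfy $0<\eta\le\frac{d_y}{2L\|X\|^2}$. Then with probability at least $1-\delta$ over the random initialization, $$\ell(0)-\ell^*\le C'\Big(1+\frac{\log(r/\delta)}{d_y}+\|W^*\|^2\Big)\|X\|_F^2,$$ and for all $t=0,1,2,\dots$, $$\ell(t)-\ell^*\le\Big(1-\tfrac12\eta L\lambda_r(X^\top X)/d_y\Big)^t(\ell(0)-\ell^* ),$$ where $\ell(t)=\ell(W_1(t),\dots,W_L(t))$.
   Context: $\|\cdot\|$ denotes the Euclidean norm of a vector and the spectral norm of a matrix, $\|\cdot\|_F$ the Frobenius norm; $\lambda_{\max}$ and $\lambda_i$ denote the largest and $i$-th largest eigenvalue of a symmetric matrix; $[L]=\{1,\dots,L\}$. *)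

theory Defs
  imports "HOL-Probability.Probability" "Jordan_Normal_Form.DL_Rank" "Jordan_Normal_Form.Char_Poly"
begin

definition fro_norm :: "real mat \<Rightarrow> real" where
  "fro_norm A = sqrt (\<Sum>i<dim_row A. \<Sum>j<dim_col A. (A $$ (i,j))^2)"

definition vnorm :: "real vec \<Rightarrow> real" where
  "vnorm v = sqrt (\<Sum>i<dim_vec v. (v $ i)^2)"

definition spec_norm :: "real mat \<Rightarrow> real" where
  "spec_norm A = Sup {vnorm (A *\<^sub>v v) | v. v \<in> carrier_vec (dim_col A) \<and> vnorm v \<le> 1}"

text \<open>Eigenvalues (with multiplicity) of a real matrix, listed in non-increasing order;
  for a symmetric matrix these are all its eigenvalues.  \<open>eig_desc A ! (i-1)\<close> is \<open>\<lambda>_i(A)\<close>.\<close>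
definition eig_desc :: "real mat \<Rightarrow> real list" where
  "eig_desc A = rev (sorted_list_of_multiset (proots (char_poly A)))"

definition lambda_i :: "real mat \<Rightarrow> nat \<Rightarrow> real" where
  "lambda_i A i = eig_desc A ! (i - 1)"

definition lambda_max :: "real mat \<Rightarrow> real" where
  "lambda_max A = lambda_i A 1"

definition mat_rank :: "real mat \<Rightarrow> nat" where
  "mat_rank A = vec_space.rank (dim_row A) A"

definition orthogonal_mat :: "nat \<Rightarrow> real mat \<Rightarrow> bool" where
  "orthogonal_mat k Q \<longleftrightarrow> Q \<in> carrier_mat k k \<and> Q\<^sup>T * Q = 1\<^sub>m k \<and> Q * Q\<^sup>T = 1\<^sub>m k"

definition mat_entries :: "nat \<Rightarrow> nat \<Rightarrow> real mat \<Rightarrow> (nat \<times> nat \<Rightarrow> real)" where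
  "mat_entries r c A = (\<lambda>(i,j). if i < r \<and> j < c then A $$ (i,j) else 0)"

definition mat_borel :: "nat \<Rightarrow> nat \<Rightarrow> real mat measure" where
  "mat_borel r c = vimage_algebra (carrier_mat r c) (mat_entries r c) borel"

text \<open>\<open>\<mu>\<close> is the uniform distribution on \<open>{W \<in> \<real>^{r\<times>c}. W^T W = s I_c}\<close> (\<open>c \<le> r\<close>):
  a probability measure concentrated on that set and invariant under left
  multiplication by orthogonal \<open>r\<times>r\<close> matrices (this invariance characterises the
  uniform/Haar measure uniquely, since \<open>O(r)\<close> acts transitively).\<close>
definition uniform_cols :: "nat \<Rightarrow> nat \<Rightarrow> real \<Rightarrow> real mat measure \<Rightarrow> bool" where
  "uniform_cols r c s \<mu> \<longleftrightarrow>
     prob_space \<mu> \<and> sets \<mu> = sets (mat_borel r c) \<and>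
     (AE A in \<mu>. A\<^sup>T * A = s \<cdot>\<^sub>m 1\<^sub>m c) \<and>
     (\<forall>Q. orthogonal_mat r Q \<longrightarrow>
        (\<forall>B \<in> sets \<mu>. measure \<mu> {A \<in> space \<mu>. Q * A \<in> B} = measure \<mu> B))"

definition uniform_rows :: "nat \<Rightarrow> nat \<Rightarrow> real \<Rightarrow> real mat measure \<Rightarrow> bool" where
  "uniform_rows r c s \<mu> \<longleftrightarrow>
     prob_space \<mu> \<and> sets \<mu> = sets (mat_borel r c) \<and>
     (AE A in \<mu>. A * A\<^sup>T = s \<cdot>\<^sub>m 1\<^sub>m r) \<and>
     (\<forall>Q. orthogonal_mat c Q \<longrightarrow>
        (\<forall>B \<in> sets \<mu>. measure \<mu> {A \<in> space \<mu>. A * Q \<in> B} = measure \<mu> B))"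

definition uniform_square :: "nat \<Rightarrow> real \<Rightarrow> real mat measure \<Rightarrow> bool" where
  "uniform_square k s \<mu> \<longleftrightarrow>
     prob_space \<mu> \<and> sets \<mu> = sets (mat_borel k k) \<and>
     (AE A in \<mu>. A\<^sup>T * A = s \<cdot>\<^sub>m 1\<^sub>m k \<and> A * A\<^sup>T = s \<cdot>\<^sub>m 1\<^sub>m k) \<and>
     (\<forall>Q. orthogonal_mat k Q \<longrightarrow>
        (\<forall>B \<in> sets \<mu>. measure \<mu> {A \<in> space \<mu>. Q * A \<in> B} = measure \<mu> B))"

fun chain :: "(nat \<Rightarrow> real mat) \<Rightarrow> nat \<Rightarrow> nat \<Rightarrow> real mat" where
  "chain W d 0 = 1\<^sub>m d"
| "chain W d (Suc k) = W (Suc k) * chain W d k"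

definition net_alpha :: "nat \<Rightarrow> nat \<Rightarrow> nat \<Rightarrow> real" where
  "net_alpha m L dy = 1 / sqrt (real m ^ (L - 1) * real dy)"

definition net_loss :: "real \<Rightarrow> real mat \<Rightarrow> real mat \<Rightarrow> nat \<Rightarrow> (nat \<Rightarrow> real mat) \<Rightarrow> real" where
  "net_loss \<alpha> X Y L W = (1/2) * (fro_norm (\<alpha> \<cdot>\<^sub>m chain W (dim_row X) L * X - Y))^2"

definition perturb :: "(nat \<Rightarrow> real mat) \<Rightarrow> nat \<Rightarrow> nat \<Rightarrow> nat \<Rightarrow> real \<Rightarrow> (nat \<Rightarrow> real mat)" where
  "perturb W i j k s = W(i := mat (dim_row (W i)) (dim_col (W i))
      (\<lambda>(a,b). W i $$ (a,b) + (if (a,b) = (j,k) then s else 0)))"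

definition partial_grad :: "((nat \<Rightarrow> real mat) \<Rightarrow> real) \<Rightarrow> (nat \<Rightarrow> real mat) \<Rightarrow> nat \<Rightarrow> real mat" where
  "partial_grad F W i = mat (dim_row (W i)) (dim_col (W i))
      (\<lambda>(j,k). deriv (\<lambda>s. F (perturb W i j k s)) 0)"

fun gd :: "((nat \<Rightarrow> real mat) \<Rightarrow> real) \<Rightarrow> real \<Rightarrow> nat \<Rightarrow> (nat \<Rightarrow> real mat) \<Rightarrow> nat \<Rightarrow> (nat \<Rightarrow> real mat)" where
  "gd F \<eta> L W0 0 = W0"
| "gd F \<eta> L W0 (Suc t) =
     (\<lambda>i. if i \<in> {1..L} then gd F \<eta> L W0 t i - \<eta> \<cdot>\<^sub>m partial_grad F (gd F \<eta> L W0 t) i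
          else gd F \<eta> L W0 t i)"

end

theory Submission
  imports Defs
begin

text \<open>
  Orthogonal initialization makes all partial products of the layers scaled isometries. As long as
  every layer stays within Frobenius distance \<open>O(sqrt m / L)\<close> of its start, the products stay
  almost isometric, and then one gradient step contracts the residual
  \<open>\<alpha> W_L \<cdots> W_1 X - W* X\<close> by a factor \<open>1 - q / 2\<close> with
  \<open>q = \<eta> L \<lambda>_r(X\<^sup>T X) / d_y\<close>: the first-order part of the step has inner product with the
  residual equal to minus \<open>\<eta>\<close> times the squared gradient norm, and the remainder is quadratic in the step.
  Summing the geometric series of the steps shows that the layers never leave that neighbourhood,
  provided the initial residual is at most a small multiple of
  \<open>\<lambda>_r sqrt m / (\<parallel>X\<parallel> sqrt d_y)\<close>.

  The initial residual is controlled by the last layer alone, since the others act isometrically.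
  Its law is invariant under the orthogonal group, so a unit vector fed into it may be replaced by a
  normalised vector of random signs; for these, an exponential moment of the squared output norm is
  bounded for each fixed matrix with orthonormal rows. Jensen's inequality over the columns of the
  data and Markov's inequality give the tail bound.
\<close>

subsection \<open>Frobenius inner product and norm\<close>

text \<open>The last layer is known only through its invariance, so there is no density to integrate
  against. Sign vectors get around this: they form a finite set of vectors of equal length, so the
  average over them is a finite sum that commutes with the integral, and its bound needs only
  Gaussian integrals in one real variable. As Jensen treats all columns at once, the tail bound
  involves ln (1 / \<delta>); the term ln (r / \<delta>) of the theorem dominates it because r \<ge>
  1.

  The target Y is replaced by W* X because W* X - Y is orthogonal to every matrix of the form A X.
  Hence the excess loss is exactly half the squared residual norm, and the gradient does not see the
  difference. The new residual has its rows in the row space of X, where the least nonzero singular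
  value of X gives a lower bound even if X is rank deficient.

  Constants: partial products may drift by two percent (51/50 and 49/50), for which L times the
  movement of a layer must stay below sqrt m / 100; this leads to the 250 in the smallness
  condition. Then C = 500000 = 8 * 250^2, where 8 is twice the constant C' = 4.\<close>

lemma mat_mult_entry:
  assumes "A \<in> carrier_mat r k" "B \<in> carrier_mat k c" "i < r" "j < c"
  shows "(A * B) $$ (i, j) = (\<Sum>l<k. A $$ (i, l) * (B $$ (l, j) :: real))"
  using assms by (simp add: scalar_prod_def lessThan_atLeast0)

definition fro_inner :: "real mat \<Rightarrow> real mat \<Rightarrow> real" where
  "fro_inner A B = (\<Sum>i<dim_row A. \<Sum>j<dim_col A. A $$ (i, j) * B $$ (i, j))"

lemma fro_norm_square: "(fro_norm A)\<^sup>2 = fro_inner A A"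
  unfolding fro_norm_def fro_inner_def
  by (subst real_sqrt_pow2) (auto intro!: sum_nonneg simp: power2_eq_square)

lemma fro_norm_square_sum:
  assumes "A \<in> carrier_mat r c"
  shows "(fro_norm A)\<^sup>2 = (\<Sum>i<r. \<Sum>j<c. (A $$ (i, j))\<^sup>2)"
  unfolding fro_norm_square fro_inner_def using assms by (simp add: power2_eq_square)

lemma fro_norm_nonneg [simp]: "0 \<le> fro_norm A"
  unfolding fro_norm_def by (auto intro!: sum_nonneg)

lemma fro_norm_eq_sqrt: "fro_norm A = sqrt (fro_inner A A)"
  by (metis fro_norm_square fro_norm_nonneg real_sqrt_unique)

lemma fro_inner_sym:
  assumes "A \<in> carrier_mat r c" "B \<in> carrier_mat r c"
  shows "fro_inner A B = fro_inner B A"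
  using assms by (simp add: fro_inner_def mult.commute)

lemma fro_inner_add_left:
  assumes "A \<in> carrier_mat r c" "B \<in> carrier_mat r c" "C \<in> carrier_mat r c"
  shows "fro_inner (A + B) C = fro_inner A C + fro_inner B C"
  using assms by (simp add: fro_inner_def ring_distribs sum.distrib)

lemma fro_inner_add_right:
  assumes "A \<in> carrier_mat r c" "B \<in> carrier_mat r c" "C \<in> carrier_mat r c"
  shows "fro_inner C (A + B) = fro_inner C A + fro_inner C B"
  using assms by (simp add: fro_inner_def ring_distribs sum.distrib)

lemma fro_inner_smult_left:
  "fro_inner (a \<cdot>\<^sub>m A) B = a * fro_inner A B"
  by (simp add: fro_inner_def sum_distrib_left mult.assoc)

lemma fro_inner_smult_right:
  assumes "A \<in> carrier_mat r c" "B \<in> carrier_mat r c"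
  shows "fro_inner A (a \<cdot>\<^sub>m B) = a * fro_inner A B"
  using assms by (simp add: fro_inner_def sum_distrib_left mult_ac)

lemma fro_inner_transpose:
  assumes "A \<in> carrier_mat r c" "B \<in> carrier_mat r c"
  shows "fro_inner A\<^sup>T B\<^sup>T = fro_inner A B"
  using assms sum.swap[of "\<lambda>i j. A $$ (j, i) * B $$ (j, i)" "{..<r}" "{..<c}"]
  by (simp add: fro_inner_def)

text \<open>Multiplication by the transpose is adjoint to multiplication by \<open>A\<close>.
  Together with its right-hand twin this moves factors across the inner product, which is how the
  gradient and the normal equation arise later.\<close>

lemma fro_inner_mult_left:
  assumes A: "A \<in> carrier_mat r k" and B: "B \<in> carrier_mat k c" and C: "C \<in> carrier_mat r c"
  shows "fro_inner (A * B) C = fro_inner B (A\<^sup>T * C)"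
proof -
  have "fro_inner (A * B) C = (\<Sum>i<r. \<Sum>j<c. \<Sum>l<k. A $$ (i, l) * B $$ (l, j) * C $$ (i, j))"
    unfolding fro_inner_def using assms
    by (auto intro!: sum.cong simp: mat_mult_entry[OF A B] sum_distrib_right simp del: index_mult_mat(1))
  also have "\<dots> = (\<Sum>i<r. \<Sum>l<k. \<Sum>j<c. A $$ (i, l) * B $$ (l, j) * C $$ (i, j))"
    by (intro sum.cong refl sum.swap)
  also have "\<dots> = (\<Sum>l<k. \<Sum>i<r. \<Sum>j<c. A $$ (i, l) * B $$ (l, j) * C $$ (i, j))"
    by (rule sum.swap)
  also have "\<dots> = (\<Sum>l<k. \<Sum>j<c. \<Sum>i<r. A $$ (i, l) * B $$ (l, j) * C $$ (i, j))"
    by (intro sum.cong refl sum.swap)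
  also have "\<dots> = fro_inner B (A\<^sup>T * C)"
    unfolding fro_inner_def using assms
    by (auto intro!: sum.cong simp: mat_mult_entry[of "A\<^sup>T" k r C c] sum_distrib_left mult_ac
        simp del: index_mult_mat(1))
  finally show ?thesis .
qed

lemma fro_norm_transpose [simp]: "fro_norm A\<^sup>T = fro_norm A"
  by (simp add: fro_norm_eq_sqrt fro_inner_transpose[of A "dim_row A" "dim_col A"])

lemma fro_inner_mult_right:
  assumes A: "A \<in> carrier_mat k c" and B: "B \<in> carrier_mat r k" and C: "C \<in> carrier_mat r c"
  shows "fro_inner (B * A) C = fro_inner B (C * A\<^sup>T)"
proof -
  have "fro_inner (B * A) C = fro_inner (A\<^sup>T * B\<^sup>T) C\<^sup>T"
    using assms fro_inner_transpose[of "B * A" r c C] transpose_mult[OF B A] by simp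
  also have "\<dots> = fro_inner B\<^sup>T (A * C\<^sup>T)"
    using assms fro_inner_mult_left[of "A\<^sup>T" c k "B\<^sup>T" r "C\<^sup>T"] by simp
  also have "\<dots> = fro_inner B (C * A\<^sup>T)"
    using assms fro_inner_transpose[of B r k "C * A\<^sup>T"] transpose_mult[of C r c "A\<^sup>T" k] by simp
  finally show ?thesis .
qed

lemma fro_norm_add_square:
  assumes "A \<in> carrier_mat r c" "B \<in> carrier_mat r c"
  shows "(fro_norm (A + B))\<^sup>2 = (fro_norm A)\<^sup>2 + 2 * fro_inner A B + (fro_norm B)\<^sup>2"
  using assms by (simp add: fro_norm_square fro_inner_add_left[of _ r c] fro_inner_add_right[of _ r c]
      fro_inner_sym[of B r c A])

lemma fro_norm_smult: "fro_norm (a \<cdot>\<^sub>m A) = \<bar>a\<bar> * fro_norm A"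
proof -
  have "fro_inner (a \<cdot>\<^sub>m A) (a \<cdot>\<^sub>m A) = a\<^sup>2 * fro_inner A A"
    by (simp add: fro_inner_smult_left fro_inner_smult_right[of A "dim_row A" "dim_col A"]
        power2_eq_square)
  then show ?thesis by (simp add: fro_norm_eq_sqrt real_sqrt_mult)
qed

lemma fro_Cauchy_Schwarz:
  assumes A: "A \<in> carrier_mat r c" and B: "B \<in> carrier_mat r c"
  shows "\<bar>fro_inner A B\<bar> \<le> fro_norm A * fro_norm B"
proof -
  let ?S = "{..<r} \<times> {..<c}"
  have inn: "fro_inner M N = (\<Sum>p\<in>?S. M $$ p * N $$ p)" if "M \<in> carrier_mat r c" for M N
    using that by (simp add: fro_inner_def sum.cartesian_product case_prod_unfold)
  have "(fro_inner A B)\<^sup>2 \<le> fro_inner A A * fro_inner B B"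
    using Cauchy_Schwarz_ineq_sum[of "\<lambda>p. A $$ p" "\<lambda>p. B $$ p" ?S]
    by (simp add: inn A B power2_eq_square)
  also have "\<dots> = (fro_norm A * fro_norm B)\<^sup>2"
    by (simp add: power_mult_distrib fro_norm_square)
  finally show ?thesis using abs_le_square_iff by (metis abs_of_nonneg fro_norm_nonneg mult_nonneg_nonneg)
qed

lemma fro_norm_triangle:
  assumes "A \<in> carrier_mat r c" "B \<in> carrier_mat r c"
  shows "fro_norm (A + B) \<le> fro_norm A + fro_norm B"
proof (rule power2_le_imp_le)
  show "(fro_norm (A + B))\<^sup>2 \<le> (fro_norm A + fro_norm B)\<^sup>2"
    using fro_Cauchy_Schwarz[OF assms] unfolding fro_norm_add_square[OF assms] power2_sum by linarith
qed simp

lemma fro_norm_uminus: "fro_norm (- A) = fro_norm A"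
  by (simp add: fro_norm_def)

lemma mat_diff_split:
  fixes A B C :: "real mat"
  assumes "A \<in> carrier_mat r c" "B \<in> carrier_mat r c" "C \<in> carrier_mat r c"
  shows "A - C = (A - B) + (B - C)"
  using assms by (intro eq_matI) auto

lemma fro_norm_triangle_diff:
  assumes "A \<in> carrier_mat r c" "B \<in> carrier_mat r c" "C \<in> carrier_mat r c"
  shows "fro_norm (A - C) \<le> fro_norm (A - B) + fro_norm (B - C)"
  unfolding mat_diff_split[OF assms] 
  by (rule fro_norm_triangle[of _ r c]) (auto intro: minus_carrier_mat assms)

lemma fro_norm_zero [simp]: "fro_norm (0\<^sub>m r c) = 0"
  by (simp add: fro_norm_def)

lemma fro_norm_eq_0D:
  assumes "A \<in> carrier_mat r c" "fro_norm A = 0"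
  shows "A = 0\<^sub>m r c"
proof (rule eq_matI)
  fix i j assume ij: "i < dim_row (0\<^sub>m r c :: real mat)" "j < dim_col (0\<^sub>m r c :: real mat)"
  have "(\<Sum>i<r. \<Sum>j<c. (A $$ (i, j))\<^sup>2) = 0" using assms by (simp add: fro_norm_def)
  then have "\<forall>i<r. \<forall>j<c. (A $$ (i, j))\<^sup>2 = 0"
    by (subst (asm) sum_nonneg_eq_0_iff) (auto simp: sum_nonneg sum_nonneg_eq_0_iff)
  then show "A $$ (i, j) = 0\<^sub>m r c $$ (i, j)" using ij by simp
qed (use assms in auto)

subsection \<open>Operator bounds\<close>

text \<open>Bounds on the largest and smallest singular value, tested against matrices instead of
  vectors, so that only Frobenius norms occur.\<close>

definition op_le :: "real mat \<Rightarrow> real \<Rightarrow> bool" where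
  "op_le A a \<longleftrightarrow> 0 \<le> a \<and> (\<forall>k. \<forall>B \<in> carrier_mat (dim_col A) k. fro_norm (A * B) \<le> a * fro_norm B)"

definition op_ge :: "real mat \<Rightarrow> real \<Rightarrow> bool" where
  "op_ge A a \<longleftrightarrow> (\<forall>k. \<forall>B \<in> carrier_mat (dim_col A) k. a * fro_norm B \<le> fro_norm (A * B))"

lemma op_le_nonneg: "op_le A a \<Longrightarrow> 0 \<le> a"
  by (simp add: op_le_def)

lemma op_leD:
  assumes "op_le A a" "A \<in> carrier_mat r k" "B \<in> carrier_mat k c"
  shows "fro_norm (A * B) \<le> a * fro_norm B"
  using assms by (auto simp: op_le_def)

lemma op_geD:
  assumes "op_ge A a" "A \<in> carrier_mat r k" "B \<in> carrier_mat k c"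
  shows "a * fro_norm B \<le> fro_norm (A * B)"
  using assms by (auto simp: op_ge_def)

lemma op_le_mono: "op_le A a \<Longrightarrow> a \<le> b \<Longrightarrow> op_le A b"
  unfolding op_le_def by (meson fro_norm_nonneg mult_right_mono order_trans)

text \<open>With C = A^T B one has |C|^2 = <A C, B> \<le> a |C| |B|, and one factor |C| cancels.
  Thus an upper bound serves for multiplication from either side.\<close>

lemma op_le_transpose:
  assumes "op_le A a"
  shows "op_le A\<^sup>T a"
  unfolding op_le_def
proof (intro conjI allI ballI)
  show a0: "0 \<le> a" using assms by (simp add: op_le_def)
  fix k and B :: "real mat" assume B: "B \<in> carrier_mat (dim_col A\<^sup>T) k"
  have A: "A \<in> carrier_mat (dim_row A) (dim_col A)" by simp
  let ?C = "A\<^sup>T * B"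
  have B': "B \<in> carrier_mat (dim_row A) k" using B by simp
  have C: "?C \<in> carrier_mat (dim_col A) k" using B by auto
  have "(fro_norm ?C)\<^sup>2 = fro_inner (A * ?C) B"
    using fro_inner_mult_left[OF A C B'] by (simp add: fro_norm_square)
  also have "\<dots> \<le> fro_norm (A * ?C) * fro_norm B"
    using fro_Cauchy_Schwarz[of "A * ?C" "dim_row A" k B] A C B' by (meson abs_le_D1 mult_carrier_mat)
  also have "\<dots> \<le> (a * fro_norm ?C) * fro_norm B"
    using op_leD[OF assms A C] by (intro mult_right_mono) auto
  finally have "fro_norm ?C * fro_norm ?C \<le> fro_norm ?C * (a * fro_norm B)"
    by (simp add: power2_eq_square mult_ac)
  then show "fro_norm ?C \<le> a * fro_norm B"
    using a0 by (cases "fro_norm ?C = 0") (auto simp: mult_le_cancel_left less_le)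
qed

lemma op_leD_right:
  assumes "op_le A a" "A \<in> carrier_mat k c" "B \<in> carrier_mat r k"
  shows "fro_norm (B * A) \<le> a * fro_norm B"
  using op_leD[OF op_le_transpose[OF assms(1)], of c k "B\<^sup>T" r] assms
    transpose_mult[of B r k A c] fro_norm_transpose[of "B * A"] by simp

text \<open>The hypothesis is on the transpose because a lower bound, unlike an upper one, does not
  pass to it: the transpose of a tall isometry has a kernel.\<close>

lemma op_geD_right:
  assumes "op_ge A\<^sup>T a" "A \<in> carrier_mat k c" "B \<in> carrier_mat r k"
  shows "a * fro_norm B \<le> fro_norm (B * A)"
  using op_geD[OF assms(1), of c k "B\<^sup>T" r] assms
    transpose_mult[of B r k A c] fro_norm_transpose[of "B * A"] by simp

lemma op_le_mult:
  assumes "op_le A a" "op_le B b" "A \<in> carrier_mat r k" "B \<in> carrier_mat k c"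
  shows "op_le (A * B) (a * b)"
  unfolding op_le_def
proof (intro conjI allI ballI)
  show "0 \<le> a * b" using assms by (simp add: op_le_def)
  fix j and C :: "real mat" assume "C \<in> carrier_mat (dim_col (A * B)) j"
  then have C: "C \<in> carrier_mat c j" using assms by simp
  have "fro_norm (A * B * C) = fro_norm (A * (B * C))"
    using assms C by (simp add: assoc_mult_mat[of _ r k])
  also have "\<dots> \<le> a * fro_norm (B * C)" using assms C by (intro op_leD[of _ _ r k]) auto
  also have "\<dots> \<le> a * (b * fro_norm C)"
    using assms C by (intro mult_left_mono op_leD[of _ _ k c]) (auto simp: op_le_def)
  finally show "fro_norm (A * B * C) \<le> a * b * fro_norm C" by simp
qed

lemma op_le_add:
  assumes "op_le A a" "op_le B b" "A \<in> carrier_mat r c" "B \<in> carrier_mat r c"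
  shows "op_le (A + B) (a + b)"
  unfolding op_le_def
proof (intro conjI allI ballI)
  show "0 \<le> a + b" using assms by (simp add: op_le_def)
  fix j and C :: "real mat" assume "C \<in> carrier_mat (dim_col (A + B)) j"
  then have C: "C \<in> carrier_mat c j" using assms by simp
  have "fro_norm ((A + B) * C) \<le> fro_norm (A * C) + fro_norm (B * C)"
    using assms C fro_norm_triangle[of "A * C" r j "B * C"]
    by (simp add: add_mult_distrib_mat[of A r c B C j])
  then show "fro_norm ((A + B) * C) \<le> (a + b) * fro_norm C"
    using op_leD[OF assms(1,3) C] op_leD[OF assms(2,4) C] by (simp add: distrib_right)
qed

lemma op_ge_add:
  assumes "op_ge A a" "op_le B b" "A \<in> carrier_mat r c" "B \<in> carrier_mat r c"
  shows "op_ge (A + B) (a - b)"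
  unfolding op_ge_def
proof (intro allI ballI)
  fix j and C :: "real mat" assume "C \<in> carrier_mat (dim_col (A + B)) j"
  then have C: "C \<in> carrier_mat c j" using assms by simp
  have "A * C = (A + B) * C + (- (B * C))"
    using assms C by (simp add: add_mult_distrib_mat[of A r c B C j]) (intro eq_matI, auto)
  then have "fro_norm (A * C) \<le> fro_norm ((A + B) * C) + fro_norm (B * C)"
    using assms C mult_carrier_mat[of "A + B" r c C j] fro_norm_triangle[of "(A + B) * C" r j "- (B * C)"]
    by (simp add: fro_norm_uminus)
  then show "(a - b) * fro_norm C \<le> fro_norm ((A + B) * C)"
    using op_geD[OF assms(1,3) C] op_leD[OF assms(2,4) C] by (simp add: left_diff_distrib)
qed

lemma op_le_one: "op_le (1\<^sub>m n) 1"
  by (simp add: op_le_def)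

lemma fro_norm_mult_le:
  assumes A: "A \<in> carrier_mat r k" and B: "B \<in> carrier_mat k c"
  shows "fro_norm (A * B) \<le> fro_norm A * fro_norm B"
proof (rule power2_le_imp_le)
  have "(fro_norm (A * B))\<^sup>2 = (\<Sum>i<r. \<Sum>j<c. (\<Sum>l<k. A $$ (i, l) * B $$ (l, j))\<^sup>2)"
    unfolding fro_norm_square fro_inner_def using A B
    by (auto intro!: sum.cong simp: mat_mult_entry[OF A B] power2_eq_square simp del: index_mult_mat(1))
  also have "\<dots> \<le> (\<Sum>i<r. \<Sum>j<c. (\<Sum>l<k. (A $$ (i, l))\<^sup>2) * (\<Sum>l<k. (B $$ (l, j))\<^sup>2))"
    by (intro sum_mono Cauchy_Schwarz_ineq_sum)
  also have "\<dots> = (\<Sum>i<r. \<Sum>l<k. (A $$ (i, l))\<^sup>2) * (\<Sum>j<c. \<Sum>l<k. (B $$ (l, j))\<^sup>2)"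
    by (simp add: sum_product)
  also have "\<dots> = (fro_norm A)\<^sup>2 * (fro_norm B)\<^sup>2"
    using A B sum.swap[of "\<lambda>j l. (B $$ (l, j))\<^sup>2" "{..<k}" "{..<c}"]
    unfolding fro_norm_square fro_inner_def by (simp add: power2_eq_square)
  finally show "(fro_norm (A * B))\<^sup>2 \<le> (fro_norm A * fro_norm B)\<^sup>2" by (simp add: power_mult_distrib)
qed simp

lemma op_le_fro_norm: "op_le A (fro_norm A)"
  by (auto simp: op_le_def intro: fro_norm_mult_le[of A "dim_row A" "dim_col A"])

lemma op_le_fro_bound: "fro_norm A \<le> a \<Longrightarrow> op_le A a"
  using op_le_fro_norm op_le_mono by blast

lemma fro_norm_scaled_isometry:
  assumes A: "A \<in> carrier_mat r c" and AA: "A\<^sup>T * A = s \<cdot>\<^sub>m 1\<^sub>m c" and s: "0 \<le> s"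
    and B: "B \<in> carrier_mat c k"
  shows "fro_norm (A * B) = sqrt s * fro_norm B"
proof -
  have "fro_inner (A * B) (A * B) = fro_inner B (A\<^sup>T * (A * B))"
    using A B by (intro fro_inner_mult_left) auto
  also have "A\<^sup>T * (A * B) = s \<cdot>\<^sub>m B"
    using A B AA assoc_mult_mat[of "A\<^sup>T" c r A c B k]
    by (metis carrier_matI index_transpose_mat(2) index_transpose_mat(3) carrier_matD left_mult_one_mat mult_smult_assoc_mat one_carrier_mat)
  finally show ?thesis
    using B by (simp add: fro_norm_eq_sqrt fro_inner_smult_right[of B c k] real_sqrt_mult)
qed

section \<open>Vector norm and spectral norm\<close>

lemma vnorm_nonneg [simp]: "0 \<le> vnorm v"
  unfolding vnorm_def by (auto intro!: sum_nonneg)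

lemma vnorm_square: "(vnorm v)\<^sup>2 = (\<Sum>i<dim_vec v. (v $ i)\<^sup>2)"
  unfolding vnorm_def by (subst real_sqrt_pow2) (auto intro!: sum_nonneg)

lemma vnorm_eq_fro_norm: "vnorm v = fro_norm (mat_of_cols (dim_vec v) [v])"
  by (simp add: vnorm_def fro_norm_def mat_of_cols_index)

lemma vnorm_mult_le:
  assumes "v \<in> carrier_vec (dim_col A)"
  shows "vnorm (A *\<^sub>v v) \<le> fro_norm A * vnorm v"
proof -
  have "mat_of_cols (dim_vec (A *\<^sub>v v)) [A *\<^sub>v v] = A * mat_of_cols (dim_vec v) [v]"
    using assms by (intro eq_matI) (auto simp: mat_of_cols_index scalar_prod_def)
  then show ?thesis using assms
    fro_norm_mult_le[of A "dim_row A" "dim_col A" "mat_of_cols (dim_vec v) [v]" 1]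
    mat_of_cols_carrier(1)[of "dim_col A" "[v]"]
    unfolding vnorm_eq_fro_norm by simp
qed

lemma vnorm_smult: "vnorm (a \<cdot>\<^sub>v v) = \<bar>a\<bar> * vnorm v"
  by (simp add: vnorm_def power_mult_distrib sum_distrib_left[symmetric] real_sqrt_mult)

text \<open>The supremum in \<open>spec_norm\<close> says something only for a set that is bounded
  above; the Frobenius norm is a crude bound that suffices.\<close>

lemma spec_norm_bdd: "bdd_above {vnorm (A *\<^sub>v v) | v. v \<in> carrier_vec (dim_col A) \<and> vnorm v \<le> 1}"
proof (rule bdd_aboveI, clarify)
  fix v assume v: "v \<in> carrier_vec (dim_col A)" "vnorm v \<le> 1"
  show "vnorm (A *\<^sub>v v) \<le> fro_norm A"
    using vnorm_mult_le[OF v(1)] mult_left_mono[OF v(2), of "fro_norm A"] by simp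
qed

lemma spec_norm_nonneg [simp]: "0 \<le> spec_norm A"
proof -
  have "vnorm (A *\<^sub>v 0\<^sub>v (dim_col A)) \<le> spec_norm A"
    unfolding spec_norm_def by (rule cSup_upper[OF _ spec_norm_bdd]) (intro CollectI exI[of _ "0\<^sub>v (dim_col A)"], simp add: vnorm_def)
  then show ?thesis using vnorm_nonneg order_trans by blast
qed

lemma vnorm_mult_le_spec_norm:
  assumes v: "v \<in> carrier_vec (dim_col A)"
  shows "vnorm (A *\<^sub>v v) \<le> spec_norm A * vnorm v"
proof (cases "vnorm v = 0")
  case True
  then show ?thesis using vnorm_mult_le[OF v] by simp
next
  case False
  then have pos: "0 < vnorm v" by (simp add: less_le)
  let ?u = "(1 / vnorm v) \<cdot>\<^sub>v v"
  have "vnorm (A *\<^sub>v ?u) \<le> spec_norm A"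
    unfolding spec_norm_def
    by (rule cSup_upper[OF _ spec_norm_bdd]) (use v pos in \<open>auto simp: vnorm_smult\<close>)
  moreover have "A *\<^sub>v ?u = (1 / vnorm v) \<cdot>\<^sub>v (A *\<^sub>v v)"
    using v by (intro mult_mat_vec[of _ "dim_row A" "dim_col A"]) auto
  ultimately show ?thesis using pos by (simp add: vnorm_smult field_simps)
qed

lemma spec_norm_le:
  assumes "\<And>v. v \<in> carrier_vec (dim_col A) \<Longrightarrow> vnorm v \<le> 1 \<Longrightarrow> vnorm (A *\<^sub>v v) \<le> c"
  shows "spec_norm A \<le> c"
  unfolding spec_norm_def
proof (rule cSup_least)
  have "vnorm (A *\<^sub>v 0\<^sub>v (dim_col A)) \<in> {vnorm (A *\<^sub>v v) |v. v \<in> carrier_vec (dim_col A) \<and> vnorm v \<le> 1}"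
    by (intro CollectI exI[of _ "0\<^sub>v (dim_col A)"]) (simp add: vnorm_def)
  then show "{vnorm (A *\<^sub>v v) |v. v \<in> carrier_vec (dim_col A) \<and> vnorm v \<le> 1} \<noteq> {}" by blast
qed (use assms in auto)

lemma fro_norm_square_cols:
  assumes "A \<in> carrier_mat r c"
  shows "(fro_norm A)\<^sup>2 = (\<Sum>j<c. (vnorm (col A j))\<^sup>2)"
  using assms sum.swap[of "\<lambda>i j. (A $$ (i, j))\<^sup>2" "{..<c}" "{..<r}"]
  by (simp add: fro_norm_square_sum[OF assms] vnorm_square)

text \<open>Squared Frobenius norms add over columns, so the vector bound applied to each column of
  \<open>B\<close> is enough. This is the passage from the supremum definition to bounds tested on
  matrices.\<close>

lemma op_le_spec_norm: "op_le A (spec_norm A)"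
  unfolding op_le_def
proof (intro conjI allI ballI)
  fix k and B :: "real mat" assume B: "B \<in> carrier_mat (dim_col A) k"
  show "fro_norm (A * B) \<le> spec_norm A * fro_norm B"
  proof (rule power2_le_imp_le)
    have "(fro_norm (A * B))\<^sup>2 = (\<Sum>j<k. (vnorm (A *\<^sub>v col B j))\<^sup>2)"
      using B by (subst fro_norm_square_cols[of _ "dim_row A" k]) (auto simp: col_mult2[of A "dim_row A" "dim_col A" B k])
    also have "\<dots> \<le> (\<Sum>j<k. (spec_norm A * vnorm (col B j))\<^sup>2)"
      using B by (intro sum_mono power_mono vnorm_mult_le_spec_norm) auto
    also have "\<dots> = (spec_norm A * fro_norm B)\<^sup>2"
      using fro_norm_square_cols[OF B] by (simp add: power_mult_distrib sum_distrib_left)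
    finally show "(fro_norm (A * B))\<^sup>2 \<le> (spec_norm A * fro_norm B)\<^sup>2" .
  qed simp
qed simp

subsection \<open>Spectral theorem and the Gram matrix\<close>

lemma orthogonal_mat_transpose: "orthogonal_mat n Q \<Longrightarrow> orthogonal_mat n Q\<^sup>T"
  by (auto simp: orthogonal_mat_def)

lemma orthogonal_mat_mult:
  assumes "orthogonal_mat n P" "orthogonal_mat n Q"
  shows "orthogonal_mat n (P * Q)"
proof -
  have c: "P \<in> carrier_mat n n" "Q \<in> carrier_mat n n"
    and e: "P\<^sup>T * P = 1\<^sub>m n" "P * P\<^sup>T = 1\<^sub>m n" "Q\<^sup>T * Q = 1\<^sub>m n" "Q * Q\<^sup>T = 1\<^sub>m n"
    using assms by (auto simp: orthogonal_mat_def)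
  have "(P * Q)\<^sup>T * (P * Q) = Q\<^sup>T * (P\<^sup>T * P) * Q"
    using c by (simp add: transpose_mult[OF c] assoc_mult_mat[of _ n n _ n _ n])
  moreover have "(P * Q) * (P * Q)\<^sup>T = P * (Q * Q\<^sup>T) * P\<^sup>T"
    using c by (simp add: transpose_mult[OF c] assoc_mult_mat[of _ n n _ n _ n])
  ultimately show ?thesis using c e by (simp add: orthogonal_mat_def)
qed

lemma orthogonal_mat_fro_norm:
  assumes "orthogonal_mat n Q" "B \<in> carrier_mat n k"
  shows "fro_norm (Q * B) = fro_norm B"
proof -
  have "1\<^sub>m n = (1 :: real) \<cdot>\<^sub>m 1\<^sub>m n" by (intro eq_matI) auto
  then show ?thesis
    using fro_norm_scaled_isometry[of Q n n 1 B k] assms by (auto simp: orthogonal_mat_def)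
qed

text \<open>The Householder reflection that swaps two vectors of equal length.\<close>
lemma orthogonal_mat_transitive:
  fixes f g :: "nat \<Rightarrow> real"
  assumes eq: "(\<Sum>i<n. (f i)\<^sup>2) = (\<Sum>i<n. (g i)\<^sup>2)"
  obtains Q where "orthogonal_mat n Q" "\<And>i. i < n \<Longrightarrow> (\<Sum>j<n. Q $$ (i, j) * f j) = g i"
proof -
  define w where "w = (\<lambda>i. f i - g i)"
  define S where "S = (\<Sum>i<n. (w i)\<^sup>2)"
  \<comment> \<open>If the two vectors agree then \<open>S = 0\<close>, division by zero gives
    \<open>c = 0\<close>, and \<open>Q\<close> is the identity.\<close>
  define c where "c = 2 / S"
  define Q where "Q = mat n n (\<lambda>(i, j). (if i = j then 1 else 0) - c * w i * w j)"
  have c2: "c * c * S = 2 * c" by (cases "S = 0") (auto simp: c_def)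
  have Qc: "Q \<in> carrier_mat n n" by (simp add: Q_def)
  have QT: "Q\<^sup>T = Q" by (rule eq_matI) (auto simp: Q_def mult_ac)
  have "Q * Q = 1\<^sub>m n"
  proof (rule eq_matI)
    fix i j assume "i < dim_row (1\<^sub>m n :: real mat)" "j < dim_col (1\<^sub>m n :: real mat)"
    then have ij: "i < n" "j < n" by auto
    have "(Q * Q) $$ (i, j) = (\<Sum>l<n. ((if i = l then 1 else 0) - c * w i * w l) * ((if l = j then 1 else 0) - c * w l * w j))"
      using ij unfolding mat_mult_entry[OF Qc Qc ij] by (intro sum.cong) (auto simp: Q_def)
    also have "\<dots> = (\<Sum>l<n. (if i = l then (if l = j then 1 else 0) - c * w l * w j else 0)
        - (if l = j then c * w i * w l else 0) + c * c * w i * w j * (w l)\<^sup>2)"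
      by (intro sum.cong) (auto simp: algebra_simps power2_eq_square)
    also have "\<dots> = (if i = j then 1 else 0) - 2 * c * w i * w j + c * c * S * w i * w j"
      using ij by (simp add: sum.distrib sum_subtractf S_def sum_distrib_left[symmetric] mult_ac)
    finally show "(Q * Q) $$ (i, j) = 1\<^sub>m n $$ (i, j)" using ij by (simp add: c2)
  qed (auto simp: Q_def)
  then have "orthogonal_mat n Q" using Qc QT by (simp add: orthogonal_mat_def)
  moreover have "(\<Sum>j<n. Q $$ (i, j) * f j) = g i" if i: "i < n" for i
  proof -
    \<comment> \<open>Equal lengths turn |f - g|^2 into 2 <f - g, f>, so the reflection subtracts
      exactly \<open>w\<close> from \<open>f\<close>.\<close>
    have "S = 2 * (\<Sum>j<n. w j * f j)"
      using eq unfolding S_def w_def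
      by (simp add: sum.distrib sum_subtractf power2_eq_square algebra_simps sum_distrib_left)
    then have wf: "c * (\<Sum>j<n. w j * f j) * w i = w i" if "S \<noteq> 0"
      using that by (simp add: c_def)
    have w0: "w i = 0" if "S = 0"
      using that i by (simp add: S_def sum_nonneg_eq_0_iff)
    have "(\<Sum>j<n. Q $$ (i, j) * f j) = (\<Sum>j<n. (if i = j then f j else 0) - c * w i * (w j * f j))"
      using i by (intro sum.cong) (auto simp: Q_def algebra_simps)
    also have "\<dots> = f i - c * (\<Sum>j<n. w j * f j) * w i"
      using i by (simp add: sum_subtractf sum_distrib_left[symmetric])
    also have "\<dots> = g i" using wf w0 by (cases "S = 0") (auto simp: w_def)
    finally show ?thesis .
  qed
  ultimately show ?thesis using that by blast
qed

text \<open>An eigenvalue exists over the complex numbers. Symmetry makes it real, and then the real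
  and the imaginary part of the eigenvector both solve the real equation; one of them is nonzero and
  gets normalised.\<close>

lemma symmetric_mat_eigenvector_ex:
  fixes A :: "real mat"
  assumes A: "A \<in> carrier_mat n n" and sym: "A\<^sup>T = A" and n: "0 < n"
  obtains f and a :: real where "(\<Sum>i<n. (f i)\<^sup>2) = 1" "\<And>i. i < n \<Longrightarrow> (\<Sum>j<n. A $$ (i, j) * f j) = a * f i"
proof -
  let ?B = "map_mat complex_of_real A"
  have B: "?B \<in> carrier_mat n n" using A by simp
  have symi: "A $$ (i, j) = A $$ (j, i)" if "i < n" "j < n" for i j
    using A that arg_cong[OF sym, of "\<lambda>M. M $$ (i, j)"] by simp
  obtain as where as: "char_poly ?B = (\<Prod>a\<leftarrow>as. [:- a, 1:])" "length as = n"
    using char_poly_factorized[OF B] by blast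
  then obtain z zs where "as = z # zs" using n by (cases as) auto
  then have "poly (char_poly ?B) z = 0" using as by simp
  then have "eigenvalue ?B z" using eigenvalue_root_char_poly[OF B] by simp
  then obtain v where v: "v \<in> carrier_vec n" "v \<noteq> 0\<^sub>v n" "?B *\<^sub>v v = z \<cdot>\<^sub>v v"
    using B by (auto simp: eigenvalue_def eigenvector_def)
  define u where "u = (\<lambda>i. v $ i)"
  have ev: "(\<Sum>j<n. of_real (A $$ (i, j)) * u j) = z * u i" if "i < n" for i
    using arg_cong[OF v(3), of "\<lambda>x. x $ i"] that v(1) A
    by (simp add: scalar_prod_def u_def lessThan_atLeast0)
  obtain i0 where i0: "i0 < n" "u i0 \<noteq> 0"
    using v(1,2) by (auto simp: u_def vec_eq_iff)
  define S where "S = (\<Sum>i<n. cnj (u i) * u i)"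
  have S: "S = of_real (\<Sum>i<n. (norm (u i))\<^sup>2)"
    by (simp add: S_def complex_norm_square[symmetric] mult.commute)
  have "0 < (\<Sum>i<n. (norm (u i))\<^sup>2)"
    using i0 by (intro sum_pos2[of _ i0]) auto
  then have S0: "S \<noteq> 0" unfolding S by (metis less_irrefl of_real_eq_0_iff)
  have zS: "z * S = (\<Sum>i<n. \<Sum>j<n. of_real (A $$ (i, j)) * (cnj (u i) * u j))"
    unfolding S_def sum_distrib_left
  proof (rule sum.cong[OF refl], goal_cases)
    case (1 i)
    then have "z * (cnj (u i) * u i) = cnj (u i) * (\<Sum>j<n. of_real (A $$ (i, j)) * u j)"
      using ev[of i] by simp
    then show ?case by (simp add: sum_distrib_left mult_ac)
  qed
  \<comment> \<open>\<open>z * S\<close> is the Hermitian form of a real symmetric matrix, so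
    conjugation merely swaps the two summation indices.\<close>
  have "cnj (z * S) = (\<Sum>i<n. \<Sum>j<n. of_real (A $$ (i, j)) * (u i * cnj (u j)))"
    unfolding zS by simp
  also have "\<dots> = (\<Sum>j<n. \<Sum>i<n. of_real (A $$ (i, j)) * (u i * cnj (u j)))"
    by (rule sum.swap)
  also have "\<dots> = z * S" unfolding zS
    by (intro sum.cong refl) (auto simp: symi mult_ac)
  finally have "cnj z * S = z * S" by (simp add: S_def mult.commute)
  then have "cnj z = z" using S0 by simp
  then obtain a where a: "z = of_real a" by (metis Reals_cases Reals_cnj_iff)
  have re: "(\<Sum>j<n. A $$ (i, j) * Re (u j)) = a * Re (u i)"
    and im: "(\<Sum>j<n. A $$ (i, j) * Im (u j)) = a * Im (u i)" if "i < n" for i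
    using arg_cong[OF ev[OF that], of Re] arg_cong[OF ev[OF that], of Im] by (auto simp: a)
  have "\<exists>f. f i0 \<noteq> 0 \<and> (\<forall>i<n. (\<Sum>j<n. A $$ (i, j) * f j) = a * f i)"
  proof (cases "Re (u i0) = 0")
    case True
    then have "Im (u i0) \<noteq> 0" using i0 complex_eq_iff by auto
    then show ?thesis using im by (intro exI[of _ "\<lambda>i. Im (u i)"]) auto
  next
    case False
    then show ?thesis using re by (intro exI[of _ "\<lambda>i. Re (u i)"]) auto
  qed
  then obtain f where f: "f i0 \<noteq> 0" "\<And>i. i < n \<Longrightarrow> (\<Sum>j<n. A $$ (i, j) * f j) = a * f i" by blast
  define s where "s = sqrt (\<Sum>i<n. (f i)\<^sup>2)"
  have pos: "0 < (\<Sum>i<n. (f i)\<^sup>2)" using f i0 by (intro sum_pos2[of _ i0]) auto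
  then have s2: "s\<^sup>2 = (\<Sum>i<n. (f i)\<^sup>2)" "s \<noteq> 0" by (auto simp: s_def)
  show ?thesis
  proof (rule that[of "\<lambda>i. f i / s" a])
    have "(\<Sum>i<n. (f i / s)\<^sup>2) = (\<Sum>i<n. (f i)\<^sup>2) / s\<^sup>2"
      by (simp add: power_divide sum_divide_distrib)
    then show "(\<Sum>i<n. (f i / s)\<^sup>2) = 1" using s2 pos by simp
    show "(\<Sum>j<n. A $$ (i, j) * (f j / s)) = a * (f i / s)" if "i < n" for i
      using f(2)[OF that] by (simp add: sum_divide_distrib[symmetric])
  qed
qed

text \<open>Deflation: a reflection taking the first basis vector to a unit eigenvector splits off a
  block of size one, since symmetry clears the first row along with the first column.\<close>

theorem real_spectral_theorem:
  fixes A :: "real mat"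
  assumes "A \<in> carrier_mat n n" "A\<^sup>T = A"
  shows "\<exists>Q d. orthogonal_mat n Q \<and> Q\<^sup>T * A * Q = mat_diag n d"
  using assms
proof (induction n arbitrary: A)
  case 0
  then have "orthogonal_mat 0 (1\<^sub>m 0) \<and> (1\<^sub>m 0)\<^sup>T * A * 1\<^sub>m 0 = mat_diag 0 (\<lambda>_. 0)"
    by (auto simp: orthogonal_mat_def mat_diag_def intro!: eq_matI)
  then show ?case by blast
next
  case (Suc n)
  note A = Suc.prems(1)
  obtain f a where f: "(\<Sum>i<Suc n. (f i)\<^sup>2) = 1"
    and ev: "\<And>i. i < Suc n \<Longrightarrow> (\<Sum>j<Suc n. A $$ (i, j) * f j) = a * f i"
    using symmetric_mat_eigenvector_ex[OF Suc.prems] by blast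
  have "(\<Sum>i<Suc n. (if i = 0 then 1 else 0 :: real)\<^sup>2) = (\<Sum>i<Suc n. (f i)\<^sup>2)"
    using f unfolding sum.lessThan_Suc_shift by simp
  then obtain H where H: "orthogonal_mat (Suc n) H"
    and Hf: "\<And>i. i < Suc n \<Longrightarrow> (\<Sum>j<Suc n. H $$ (i, j) * (if j = 0 then 1 else 0)) = f i"
    by (rule orthogonal_mat_transitive) blast
  have Hc: "H \<in> carrier_mat (Suc n) (Suc n)" and HH: "H\<^sup>T * H = 1\<^sub>m (Suc n)"
    using H by (auto simp: orthogonal_mat_def)
  have H0: "H $$ (i, 0) = f i" if "i < Suc n" for i
    using Hf[OF that] unfolding sum.lessThan_Suc_shift by simp
  define B where "B = H\<^sup>T * A * H"
  have Bc: "B \<in> carrier_mat (Suc n) (Suc n)" using Hc A by (simp add: B_def)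
  have BT: "B\<^sup>T = B"
    using Hc A Suc.prems(2) unfolding B_def
    by (simp add: transpose_mult[of _ "Suc n" "Suc n" _ "Suc n"] assoc_mult_mat[of _ "Suc n" "Suc n" _ "Suc n" _ "Suc n"])
  have AH: "(A * H) $$ (i, 0) = a * H $$ (i, 0)" if "i < Suc n" for i
    using ev[OF that] H0 that by (subst mat_mult_entry[OF A Hc]) (auto simp del: sum.lessThan_Suc)
  have B0: "B $$ (i, 0) = (if i = 0 then a else 0)" if i: "i < Suc n" for i
  proof -
    have "B = H\<^sup>T * (A * H)"
      using Hc A by (simp add: B_def assoc_mult_mat[of _ "Suc n" "Suc n" _ "Suc n" _ "Suc n"])
    then have "B $$ (i, 0) = (\<Sum>l<Suc n. H\<^sup>T $$ (i, l) * (A * H) $$ (l, 0))"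
      using mat_mult_entry[of "H\<^sup>T" "Suc n" "Suc n" "A * H" "Suc n" i 0] i A Hc by simp
    also have "\<dots> = (\<Sum>l<Suc n. H\<^sup>T $$ (i, l) * (a * H $$ (l, 0)))"
      using AH by (intro sum.cong) auto
    also have "\<dots> = a * (H\<^sup>T * H) $$ (i, 0)"
      using mat_mult_entry[of "H\<^sup>T" "Suc n" "Suc n" H "Suc n" i 0] i Hc
      by (simp add: sum_distrib_left mult_ac del: sum.lessThan_Suc)
    finally show ?thesis using i by (simp add: HH)
  qed
  have B0': "B $$ (0, i) = (if i = 0 then a else 0)" if "i < Suc n" for i
    using B0[OF that] arg_cong[OF BT, of "\<lambda>M. M $$ (0, i)"] Bc that by simp
  define A' where "A' = mat n n (\<lambda>(i, j). B $$ (Suc i, Suc j))"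
  have A'c: "A' \<in> carrier_mat n n" by (simp add: A'_def)
  have "A'\<^sup>T = A'"
  proof (rule eq_matI)
    fix i j assume "i < dim_row A'" "j < dim_col A'"
    then show "A'\<^sup>T $$ (i, j) = A' $$ (i, j)"
      using arg_cong[OF BT, of "\<lambda>M. M $$ (Suc i, Suc j)"] Bc by (simp add: A'_def)
  qed (auto simp: A'_def)
  then obtain Q' d where Q': "orthogonal_mat n Q'" and d: "Q'\<^sup>T * A' * Q' = mat_diag n d"
    using Suc.IH[OF A'c] by blast
  have Q'c: "Q' \<in> carrier_mat n n" using Q' by (simp add: orthogonal_mat_def)
  define F where "F = four_block_mat (1\<^sub>m 1) (0\<^sub>m 1 n) (0\<^sub>m n 1) Q'"
  have Fc: "F \<in> carrier_mat (Suc n) (Suc n)" using four_block_carrier_mat[of "1\<^sub>m 1" 1 1 Q' n n] Q'c by (simp add: F_def)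
  have FT: "F\<^sup>T = four_block_mat (1\<^sub>m 1) (0\<^sub>m 1 n) (0\<^sub>m n 1) Q'\<^sup>T"
    unfolding F_def using Q'c by (subst transpose_four_block_mat[of _ 1 1 _ n _ n]) auto
  have one: "four_block_mat (1\<^sub>m 1) (0\<^sub>m 1 n) (0\<^sub>m n 1) (1\<^sub>m n) = (1\<^sub>m (Suc n) :: real mat)"
    by (rule eq_matI) auto
  have F: "orthogonal_mat (Suc n) F"
    unfolding orthogonal_mat_def FT using Fc Q'c Q'
    by (auto simp: F_def mult_four_block_mat[of _ 1 1 _ n _ n _ _ 1 _ n] orthogonal_mat_def one)
  have Bb: "B = four_block_mat (a \<cdot>\<^sub>m 1\<^sub>m 1) (0\<^sub>m 1 n) (0\<^sub>m n 1) A'"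
    using Bc B0 B0' by (intro eq_matI) (auto simp: A'_def)
  have "F\<^sup>T * B * F = four_block_mat (a \<cdot>\<^sub>m 1\<^sub>m 1) (0\<^sub>m 1 n) (0\<^sub>m n 1) (Q'\<^sup>T * A' * Q')"
  proof -
    have "F\<^sup>T * B = four_block_mat (a \<cdot>\<^sub>m 1\<^sub>m 1) (0\<^sub>m 1 n) (0\<^sub>m n 1) (Q'\<^sup>T * A')"
      unfolding FT Bb by (subst mult_four_block_mat[of _ 1 1 _ n _ n _ _ 1 _ n]) (use Q'c A'c in auto)
    then show ?thesis
      unfolding F_def by (simp only:, subst mult_four_block_mat[of _ 1 1 _ n _ n _ _ 1 _ n]) (use Q'c A'c in auto)
  qed
  also have "\<dots> = mat_diag (Suc n) (\<lambda>i. if i = 0 then a else d (i - 1))"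
    unfolding d by (rule eq_matI) (auto simp: mat_diag_def)
  finally have "(H * F)\<^sup>T * A * (H * F) = mat_diag (Suc n) (\<lambda>i. if i = 0 then a else d (i - 1))"
    using Fc Hc A unfolding B_def
    by (simp add: transpose_mult[of _ "Suc n" "Suc n" _ "Suc n"] assoc_mult_mat[of _ "Suc n" "Suc n" _ "Suc n" _ "Suc n"])
  then show ?case using orthogonal_mat_mult[OF H F] by blast
qed

section \<open>Sorted eigenvalues\<close>

lemma sorted_dropWhile_nonpos:
  "sorted (xs :: real list) \<Longrightarrow> dropWhile (\<lambda>x. x \<le> 0) xs = filter (\<lambda>x. 0 < x) xs"
  by (induction xs) (auto intro!: filter_True[symmetric] simp: not_le intro: order.strict_trans2)

text \<open>In decreasing order the positive entries come first, so position \<open>r - 1\<close>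
  holds the least of them. For a Gram matrix \<open>r\<close> will be the rank, which identifies
  \<open>lambda_i\<close> at the rank as the least nonzero eigenvalue.\<close>

lemma nth_rev_sort_positive:
  fixes ys :: "real list"
  assumes r: "r = length (filter (\<lambda>x. 0 < x) ys)" "0 < r"
  shows "0 < rev (sort ys) ! (r - 1)" "rev (sort ys) ! (r - 1) \<in> set ys"
    "y \<in> set ys \<Longrightarrow> 0 < y \<Longrightarrow> rev (sort ys) ! (r - 1) \<le> y"
    "y \<in> set ys \<Longrightarrow> y \<le> rev (sort ys) ! 0"
proof -
  let ?zs = "sort ys" let ?ps = "filter (\<lambda>x. 0 < x) ?zs"
  have len: "length ?ps = r" using r by (simp add: filter_sort)
  have dec: "?zs = takeWhile (\<lambda>x. x \<le> 0) ?zs @ ?ps"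
    using takeWhile_dropWhile_id[of "\<lambda>x. x \<le> 0" ?zs] sorted_dropWhile_nonpos[of ?zs] by simp
  have "rev ?zs ! (r - 1) = (rev ?ps @ rev (takeWhile (\<lambda>x. x \<le> 0) ?zs)) ! (r - 1)"
    by (subst dec) (simp add: rev_append del: rev_filter)
  also have "\<dots> = rev ?ps ! (r - 1)" using r len by (subst nth_append) simp
  also have "\<dots> = ?ps ! 0" using r len by (subst rev_nth) auto
  finally have *: "rev ?zs ! (r - 1) = ?ps ! 0" .
  have in_ps: "?ps ! 0 \<in> set ?ps" using len r by (intro nth_mem) auto
  show "0 < rev ?zs ! (r - 1)" "rev ?zs ! (r - 1) \<in> set ys"
    using in_ps unfolding * by auto
  show "rev ?zs ! (r - 1) \<le> y" if "y \<in> set ys" "0 < y"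
  proof -
    have "y \<in> set ?ps" using that by simp
    then obtain k where "k < length ?ps" "y = ?ps ! k" by (metis in_set_conv_nth)
    moreover have "sorted ?ps" by (simp add: filter_sort)
    ultimately show ?thesis unfolding * using sorted_nth_mono by blast
  qed
  show "y \<le> rev ?zs ! 0" if "y \<in> set ys"
  proof -
    have "y \<in> set ?zs" using that by simp
    then obtain k where k: "k < length ?zs" "y = ?zs ! k" by (metis in_set_conv_nth)
    then have "?zs ! k \<le> ?zs ! (length ?zs - 1)" by (intro sorted_nth_mono) auto
    then show ?thesis using k by (subst rev_nth) auto
  qed
qed

text \<open>Similar matrices share their characteristic polynomial, and that of a diagonal matrix
  splits into linear factors whose roots, with multiplicity, are the diagonal entries.\<close>

lemma eig_desc_mat_diag:
  assumes A: "A \<in> carrier_mat n n" and Q: "orthogonal_mat n Q" and d: "Q\<^sup>T * A * Q = mat_diag n d"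
  shows "eig_desc A = rev (sort (map d [0..<n]))"
proof -
  have Qc: "Q \<in> carrier_mat n n" using Q by (simp add: orthogonal_mat_def)
  have QQ: "Q * Q\<^sup>T = 1\<^sub>m n" "Q\<^sup>T * Q = 1\<^sub>m n" using Q by (auto simp: orthogonal_mat_def)
  have "similar_mat (mat_diag n d) A"
    unfolding similar_mat_def similar_mat_wit_def
    by (rule exI[of _ "Q\<^sup>T"], rule exI[of _ Q]) (use A Qc QQ d in \<open>auto simp: Let_def mat_diag_def\<close>)
  then have "char_poly A = char_poly (mat_diag n d)" by (simp add: char_poly_similar)
  also have "\<dots> = (\<Prod>a\<leftarrow>diag_mat (mat_diag n d). [:- a, 1:])"
    by (rule char_poly_upper_triangular[of _ n]) (auto simp: mat_diag_def)
  also have "diag_mat (mat_diag n d) = map d [0..<n]"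
    by (auto simp: diag_mat_def mat_diag_def)
  finally have "proots (char_poly A) = proots (\<Prod>p\<leftarrow>map (\<lambda>a. [:- a, 1:]) (map d [0..<n]). p)" by simp
  also have "\<dots> = mset (map d [0..<n])"
    by (subst proots_prod_list) (auto simp: comp_def sum_list_singleton_mset)
  finally show ?thesis unfolding eig_desc_def by (metis sorted_list_of_multiset_mset)
qed

text \<open>In an eigenbasis of the Gram matrix the squared norm is a weighted sum of squares. Both
  the upper and the lower singular value bound are read off from this formula.\<close>

lemma fro_norm_square_gram_diag:
  assumes X: "X \<in> carrier_mat p n" and Q: "orthogonal_mat n Q"
    and d: "Q\<^sup>T * (X\<^sup>T * X) * Q = mat_diag n d" and B: "B \<in> carrier_mat n k"
  shows "(fro_norm (X * B))\<^sup>2 = (\<Sum>i<n. \<Sum>j<k. d i * ((Q\<^sup>T * B) $$ (i, j))\<^sup>2)"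
proof -
  have Qc: "Q \<in> carrier_mat n n" and QQ: "Q * Q\<^sup>T = 1\<^sub>m n" using Q by (auto simp: orthogonal_mat_def)
  define M where "M = Q\<^sup>T * B"
  have M: "M \<in> carrier_mat n k" using Qc B by (auto simp: M_def)
  have BM: "B = Q * M"
    unfolding M_def using Qc B QQ assoc_mult_mat[of Q n n "Q\<^sup>T" n B k] by simp
  have "(fro_norm (X * B))\<^sup>2 = fro_inner B (X\<^sup>T * (X * B))"
    unfolding fro_norm_square using X B by (intro fro_inner_mult_left) auto
  also have "\<dots> = fro_inner (Q * M) ((X\<^sup>T * X) * (Q * M))"
    unfolding BM[symmetric] using X B assoc_mult_mat[of "X\<^sup>T" n p X n B k] by simp
  also have "\<dots> = fro_inner M (Q\<^sup>T * ((X\<^sup>T * X) * (Q * M)))"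
    by (rule fro_inner_mult_left[OF Qc M]) (use X Qc M in auto)
  also have "Q\<^sup>T * ((X\<^sup>T * X) * (Q * M)) = Q\<^sup>T * (X\<^sup>T * X) * Q * M"
  proof -
    have G: "X\<^sup>T * X \<in> carrier_mat n n" using X by auto
    show ?thesis using Qc M G
      by (simp add: assoc_mult_mat[of _ n n _ n _ n] assoc_mult_mat[of _ n n _ n _ k])
  qed
  also have "\<dots> = mat n k (\<lambda>(i, j). d i * M $$ (i, j))"
    unfolding d using mat_diag_mult_left[OF M] by simp
  finally show ?thesis using M unfolding M_def[symmetric]
    by (simp add: fro_inner_def power2_eq_square mult_ac)
qed

section \<open>Rank as the number of positive eigenvalues\<close>

lemma rank_mult_orthogonal:
  assumes X: "X \<in> carrier_mat p n" and Q: "orthogonal_mat n Q"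
  shows "vec_space.rank p (X * Q) = vec_space.rank p X"
proof -
  interpret vec_space "TYPE(real)" p .
  have Qc: "Q \<in> carrier_mat n n" and QQ: "Q * Q\<^sup>T = 1\<^sub>m n" using Q by (auto simp: orthogonal_mat_def)
  have "col_space (X * Q) = col_space X"
    unfolding col_space_eq[OF X] col_space_eq[OF mult_carrier_mat[OF X Qc]]
  proof (intro Collect_cong conj_cong, goal_cases)
    case 1 show ?case using X Qc by simp
  next
    case (2 y)
    show ?case
    proof
      assume "\<exists>x\<in>carrier_vec (dim_col (X * Q)). X * Q *\<^sub>v x = y"
      then obtain x where "x \<in> carrier_vec n" "X * Q *\<^sub>v x = y" using Qc by auto
      then show "\<exists>x\<in>carrier_vec (dim_col X). X *\<^sub>v x = y"
        using X Qc by (intro bexI[of _ "Q *\<^sub>v x"]) (auto simp: assoc_mult_mat_vec)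
    next
      assume "\<exists>x\<in>carrier_vec (dim_col X). X *\<^sub>v x = y"
      then obtain x where x: "x \<in> carrier_vec n" "X *\<^sub>v x = y" using X by auto
      have "X * Q *\<^sub>v (Q\<^sup>T *\<^sub>v x) = X *\<^sub>v (Q * Q\<^sup>T *\<^sub>v x)"
        using X Qc x by (simp add: assoc_mult_mat_vec[of _ p n _ n] assoc_mult_mat_vec[of _ n n _ n])
      then show "\<exists>x\<in>carrier_vec (dim_col (X * Q)). X * Q *\<^sub>v x = y"
        using X Qc QQ x by (intro bexI[of _ "Q\<^sup>T *\<^sub>v x"]) auto
    qed
  qed
  then show ?thesis by (simp add: rank_def col_space_def)
qed

text \<open>The columns are pairwise orthogonal with squared lengths \<open>d i\<close>. Those
  without positive \<open>d i\<close> are zero; the others are distinct and independent, hence a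
  maximal independent set of columns.\<close>

lemma rank_orthogonal_cols:
  fixes Z :: "real mat"
  assumes Z: "Z \<in> carrier_mat p n" and D: "Z\<^sup>T * Z = mat_diag n d"
  shows "vec_space.rank p Z = card {i. i < n \<and> 0 < d i}"
proof -
  interpret vec_space "TYPE(real)" p .
  let ?is = "filter (\<lambda>i. 0 < d i) [0..<n]"
  have inner: "(\<Sum>l<p. Z $$ (l, i) * Z $$ (l, j)) = (if i = j then d i else 0)" if "i < n" "j < n" for i j
  proof -
    have "(\<Sum>l<p. Z $$ (l, i) * Z $$ (l, j)) = (Z\<^sup>T * Z) $$ (i, j)"
      using that Z by (subst mat_mult_entry[of "Z\<^sup>T" n p Z n i j]) auto
    then show ?thesis using that by (simp add: D mat_diag_def)
  qed
  have zero: "col Z i = 0\<^sub>v p" if i: "i < n" and "\<not> 0 < d i" for i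
  proof -
    have "0 \<le> (\<Sum>l<p. Z $$ (l, i) * Z $$ (l, i))" by (intro sum_nonneg) auto
    then have "(\<Sum>l<p. (Z $$ (l, i))\<^sup>2) = 0" using inner[OF i i] that by (simp add: power2_eq_square)
    then have "\<forall>l<p. Z $$ (l, i) = 0" by (simp add: sum_nonneg_eq_0_iff)
    then show ?thesis using Z i by (intro eq_vecI) auto
  qed
  have inj: "inj_on (col Z) {i. i < n \<and> 0 < d i}"
  proof (rule inj_onI, rule ccontr)
    fix i j assume ij: "i \<in> {i. i < n \<and> 0 < d i}" "j \<in> {i. i < n \<and> 0 < d i}" "col Z i = col Z j" "i \<noteq> j"
    have "Z $$ (l, i) = Z $$ (l, j)" if "l < p" for l
      using arg_cong[OF ij(3), of "\<lambda>v. v $ l"] Z that ij(1,2) by simp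
    then have "(\<Sum>l<p. Z $$ (l, i) * Z $$ (l, i)) = (\<Sum>l<p. Z $$ (l, i) * Z $$ (l, j))"
      by (intro sum.cong) auto
    then show False using inner[of i i] inner[of i j] ij by simp
  qed
  let ?cs = "map (col Z) ?is"
  let ?M = "mat_of_cols p ?cs"
  have M: "?M \<in> carrier_mat p (length ?is)" by (metis length_map mat_of_cols_carrier(1))
  have cols: "cols ?M = ?cs" using Z by (intro cols_mat_of_cols) auto
  have dist: "distinct ?cs"
    using inj by (auto simp: distinct_map intro: inj_on_subset)
  have indpt: "lin_indpt (set ?cs)"
  proof
    assume "lin_dep (set ?cs)"
    then obtain v where v: "v \<in> carrier_vec (length ?is)" "v \<noteq> 0\<^sub>v (length ?is)" "?M *\<^sub>v v = 0\<^sub>v p"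
      using lin_depE[OF M] cols dist by metis
    have "v $ k = 0" if k: "k < length ?is" for k
    proof -
      have isn: "?is ! q < n \<and> 0 < d (?is ! q)" if "q < length ?is" for q
        using nth_mem[OF that] by auto
      have neq: "?is ! q = ?is ! k \<longleftrightarrow> q = k" if "q < length ?is" for q
        using that k by (simp add: nth_eq_iff_index_eq)
      have row: "(\<Sum>q<length ?is. Z $$ (l, ?is ! q) * v $ q) = 0" if "l < p" for l
        using arg_cong[OF v(3), of "\<lambda>x. x $ l"] that v(1) Z isn
        by (auto simp: scalar_prod_def mat_of_cols_index lessThan_atLeast0 intro!: sum.cong)
      \<comment> \<open>Pairing the vanishing combination with the k-th selected column leaves only
        the k-th coefficient, by orthogonality.\<close>
      have "0 = (\<Sum>l<p. Z $$ (l, ?is ! k) * (\<Sum>q<length ?is. Z $$ (l, ?is ! q) * v $ q))"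
        using row by simp
      also have "\<dots> = (\<Sum>l<p. \<Sum>q<length ?is. Z $$ (l, ?is ! k) * Z $$ (l, ?is ! q) * v $ q)"
        by (simp add: sum_distrib_left mult.assoc)
      also have "\<dots> = (\<Sum>q<length ?is. (\<Sum>l<p. Z $$ (l, ?is ! k) * Z $$ (l, ?is ! q)) * v $ q)"
        by (subst sum.swap) (simp add: sum_distrib_right)
      also have "\<dots> = (\<Sum>q<length ?is. if q = k then d (?is ! k) * v $ q else 0)"
      proof (rule sum.cong[OF refl])
        fix q assume "q \<in> {..<length ?is}"
        then have q: "q < length ?is" by simp
        have "?is ! k = ?is ! q \<longleftrightarrow> q = k" using neq[OF q] by metis
        then show "(\<Sum>l<p. Z $$ (l, ?is ! k) * Z $$ (l, ?is ! q)) * v $ q = (if q = k then d (?is ! k) * v $ q else 0)"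
          using isn[OF q] isn[OF k] inner[of "?is ! k" "?is ! q"] by simp
      qed
      also have "\<dots> = d (?is ! k) * v $ k" using k by (subst sum.delta) auto
      finally show ?thesis using isn[OF k] by simp
    qed
    then show False using v by (auto intro!: eq_vecI)
  qed
  have "maximal (set ?cs) (\<lambda>T. T \<subseteq> set (cols Z) \<and> lin_indpt T)"
    unfolding maximal_def
  proof (intro conjI allI impI indpt)
    show "set ?cs \<subseteq> set (cols Z)" using Z by (auto simp: cols_def)
    fix T assume T: "set ?cs \<subseteq> T \<and> T \<subseteq> set (cols Z) \<and> lin_indpt T"
    have "T \<subseteq> set ?cs"
    proof
      fix x assume x: "x \<in> T"
      then obtain i where i: "i < n" "x = col Z i" using T Z by (auto simp: cols_def)
      have "T \<subseteq> carrier_vec p" using T cols_dim[of Z] Z by auto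
      then have "x \<noteq> 0\<^sub>v p" using x T zero_nin_lin_indpt[of T] by auto
      then show "x \<in> set ?cs" using i zero[of i] by auto
    qed
    then show "T = set ?cs" using T by blast
  qed
  then have "rank Z = card (set ?cs)" by (rule rank_card_indpt[OF Z])
  also have "\<dots> = length ?is" using distinct_card[OF dist] by simp
  also have "\<dots> = card {i. i < n \<and> 0 < d i}"
    using distinct_card[of ?is] by (simp add: conj_commute)
  finally show ?thesis .
qed

lemma spec_norm_le_op_le:
  assumes "op_le A a"
  shows "spec_norm A \<le> a"
proof (rule spec_norm_le)
  fix v assume v: "v \<in> carrier_vec (dim_col A)" "vnorm v \<le> 1"
  have "mat_of_cols (dim_vec (A *\<^sub>v v)) [A *\<^sub>v v] = A * mat_of_cols (dim_vec v) [v]"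
    using v by (intro eq_matI) (auto simp: mat_of_cols_index scalar_prod_def)
  then have "vnorm (A *\<^sub>v v) \<le> a * vnorm v"
    using op_leD[OF assms, of "dim_row A" "dim_col A" "mat_of_cols (dim_vec v) [v]" 1] v
      mat_of_cols_carrier(1)[of "dim_col A" "[v]"]
    unfolding vnorm_eq_fro_norm by simp
  also have "\<dots> \<le> a" using mult_left_mono[OF v(2) op_le_nonneg[OF assms]] by simp
  finally show "vnorm (A *\<^sub>v v) \<le> a" .
qed

text \<open>The last inequality survives kernels of \<open>X\<close>: the rows of
  \<open>B * X\<close> lie in the row space of \<open>X\<close>, which is orthogonal to the
  eigenvectors of eigenvalue zero, so only eigenvalues at least \<open>s\<close> act on
  them.\<close>

theorem gram_lambda_rank:
  fixes X :: "real mat"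
  defines "s \<equiv> lambda_i (X\<^sup>T * X) (mat_rank X)"
  assumes X: "X \<in> carrier_mat p n" and X0: "spec_norm X \<noteq> 0"
  shows "1 \<le> mat_rank X" "0 < s" "s \<le> (spec_norm X)\<^sup>2" "(spec_norm X)\<^sup>2 \<le> lambda_max (X\<^sup>T * X)"
    "B \<in> carrier_mat k p \<Longrightarrow> sqrt s * fro_norm (B * X) \<le> fro_norm (B * X * X\<^sup>T)"
proof -
  have G: "X\<^sup>T * X \<in> carrier_mat n n" using X by auto
  have "(X\<^sup>T * X)\<^sup>T = X\<^sup>T * X" using X by (simp add: transpose_mult[of _ n p _ n])
  then obtain Q d where Q: "orthogonal_mat n Q" and d: "Q\<^sup>T * (X\<^sup>T * X) * Q = mat_diag n d"
    using real_spectral_theorem[OF G] by blast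
  have Qc: "Q \<in> carrier_mat n n" and QQ: "Q * Q\<^sup>T = 1\<^sub>m n" "Q\<^sup>T * Q = 1\<^sub>m n"
    using Q by (auto simp: orthogonal_mat_def)
  have XQ: "X * Q \<in> carrier_mat p n" using X Qc by auto
  have ZZ: "(X * Q)\<^sup>T * (X * Q) = mat_diag n d"
    unfolding d[symmetric] using X Qc
    by (simp add: transpose_mult[OF X Qc] assoc_mult_mat[of _ n n _ p _ n] assoc_mult_mat[of _ n p _ n _ n] assoc_mult_mat[of _ p n _ n _ n] assoc_mult_mat[of _ n n _ n _ n])
  have fro: "(fro_norm (X * B))\<^sup>2 = (\<Sum>i<n. \<Sum>j<k. d i * ((Q\<^sup>T * B) $$ (i, j))\<^sup>2)"
    if "B \<in> carrier_mat n k" for B k by (rule fro_norm_square_gram_diag[OF X Q d that])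
  have d_nonneg: "0 \<le> d i" and d_le: "d i \<le> (spec_norm X)\<^sup>2" if i: "i < n" for i
  proof -
    \<comment> \<open>\<open>Q * E\<close> is the i-th eigenvector; testing \<open>X\<close> on it
      exhibits \<open>d i\<close> as a squared norm.\<close>
    define E where "E = mat n 1 (\<lambda>(a, b). if a = i then 1 else 0 :: real)"
    have E: "E \<in> carrier_mat n 1" by (simp add: E_def)
    have QE: "Q * E \<in> carrier_mat n 1" using E Qc by auto
    have "Q\<^sup>T * (Q * E) = E"
      using QQ E Qc assoc_mult_mat[of "Q\<^sup>T" n n Q n E 1] by simp
    then have "(fro_norm (X * (Q * E)))\<^sup>2 = (\<Sum>a<n. \<Sum>b<1. d a * (E $$ (a, b))\<^sup>2)"
      using fro[OF QE] by simp
    also have "\<dots> = (\<Sum>a<n. if a = i then d a else 0)"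
      by (intro sum.cong) (auto simp: E_def)
    also have "\<dots> = d i" using i by simp
    finally have di: "d i = (fro_norm (X * (Q * E)))\<^sup>2" by simp
    then show "0 \<le> d i" by simp
    have "(\<Sum>a<n. \<Sum>b<1. (E $$ (a, b))\<^sup>2) = (\<Sum>a<n. if a = i then 1 else 0)"
      by (intro sum.cong) (auto simp: E_def)
    then have "fro_norm E = 1" using i E by (simp add: fro_norm_def)
    then have "fro_norm (Q * E) = 1" by (simp add: orthogonal_mat_fro_norm[OF Q E])
    then have "fro_norm (X * (Q * E)) \<le> spec_norm X"
      using op_leD[OF op_le_spec_norm X QE] by simp
    then show "d i \<le> (spec_norm X)\<^sup>2" unfolding di by (intro power_mono) auto
  qed
  let ?ys = "map d [0..<n]"
  have rank: "mat_rank X = length (filter (\<lambda>x. 0 < x) ?ys)"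
  proof -
    have "mat_rank X = card {i. i < n \<and> 0 < d i}"
      using rank_orthogonal_cols[OF XQ ZZ] rank_mult_orthogonal[OF X Q] X by (simp add: mat_rank_def)
    then show ?thesis
      using distinct_card[of "filter (\<lambda>i. 0 < d i) [0..<n]"] by (simp add: filter_map comp_def conj_commute)
  qed
  \<comment> \<open>With all eigenvalues zero \<open>X\<close> would act as zero, against
    \<open>X0\<close>. Hence the rank is at least 1 and the index \<open>mat_rank X - 1\<close> is
    not truncated.\<close>
  have "\<exists>i<n. 0 < d i"
  proof (rule ccontr)
    assume "\<not> (\<exists>i<n. 0 < d i)"
    then have d0: "d i = 0" if "i < n" for i using d_nonneg that by force
    have "op_le X 0"
      unfolding op_le_def
    proof (intro conjI allI ballI)
      fix k and B :: "real mat" assume "B \<in> carrier_mat (dim_col X) k"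
      then have "(fro_norm (X * B))\<^sup>2 = 0" using fro[of B k] X d0 by simp
      then show "fro_norm (X * B) \<le> 0 * fro_norm B" by simp
    qed simp
    then have "spec_norm X \<le> 0" by (rule spec_norm_le_op_le)
    then show False using X0 spec_norm_nonneg[of X] by linarith
  qed
  then have pos: "0 < mat_rank X" unfolding rank by (auto simp: filter_empty_conv)
  then show "1 \<le> mat_rank X" by simp
  have eig: "eig_desc (X\<^sup>T * X) = rev (sort ?ys)" by (rule eig_desc_mat_diag[OF G Q d])
  note srt = nth_rev_sort_positive[OF rank pos, folded eig, folded lambda_i_def, folded s_def]
  show s0: "0 < s" by (rule srt(1))
  show "s \<le> (spec_norm X)\<^sup>2" using srt(2) d_le by auto
  have dmax: "d i \<le> lambda_max (X\<^sup>T * X)" if "i < n" for i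
    using srt(4)[of "d i"] that by (auto simp: lambda_max_def lambda_i_def)
  have dmax0: "0 \<le> lambda_max (X\<^sup>T * X)"
    using \<open>\<exists>i<n. 0 < d i\<close> dmax by force
  have "op_le X (sqrt (lambda_max (X\<^sup>T * X)))"
    unfolding op_le_def
  proof (intro conjI allI ballI)
    fix k and B :: "real mat" assume "B \<in> carrier_mat (dim_col X) k"
    then have B: "B \<in> carrier_mat n k" using X by simp
    have QB: "Q\<^sup>T * B \<in> carrier_mat n k" using B Qc by auto
    have "(fro_norm (X * B))\<^sup>2 \<le> (\<Sum>i<n. \<Sum>j<k. lambda_max (X\<^sup>T * X) * ((Q\<^sup>T * B) $$ (i, j))\<^sup>2)"
      unfolding fro[OF B] using dmax by (intro sum_mono mult_right_mono) auto
    also have "\<dots> = lambda_max (X\<^sup>T * X) * (fro_norm (Q\<^sup>T * B))\<^sup>2"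
      unfolding fro_norm_square_sum[OF QB] by (simp add: sum_distrib_left)
    also have "fro_norm (Q\<^sup>T * B) = fro_norm B"
      by (rule orthogonal_mat_fro_norm[OF orthogonal_mat_transpose[OF Q] B])
    finally have "(fro_norm (X * B))\<^sup>2 \<le> (sqrt (lambda_max (X\<^sup>T * X)) * fro_norm B)\<^sup>2"
      using dmax0 by (simp add: power_mult_distrib)
    then show "fro_norm (X * B) \<le> sqrt (lambda_max (X\<^sup>T * X)) * fro_norm B"
      by (rule power2_le_imp_le) (simp add: dmax0)
  qed (simp add: dmax0)
  then have "spec_norm X \<le> sqrt (lambda_max (X\<^sup>T * X))" by (rule spec_norm_le_op_le)
  then have "(spec_norm X)\<^sup>2 \<le> (sqrt (lambda_max (X\<^sup>T * X)))\<^sup>2" by (intro power_mono) auto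
  then show "(spec_norm X)\<^sup>2 \<le> lambda_max (X\<^sup>T * X)" using dmax0 by simp
  show "sqrt s * fro_norm (B * X) \<le> fro_norm (B * X * X\<^sup>T)" if B: "B \<in> carrier_mat k p"
  proof -
    let ?N = "(B * X)\<^sup>T"
    have N: "?N \<in> carrier_mat n k" using B X by auto
    have M: "Q\<^sup>T * ?N \<in> carrier_mat n k" using N Qc by auto
    have Meq: "Q\<^sup>T * ?N = (X * Q)\<^sup>T * B\<^sup>T"
      using X B Qc by (simp add: transpose_mult[OF B X] transpose_mult[OF X Qc] assoc_mult_mat[of _ n n _ p _ k])
    \<comment> \<open>\<open>X\<close> annihilates an eigenvector of eigenvalue zero, so
      \<open>?N\<close> has no component along it.\<close>
    have M0: "(Q\<^sup>T * ?N) $$ (i, j) = 0" if ij: "i < n" "j < k" "\<not> 0 < d i" for i j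
    proof -
      have "d i = 0" using d_nonneg ij by force
      moreover have "d i = (\<Sum>l<p. ((X * Q) $$ (l, i))\<^sup>2)"
      proof -
        have "(\<Sum>l<p. ((X * Q) $$ (l, i))\<^sup>2) = ((X * Q)\<^sup>T * (X * Q)) $$ (i, i)"
          using ij XQ
          by (subst mat_mult_entry[of "(X * Q)\<^sup>T" n p "X * Q" n i i]) (auto simp: power2_eq_square simp del: index_mult_mat)
        then show ?thesis using ij by (simp add: ZZ mat_diag_def)
      qed
      ultimately have "\<forall>l<p. (X * Q) $$ (l, i) = 0" by (simp add: sum_nonneg_eq_0_iff)
      then have "(X * Q)\<^sup>T $$ (i, l) = 0" if "l < p" for l
        using that XQ ij by (metis carrier_matD index_transpose_mat(1))
      then show ?thesis
        unfolding Meq using XQ B ij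
        by (subst mat_mult_entry[of _ n p _ k]) auto
    qed
    have "(sqrt s * fro_norm (B * X))\<^sup>2 = s * (fro_norm (Q\<^sup>T * ?N))\<^sup>2"
      using s0 orthogonal_mat_fro_norm[OF orthogonal_mat_transpose[OF Q] N]
      by (simp add: power_mult_distrib)
    also have "\<dots> = (\<Sum>i<n. \<Sum>j<k. s * ((Q\<^sup>T * ?N) $$ (i, j))\<^sup>2)"
      unfolding fro_norm_square_sum[OF M] by (simp add: sum_distrib_left)
    also have "\<dots> \<le> (\<Sum>i<n. \<Sum>j<k. d i * ((Q\<^sup>T * ?N) $$ (i, j))\<^sup>2)"
    proof (intro sum_mono)
      fix i j assume ij: "i \<in> {..<n}" "j \<in> {..<k}"
      show "s * ((Q\<^sup>T * ?N) $$ (i, j))\<^sup>2 \<le> d i * ((Q\<^sup>T * ?N) $$ (i, j))\<^sup>2"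
      proof (cases "0 < d i")
        case True
        then show ?thesis using srt(3)[of "d i"] ij by (intro mult_right_mono) auto
      next
        case False
        then show ?thesis using M0[of i j] ij by simp
      qed
    qed
    also have "\<dots> = (fro_norm (X * ?N))\<^sup>2" using fro[OF N] by simp
    also have "X * ?N = (B * X * X\<^sup>T)\<^sup>T" using B X by (subst transpose_mult[of "B * X" k n "X\<^sup>T" p]) auto
    also have "fro_norm \<dots> = fro_norm (B * X * X\<^sup>T)" by (rule fro_norm_transpose)
    finally show ?thesis by (rule power2_le_imp_le) simp
  qed
qed

subsection \<open>Perturbation of matrix products\<close>

definition chain_dims :: "(nat \<Rightarrow> real mat) \<Rightarrow> (nat \<Rightarrow> nat) \<Rightarrow> nat \<Rightarrow> bool" where
  "chain_dims W d K \<longleftrightarrow> (\<forall>i. 1 \<le> i \<and> i \<le> K \<longrightarrow> W i \<in> carrier_mat (d i) (d (i - 1)))"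

lemma chain_dimsD: "chain_dims W d K \<Longrightarrow> 1 \<le> i \<Longrightarrow> i \<le> K \<Longrightarrow> W i \<in> carrier_mat (d i) (d (i - 1))"
  by (simp add: chain_dims_def)

lemma chain_dims_Suc: "chain_dims W d K \<Longrightarrow> Suc k \<le> K \<Longrightarrow> W (Suc k) \<in> carrier_mat (d (Suc k)) (d k)"
  using chain_dimsD[of W d K "Suc k"] by simp

lemma chain_dims_le: "chain_dims W d K \<Longrightarrow> k \<le> K \<Longrightarrow> chain_dims W d k"
  by (auto simp: chain_dims_def)

lemma chain_dims_shift:
  assumes "chain_dims W d K" "i + k \<le> K"
  shows "chain_dims (\<lambda>j. W (i + j)) (\<lambda>j. d (i + j)) k"
  unfolding chain_dims_def
proof (intro allI impI)
  fix j assume j: "1 \<le> j \<and> j \<le> k"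
  show "W (i + j) \<in> carrier_mat (d (i + j)) (d (i + (j - 1)))"
    using chain_dimsD[OF assms(1), of "i + j"] j assms(2) by simp
qed

lemma chain_carrier: "chain_dims W d K \<Longrightarrow> chain W (d 0) K \<in> carrier_mat (d K) (d 0)"
proof (induction K)
  case (Suc K)
  then show ?case using chain_dims_Suc[OF Suc.prems order_refl] chain_dims_le[OF Suc.prems le_SucI[OF order_refl]] by auto
qed simp

lemma chain_cong: "(\<And>i. 1 \<le> i \<Longrightarrow> i \<le> K \<Longrightarrow> V i = W i) \<Longrightarrow> chain V e K = chain W e K"
  by (induction K) auto

text \<open>\<open>tail_chain W d L i\<close> is the product \<open>W_L \<cdots> W_{i+1}\<close>.\<close>
definition tail_chain :: "(nat \<Rightarrow> real mat) \<Rightarrow> (nat \<Rightarrow> nat) \<Rightarrow> nat \<Rightarrow> nat \<Rightarrow> real mat" where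
  "tail_chain W d L i = chain (\<lambda>j. W (i + j)) (d i) (L - i)"

lemma tail_chain_carrier:
  assumes "chain_dims W d L" "i \<le> L"
  shows "tail_chain W d L i \<in> carrier_mat (d L) (d i)"
  using chain_carrier[OF chain_dims_shift[OF assms(1), of i "L - i"]] assms(2)
  by (simp add: tail_chain_def)

lemma tail_chain_Suc:
  assumes "i \<le> K"
  shows "tail_chain W d (Suc K) i = W (Suc K) * tail_chain W d K i"
  using assms by (simp add: tail_chain_def Suc_diff_le)

lemma tail_chain_self: "tail_chain W d K K = 1\<^sub>m (d K)"
  by (simp add: tail_chain_def)

lemma chain_op_le:
  assumes "chain_dims W d K" "\<And>i. 1 \<le> i \<Longrightarrow> i \<le> K \<Longrightarrow> op_le (W i) a"
  shows "op_le (chain W (d 0) K) (a ^ K)"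
  using assms
proof (induction K)
  case (Suc K)
  note dims = chain_dims_le[OF Suc.prems(1) le_SucI[OF order_refl]]
  have "op_le (chain W (d 0) K) (a ^ K)" using Suc dims by simp
  then show ?case
    using op_le_mult[OF Suc.prems(2)[of "Suc K"] _ chain_dims_Suc[OF Suc.prems(1) order_refl] chain_carrier[OF dims]]
    by simp
qed (simp add: op_le_one)

lemma chain_diff_Suc:
  assumes V: "V (Suc k) \<in> carrier_mat r p" and W: "W (Suc k) \<in> carrier_mat r p"
    and CV: "chain V e k \<in> carrier_mat p c" and CW: "chain W e k \<in> carrier_mat p c"
  shows "chain V e (Suc k) - chain W e (Suc k)
    = V (Suc k) * (chain V e k - chain W e k) + (V (Suc k) - W (Suc k)) * chain W e k"
proof -
  have "V (Suc k) * (chain V e k - chain W e k) = V (Suc k) * chain V e k - V (Suc k) * chain W e k"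
    using assms by (intro mult_minus_distrib_mat) auto
  moreover have "(V (Suc k) - W (Suc k)) * chain W e k = V (Suc k) * chain W e k - W (Suc k) * chain W e k"
    using assms by (intro minus_mult_distrib_mat) auto
  ultimately show ?thesis using assms by (intro eq_matI) auto
qed

lemma op_le_of_diff:
  assumes "op_le W a" "op_le (V - W) h" "V \<in> carrier_mat r c" "W \<in> carrier_mat r c"
  shows "op_le V (a + h)"
proof -
  have "V = W + (V - W)" using assms by (intro eq_matI) auto
  then show ?thesis using op_le_add[OF assms(1,2), of r c] assms by (simp add: minus_carrier_mat)
qed

text \<open>Changing one factor at a time gives the recursion e' = (a + h) e + h a^K for the error,
  and (a + h)^K - a^K is its solution.\<close>

lemma chain_diff_op_le:
  assumes "chain_dims V d K" "chain_dims W d K"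
    and "\<And>i. 1 \<le> i \<Longrightarrow> i \<le> K \<Longrightarrow> op_le (W i) a"
    and "\<And>i. 1 \<le> i \<Longrightarrow> i \<le> K \<Longrightarrow> op_le (V i - W i) h"
  shows "op_le (chain V (d 0) K - chain W (d 0) K) ((a + h) ^ K - a ^ K)"
  using assms
proof (induction K)
  case 0
  have z: "1\<^sub>m (d 0) - 1\<^sub>m (d 0) = (0\<^sub>m (d 0) (d 0) :: real mat)" by (intro eq_matI) auto
  show ?case unfolding chain.simps z by (simp add: op_le_def)
next
  case (Suc K)
  let ?V = "chain V (d 0) K" and ?W = "chain W (d 0) K"
  note dV = chain_dims_le[OF Suc.prems(1) le_SucI[OF order_refl]] and dW = chain_dims_le[OF Suc.prems(2) le_SucI[OF order_refl]]
  note V = chain_dims_Suc[OF Suc.prems(1) order_refl] and W = chain_dims_Suc[OF Suc.prems(2) order_refl]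
  note CV = chain_carrier[OF dV] and CW = chain_carrier[OF dW]
  have IH: "op_le (?V - ?W) ((a + h) ^ K - a ^ K)"
    using Suc dV dW by simp
  have opV: "op_le (V (Suc K)) (a + h)"
    by (rule op_le_of_diff[OF _ _ V W]) (use Suc.prems(3,4)[of "Suc K"] in auto)
  have "op_le (V (Suc K) * (?V - ?W) + (V (Suc K) - W (Suc K)) * ?W)
     ((a + h) * ((a + h) ^ K - a ^ K) + h * a ^ K)"
    using V W CV CW Suc.prems(4)[of "Suc K"] Suc.prems(3) IH opV
    by (intro op_le_add[of _ _ _ _ "d (Suc K)" "d 0"] op_le_mult[of _ _ _ _ "d (Suc K)" "d K" "d 0"]
        chain_op_le[OF dW] mult_carrier_mat[of _ "d (Suc K)" "d K"] minus_carrier_mat) auto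
  moreover have "(a + h) * ((a + h) ^ K - a ^ K) + h * a ^ K = (a + h) ^ Suc K - a ^ Suc K"
    by (simp add: algebra_simps)
  ultimately show ?case
    using chain_diff_Suc[of V K "d (Suc K)" "d K" W "d 0" "d 0"] V W CV CW
    by (simp del: chain.simps)
qed

subsection \<open>First-order expansion of a product\<close>

text \<open>The differential of \<open>W \<mapsto> W_k \<cdots> W_1\<close> in direction \<open>D\<close>.\<close>
fun dchain :: "(nat \<Rightarrow> real mat) \<Rightarrow> (nat \<Rightarrow> real mat) \<Rightarrow> nat \<Rightarrow> nat \<Rightarrow> real mat" where
  "dchain W D e 0 = 0\<^sub>m e e"
| "dchain W D e (Suc k) = W (Suc k) * dchain W D e k + D (Suc k) * chain W e k"

lemma dchain_carrier:
  "chain_dims W d K \<Longrightarrow> chain_dims D d K \<Longrightarrow> dchain W D (d 0) K \<in> carrier_mat (d K) (d 0)"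
proof (induction K)
  case (Suc K)
  then show ?case
    using chain_dims_Suc[of W d "Suc K" K] chain_dims_Suc[of D d "Suc K" K]
      chain_dims_le[of W d "Suc K" K] chain_dims_le[of D d "Suc K" K] chain_carrier[of W d K] by auto
qed simp

lemma dchain_fro_norm_le:
  assumes "chain_dims W d K" "chain_dims D d K" "\<And>i. 1 \<le> i \<Longrightarrow> i \<le> K \<Longrightarrow> op_le (W i) a" "0 \<le> a"
  shows "fro_norm (dchain W D (d 0) K) \<le> a ^ (K - 1) * (\<Sum>i=1..K. fro_norm (D i))"
  using assms
proof (induction K)
  case (Suc K)
  let ?DC = "dchain W D (d 0) K" and ?CK = "chain W (d 0) K"
  note dW = chain_dims_le[OF Suc.prems(1) le_SucI[OF order_refl]] and dD = chain_dims_le[OF Suc.prems(2) le_SucI[OF order_refl]]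
  note W = chain_dims_Suc[OF Suc.prems(1) order_refl] and D = chain_dims_Suc[OF Suc.prems(2) order_refl]
  note C = chain_carrier[OF dW] and dC = dchain_carrier[OF dW dD]
  have "fro_norm (dchain W D (d 0) (Suc K))
      \<le> fro_norm (W (Suc K) * ?DC) + fro_norm (D (Suc K) * ?CK)"
    using W D C dC by (simp, intro fro_norm_triangle) auto
  also have "fro_norm (W (Suc K) * ?DC) \<le> a * fro_norm (?DC)"
    using W dC Suc.prems(3)[of "Suc K"] by (intro op_leD) auto
  \<comment> \<open>The cases on \<open>K\<close> are due to truncated subtraction:
    \<open>a * a ^ (K - 1)\<close> is \<open>a ^ K\<close> only for positive \<open>K\<close>, and
    for zero the sum is empty.\<close>
  also have "a * fro_norm (?DC) \<le> a ^ K * (\<Sum>i=1..K. fro_norm (D i))"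
  proof (cases K)
    case (Suc k)
    have "a * fro_norm (?DC) \<le> a * (a ^ (K - 1) * (\<Sum>i=1..K. fro_norm (D i)))"
      using Suc.IH dW dD Suc.prems by (intro mult_left_mono) auto
    then show ?thesis using Suc by (simp add: mult.assoc)
  qed simp
  also have "fro_norm (D (Suc K) * ?CK) \<le> a ^ K * fro_norm (D (Suc K))"
    using D C chain_op_le[OF dW, of a] Suc.prems(3) by (intro op_leD_right) auto
  finally show ?case by (simp add: algebra_simps)
qed simp

text \<open>The remainder for one more layer is W times the old remainder plus the layer change
  times the difference of the products. The second-order Taylor remainder of z^K at \<open>a\<close>
  with increment \<open>h\<close> obeys the same recursion with equality.\<close>

lemma chain_second_order:
  assumes "chain_dims V d K" "chain_dims W d K"
    and "\<And>i. 1 \<le> i \<Longrightarrow> i \<le> K \<Longrightarrow> op_le (W i) a"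
    and "\<And>i. 1 \<le> i \<Longrightarrow> i \<le> K \<Longrightarrow> fro_norm (V i - W i) \<le> h" and "0 \<le> a"
  shows "fro_norm (chain V (d 0) K - chain W (d 0) K - dchain W (\<lambda>i. V i - W i) (d 0) K)
    \<le> (a + h) ^ K - a ^ K - real K * h * a ^ (K - 1)"
  using assms
proof (induction K)
  case 0
  have "1\<^sub>m (d 0) - 1\<^sub>m (d 0) - 0\<^sub>m (d 0) (d 0) = (0\<^sub>m (d 0) (d 0) :: real mat)" by (intro eq_matI) auto
  then show ?case by simp
next
  case (Suc K)
  let ?D = "\<lambda>i. V i - W i"
  let ?CV = "chain V (d 0) K" and ?CD = "dchain W ?D (d 0) K" and ?CW = "chain W (d 0) K" and ?V = "V (Suc K)" and ?W = "W (Suc K)"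
  note dV = chain_dims_le[OF Suc.prems(1) le_SucI[OF order_refl]] and dW = chain_dims_le[OF Suc.prems(2) le_SucI[OF order_refl]]
  note V = chain_dims_Suc[OF Suc.prems(1) order_refl] and W = chain_dims_Suc[OF Suc.prems(2) order_refl]
  note CV = chain_carrier[OF dV] and CW = chain_carrier[OF dW]
  have dD: "chain_dims ?D d K" using dV dW by (auto simp: chain_dims_def minus_carrier_mat)
  note dC = dchain_carrier[OF dW dD]
  have D: "?D (Suc K) \<in> carrier_mat (d (Suc K)) (d K)" using V W by (simp add: minus_carrier_mat)
  define E where "E = ?CV - ?CW - ?CD"
  have E: "E \<in> carrier_mat (d K) (d 0)" using dC by (simp add: E_def minus_carrier_mat)
  have IH: "fro_norm E \<le> (a + h) ^ K - a ^ K - real K * h * a ^ (K - 1)"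
    unfolding E_def using Suc dV dW by simp
  have dif: "op_le (?CV - ?CW) ((a + h) ^ K - a ^ K)"
    by (rule chain_diff_op_le[OF dV dW]) (use Suc.prems op_le_fro_bound in auto)
  have split: "chain V (d 0) (Suc K) - chain W (d 0) (Suc K) - dchain W ?D (d 0) (Suc K)
    = ?W * E + ?D (Suc K) * (?CV - ?CW)"
  proof -
    have 1: "?W * E = ?W * ?CV - ?W * ?CW - ?W * ?CD"
      unfolding E_def using W CV CW dC
      by (subst mult_minus_distrib_mat[of _ "d (Suc K)" "d K" _ "d 0"]
        | subst mult_minus_distrib_mat[of _ "d (Suc K)" "d K" _ "d 0"] | simp add: minus_carrier_mat)+
    have 2: "?D (Suc K) * (?CV - ?CW) = ?D (Suc K) * ?CV - ?D (Suc K) * ?CW"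
      using D CV CW by (intro mult_minus_distrib_mat) auto
    have 3: "?D (Suc K) * ?CV = ?V * ?CV - ?W * ?CV"
      using V W CV by (intro minus_mult_distrib_mat) auto
    have 4: "?D (Suc K) * ?CW = ?V * ?CW - ?W * ?CW"
      using V W CW by (intro minus_mult_distrib_mat) auto
    define VV VW WV WW WD where "VV = ?V * ?CV" "VW = ?V * ?CW"
       "WV = ?W * ?CV" "WW = ?W * ?CW" "WD = ?W * ?CD"
    have c: "VV \<in> carrier_mat (d (Suc K)) (d 0)" "VW \<in> carrier_mat (d (Suc K)) (d 0)"
      "WV \<in> carrier_mat (d (Suc K)) (d 0)" "WW \<in> carrier_mat (d (Suc K)) (d 0)" "WD \<in> carrier_mat (d (Suc K)) (d 0)"
      unfolding VV_VW_WV_WW_WD_def using V W CV CW dC by auto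
    show ?thesis
      unfolding 2 1 4 3 dchain.simps chain.simps VV_VW_WV_WW_WD_def[symmetric]
      using c by (intro eq_matI) auto
  qed
  have "fro_norm (?W * E + ?D (Suc K) * (?CV - ?CW))
     \<le> fro_norm (?W * E) + fro_norm (?D (Suc K) * (?CV - ?CW))"
    using W E D CW by (intro fro_norm_triangle mult_carrier_mat[of _ "d (Suc K)" "d K"] minus_carrier_mat) auto
  also have "fro_norm (?W * E) \<le> a * fro_norm E"
    using W E Suc.prems(3)[of "Suc K"] by (intro op_leD) auto
  also have "a * fro_norm E \<le> a * ((a + h) ^ K - a ^ K - real K * h * a ^ (K - 1))"
    using IH Suc.prems(5) by (intro mult_left_mono)
  also have "fro_norm (?D (Suc K) * (?CV - ?CW)) \<le> ((a + h) ^ K - a ^ K) * fro_norm (?D (Suc K))"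
    by (rule op_leD_right[OF dif minus_carrier_mat[OF CW] D])
  also have "\<dots> \<le> ((a + h) ^ K - a ^ K) * h"
    using Suc.prems(4)[of "Suc K"] op_le_nonneg[OF dif] by (intro mult_left_mono) auto
  also have "a * ((a + h) ^ K - a ^ K - real K * h * a ^ (K - 1)) + ((a + h) ^ K - a ^ K) * h
     = (a + h) ^ Suc K - a ^ Suc K - real (Suc K) * h * a ^ (Suc K - 1)"
    by (cases K) (auto simp: algebra_simps)
  finally show ?case unfolding split by simp
qed

text \<open>This computes the adjoint of the differential: the factor paired with \<open>D i\<close>
  is, up to scaling, the gradient in layer i. \<open>U\<close> varies in the induction because
  peeling off the top layer multiplies it by the transpose of that layer.\<close>

lemma fro_inner_dchain:
  assumes "chain_dims W d K" "chain_dims D d K" "U \<in> carrier_mat (d K) n" "X \<in> carrier_mat (d 0) n"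
  shows "fro_inner U (dchain W D (d 0) K * X)
    = (\<Sum>i=1..K. fro_inner ((tail_chain W d K i)\<^sup>T * U * (chain W (d 0) (i - 1) * X)\<^sup>T) (D i))"
  using assms
proof (induction K arbitrary: U)
  case 0
  then show ?case by (simp add: fro_inner_def)
next
  case (Suc K)
  note dW = chain_dims_le[OF Suc.prems(1) le_SucI[OF order_refl]] and dD = chain_dims_le[OF Suc.prems(2) le_SucI[OF order_refl]]
  note W = chain_dims_Suc[OF Suc.prems(1) order_refl] and D = chain_dims_Suc[OF Suc.prems(2) order_refl]
  note C = chain_carrier[OF dW] and dC = dchain_carrier[OF dW dD]
  note U = Suc.prems(3) and X = Suc.prems(4)
  let ?W = "W (Suc K)"
  let ?DC = "dchain W D (d 0) K" and ?CK = "chain W (d 0) K"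
  have WU: "?W\<^sup>T * U \<in> carrier_mat (d K) n" using W U by auto
  have CX: "?CK * X \<in> carrier_mat (d K) n" using C X by auto
  have DX: "?DC * X \<in> carrier_mat (d K) n" using dC X by auto
  have "dchain W D (d 0) (Suc K) * X = ?W * (?DC * X) + D (Suc K) * (?CK * X)"
    using W D C dC X
    by (simp add: add_mult_distrib_mat[of _ "d (Suc K)" "d 0"] assoc_mult_mat[of _ "d (Suc K)" "d K" _ "d 0"])
  then have "fro_inner U (dchain W D (d 0) (Suc K) * X)
    = fro_inner U (?W * (?DC * X)) + fro_inner U (D (Suc K) * (?CK * X))"
    using W D CX DX U fro_inner_add_right[of "?W * (?DC * X)" "d (Suc K)" n] by auto
  also have "fro_inner U (?W * (?DC * X)) = fro_inner (?W\<^sup>T * U) (?DC * X)"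
    using fro_inner_mult_left[OF W DX U] fro_inner_sym[of U "d (Suc K)" n "?W * (?DC * X)"]
      fro_inner_sym[OF WU DX] W DX U by auto
  also have "\<dots> = (\<Sum>i=1..K. fro_inner ((tail_chain W d K i)\<^sup>T * (?W\<^sup>T * U) * (chain W (d 0) (i - 1) * X)\<^sup>T) (D i))"
    using Suc.IH[OF dW dD WU X] by simp
  also have "\<dots> = (\<Sum>i=1..K. fro_inner ((tail_chain W d (Suc K) i)\<^sup>T * U * (chain W (d 0) (i - 1) * X)\<^sup>T) (D i))"
  proof (rule sum.cong[OF refl])
    fix i assume "i \<in> {1..K}"
    then have i: "i \<le> K" by simp
    note T = tail_chain_carrier[OF dW i]
    have "(tail_chain W d (Suc K) i)\<^sup>T * U = (tail_chain W d K i)\<^sup>T * (?W\<^sup>T * U)"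
      unfolding tail_chain_Suc[OF i] transpose_mult[OF W T] using T W U by (intro assoc_mult_mat) auto
    then show "fro_inner ((tail_chain W d K i)\<^sup>T * (?W\<^sup>T * U) * (chain W (d 0) (i - 1) * X)\<^sup>T) (D i)
      = fro_inner ((tail_chain W d (Suc K) i)\<^sup>T * U * (chain W (d 0) (i - 1) * X)\<^sup>T) (D i)" by simp
  qed
  also have "fro_inner U (D (Suc K) * (?CK * X)) = fro_inner (U * (?CK * X)\<^sup>T) (D (Suc K))"
  proof -
    have DCX: "D (Suc K) * (?CK * X) \<in> carrier_mat (d (Suc K)) n" using D CX by auto
    have UT: "U * (?CK * X)\<^sup>T \<in> carrier_mat (d (Suc K)) (d K)" using U CX by auto
    show ?thesis
      using fro_inner_mult_right[OF CX D U] fro_inner_sym[OF U DCX] fro_inner_sym[OF UT D] by simp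
  qed
  also have "U * (?CK * X)\<^sup>T = (tail_chain W d (Suc K) (Suc K))\<^sup>T * U * (chain W (d 0) (Suc K - 1) * X)\<^sup>T"
    using U by (simp add: tail_chain_self)
  finally show ?case by simp
qed

lemma dchain_eq_zero:
  assumes "chain_dims W d k" "\<And>j. 1 \<le> j \<Longrightarrow> j \<le> k \<Longrightarrow> D j = 0\<^sub>m (d j) (d (j - 1))"
  shows "dchain W D (d 0) k = 0\<^sub>m (d k) (d 0)"
  using assms
proof (induction k)
  case (Suc k)
  have W: "W (Suc k) \<in> carrier_mat (d (Suc k)) (d k)" using chain_dims_Suc[OF Suc.prems(1) order_refl] by simp
  have C: "chain W (d 0) k \<in> carrier_mat (d k) (d 0)"
    using chain_carrier[OF chain_dims_le[OF Suc.prems(1)]] by simp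
  have "dchain W D (d 0) k = 0\<^sub>m (d k) (d 0)"
    using Suc chain_dims_le[OF Suc.prems(1) le_SucI[OF order_refl]] by simp
  then show ?case using W C Suc.prems(2)[of "Suc k"] by simp
qed simp

text \<open>The product is affine in each single layer, so the expansion stops after the linear
  term.\<close>

lemma chain_update:
  fixes s :: real
  assumes "chain_dims W d K" and E: "E \<in> carrier_mat (d i) (d (i - 1))"
  defines "D \<equiv> (\<lambda>j. if j = i then E else 0\<^sub>m (d j) (d (j - 1)))"
  shows "chain (W(i := W i + s \<cdot>\<^sub>m E)) (d 0) K = chain W (d 0) K + s \<cdot>\<^sub>m dchain W D (d 0) K"
  using assms(1)
proof (induction K)
  case 0
  then show ?case by (intro eq_matI) auto
next
  case (Suc K)
  note dW = chain_dims_le[OF Suc.prems(1) le_SucI[OF order_refl]]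
  have dD: "chain_dims D d k" for k using E by (auto simp: chain_dims_def D_def)
  note W = chain_dims_Suc[OF Suc.prems(1) order_refl] and D = chain_dims_Suc[OF dD, of K "Suc K"]
  note C = chain_carrier[OF dW] and dC = dchain_carrier[OF dW dD]
  let ?V = "W(i := W i + s \<cdot>\<^sub>m E)"
  let ?DC = "dchain W D (d 0) K" and ?CK = "chain W (d 0) K"
  show ?case
  proof (cases "Suc K = i")
    case True
    have "chain ?V (d 0) K = ?CK" using True by (intro chain_cong) auto
    moreover have "?DC = 0\<^sub>m (d K) (d 0)"
      using True by (intro dchain_eq_zero[OF dW]) (auto simp: D_def)
    moreover have "?V (Suc K) = W (Suc K) + s \<cdot>\<^sub>m E" "D (Suc K) = E" using True by (auto simp: D_def)
    moreover have "E \<in> carrier_mat (d (Suc K)) (d K)" using E True by auto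
    ultimately show ?thesis
      using W C unfolding chain.simps dchain.simps
      by (simp add: add_mult_distrib_mat[of _ "d (Suc K)" "d K" _ _ "d 0"] mult_smult_assoc_mat[of _ "d (Suc K)" "d K" _ "d 0"])
  next
    case False
    have DS: "D (Suc K) = 0\<^sub>m (d (Suc K)) (d K)" using False by (simp add: D_def)
    have "chain ?V (d 0) (Suc K) = W (Suc K) * (?CK + s \<cdot>\<^sub>m ?DC)"
      unfolding chain.simps Suc.IH[OF dW] using False by simp
    also have "\<dots> = W (Suc K) * ?CK + s \<cdot>\<^sub>m (W (Suc K) * ?DC)"
      using W C dC by (simp add: mult_add_distrib_mat[of _ "d (Suc K)" "d K" _ "d 0"] mult_smult_distrib[of _ "d (Suc K)" "d K" _ "d 0"])
    also have "W (Suc K) * ?DC = dchain W D (d 0) (Suc K)"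
      using W C dC DS by simp
    finally show ?thesis by simp
  qed
qed

section \<open>The gradient in closed form\<close>

definition layer_grad :: "real \<Rightarrow> real mat \<Rightarrow> real mat \<Rightarrow> (nat \<Rightarrow> nat) \<Rightarrow> nat \<Rightarrow> (nat \<Rightarrow> real mat) \<Rightarrow> nat \<Rightarrow> real mat" where
  "layer_grad \<alpha> X Y d L W i = \<alpha> \<cdot>\<^sub>m ((tail_chain W d L i)\<^sup>T
      * (\<alpha> \<cdot>\<^sub>m chain W (d 0) L * X - Y) * (chain W (d 0) (i - 1) * X)\<^sup>T)"

lemma layer_grad_carrier:
  assumes "chain_dims W d L" "1 \<le> i" "i \<le> L" "X \<in> carrier_mat (d 0) n"
  shows "layer_grad \<alpha> X Y d L W i \<in> carrier_mat (d i) (d (i - 1))"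
proof -
  have "i - 1 \<le> L" using assms(3) by simp
  then show ?thesis
    using tail_chain_carrier[OF assms(1,3)] chain_carrier[OF chain_dims_le[OF assms(1), of "i - 1"]] assms
    by (auto simp: layer_grad_def)
qed

lemma fro_inner_zero_right:
  assumes "A \<in> carrier_mat r c"
  shows "fro_inner A (0\<^sub>m r c) = 0"
  using assms by (simp add: fro_inner_def)

lemma fro_inner_unit:
  assumes "A \<in> carrier_mat r c" "j < r" "k < c"
  shows "fro_inner A (mat r c (\<lambda>p. if p = (j, k) then 1 else 0)) = A $$ (j, k)"
proof -
  have "fro_inner A (mat r c (\<lambda>p. if p = (j, k) then 1 else 0))
    = (\<Sum>p\<in>{..<r} \<times> {..<c}. if p = (j, k) then A $$ p else 0)"
    using assms unfolding fro_inner_def sum.cartesian_product by (intro sum.cong) (auto split: if_splits)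
  also have "\<dots> = A $$ (j, k)" using assms by (subst sum.delta) auto
  finally show ?thesis .
qed

text \<open>Along a single entry the loss is a quadratic polynomial in \<open>s\<close>. Its linear
  coefficient is an inner product with the differential, and taking the adjoint against a matrix
  unit extracts one entry of \<open>layer_grad\<close>.\<close>

lemma partial_grad_net_loss:
  assumes W: "chain_dims W d L" and i: "1 \<le> i" "i \<le> L"
    and X: "X \<in> carrier_mat (d 0) n" and Y: "Y \<in> carrier_mat (d L) n"
  shows "partial_grad (net_loss \<alpha> X Y L) W i = layer_grad \<alpha> X Y d L W i"
proof (rule eq_matI)
  note Wi = chain_dimsD[OF W i]
  note G = layer_grad_carrier[OF W i X, of \<alpha> Y]
  show "dim_row (partial_grad (net_loss \<alpha> X Y L) W i) = dim_row (layer_grad \<alpha> X Y d L W i)"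
    "dim_col (partial_grad (net_loss \<alpha> X Y L) W i) = dim_col (layer_grad \<alpha> X Y d L W i)"
    using Wi G by (auto simp: partial_grad_def)
  fix j k assume "j < dim_row (layer_grad \<alpha> X Y d L W i)" "k < dim_col (layer_grad \<alpha> X Y d L W i)"
  then have j: "j < d i" and k: "k < d (i - 1)" using G by auto
  define E where "E = mat (d i) (d (i - 1)) (\<lambda>p. if p = (j, k) then 1 else 0 :: real)"
  define D where "D = (\<lambda>l. if l = i then E else 0\<^sub>m (d l) (d (l - 1)))"
  have E: "E \<in> carrier_mat (d i) (d (i - 1))" by (simp add: E_def)
  have dD: "chain_dims D d L" using E by (auto simp: chain_dims_def D_def)
  let ?D = "dchain W D (d 0) L" and ?C = "chain W (d 0) L"
  note C = chain_carrier[OF W] and dC = dchain_carrier[OF W dD]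
  have DX: "?D * X \<in> carrier_mat (d L) n" using dC X by auto
  define U where "U = \<alpha> \<cdot>\<^sub>m ?C * X - Y"
  have U: "U \<in> carrier_mat (d L) n" using C X Y by (simp add: U_def minus_carrier_mat)
  define N where "N = \<alpha> \<cdot>\<^sub>m (?D * X)"
  have N: "N \<in> carrier_mat (d L) n" using DX by (simp add: N_def)
  have pert: "perturb W i j k s = W(i := W i + s \<cdot>\<^sub>m E)" for s
    unfolding perturb_def using Wi by (intro arg_cong[of _ _ "\<lambda>M. W(i := M)"] eq_matI) (auto simp: E_def)
  have loss: "net_loss \<alpha> X Y L (perturb W i j k s)
      = (1/2) * ((fro_norm U)\<^sup>2 + 2 * s * fro_inner U N + s\<^sup>2 * (fro_norm N)\<^sup>2)" for s
  proof -
    have "\<alpha> \<cdot>\<^sub>m chain (perturb W i j k s) (d 0) L * X - Y = U + s \<cdot>\<^sub>m N"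
    proof -
      have 1: "\<alpha> \<cdot>\<^sub>m (?C + s \<cdot>\<^sub>m ?D) * X
        = \<alpha> \<cdot>\<^sub>m (?C * X) + \<alpha> \<cdot>\<^sub>m (s \<cdot>\<^sub>m (?D * X))"
        using C dC X by (simp add: mult_smult_assoc_mat[of _ "d L" "d 0" _ n] add_mult_distrib_mat[of _ "d L" "d 0" _ _ n]
            add_smult_distrib_left_mat[of _ "d L" n])
      have 2: "\<alpha> \<cdot>\<^sub>m ?C * X = \<alpha> \<cdot>\<^sub>m (?C * X)"
        using C X by (simp add: mult_smult_assoc_mat[of _ "d L" "d 0" _ n])
      define P where "P = ?C * X"
      define R where "R = ?D * X"
      have "P \<in> carrier_mat (d L) n" "R \<in> carrier_mat (d L) n" using C X DX by (auto simp: P_def R_def)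
      then show ?thesis
        unfolding pert chain_update[OF W E, folded D_def] 1 U_def N_def 2 P_def[symmetric] R_def[symmetric]
        using Y by (intro eq_matI) auto
    qed
    then show ?thesis
      using X N U unfolding net_loss_def
      by (simp add: fro_norm_add_square[of U "d L" n "s \<cdot>\<^sub>m N"] fro_inner_smult_right[OF U N]
          fro_norm_smult power_mult_distrib)
  qed
  have "((\<lambda>s. net_loss \<alpha> X Y L (perturb W i j k s)) has_real_derivative fro_inner U N) (at 0)"
    unfolding loss by (auto intro!: derivative_eq_intros)
  then have "deriv (\<lambda>s. net_loss \<alpha> X Y L (perturb W i j k s)) 0 = fro_inner U N"
    by (rule DERIV_imp_deriv)
  also have "\<dots> = \<alpha> * fro_inner U (?D * X)"
    unfolding N_def by (rule fro_inner_smult_right[OF U DX])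
  also have "fro_inner U (?D * X)
    = (\<Sum>l=1..L. fro_inner ((tail_chain W d L l)\<^sup>T * U * (chain W (d 0) (l - 1) * X)\<^sup>T) (D l))"
    by (rule fro_inner_dchain[OF W dD U X])
  also have "\<dots> = (\<Sum>l=1..L. if l = i then fro_inner ((tail_chain W d L i)\<^sup>T * U * (chain W (d 0) (i - 1) * X)\<^sup>T) E else 0)"
  proof (rule sum.cong[OF refl])
    fix l assume l: "l \<in> {1..L}"
    then have "l - 1 \<le> L" by auto
    then have "(tail_chain W d L l)\<^sup>T * U * (chain W (d 0) (l - 1) * X)\<^sup>T \<in> carrier_mat (d l) (d (l - 1))"
      using tail_chain_carrier[OF W, of l] chain_carrier[OF chain_dims_le[OF W, of "l - 1"]] U X l by auto
    then show "fro_inner ((tail_chain W d L l)\<^sup>T * U * (chain W (d 0) (l - 1) * X)\<^sup>T) (D l)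
      = (if l = i then fro_inner ((tail_chain W d L i)\<^sup>T * U * (chain W (d 0) (i - 1) * X)\<^sup>T) E else 0)"
      by (cases "l = i") (auto simp: D_def fro_inner_zero_right)
  qed
  also have "\<dots> = fro_inner ((tail_chain W d L i)\<^sup>T * U * (chain W (d 0) (i - 1) * X)\<^sup>T) E"
    using i by (subst sum.delta) auto
  also have "\<alpha> * \<dots> = fro_inner (layer_grad \<alpha> X Y d L W i) E"
    by (simp add: layer_grad_def U_def fro_inner_smult_left)
  also have "\<dots> = layer_grad \<alpha> X Y d L W i $$ (j, k)"
    unfolding E_def using G j k by (rule fro_inner_unit)
  finally show "partial_grad (net_loss \<alpha> X Y L) W i $$ (j, k) = layer_grad \<alpha> X Y d L W i $$ (j, k)"
    using j k Wi by (simp add: partial_grad_def)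
qed

subsection \<open>Gradient descent from a nearly isometric start\<close>

text \<open>The gradient involves the output error only after multiplication by the transpose of
  \<open>X\<close>, where \<open>Y\<close> and \<open>Ws * X\<close> agree by \<open>opt\<close>.
  The first form, with that product isolated, serves the norm bounds; the second matches the adjoint
  of the differential.\<close>

lemma layer_grad_residual:
  fixes \<alpha> :: real
  assumes W: "chain_dims W d L" and i: "1 \<le> i" "i \<le> L"
    and X: "X \<in> carrier_mat (d 0) n" and Y: "Y \<in> carrier_mat (d L) n" and Ws: "Ws \<in> carrier_mat (d L) (d 0)"
    and opt: "(Ws * X - Y) * X\<^sup>T = 0\<^sub>m (d L) (d 0)"
  defines "U \<equiv> \<alpha> \<cdot>\<^sub>m chain W (d 0) L * X - Ws * X"
  shows "layer_grad \<alpha> X Y d L W i = \<alpha> \<cdot>\<^sub>m ((tail_chain W d L i)\<^sup>T * (U * X\<^sup>T) * (chain W (d 0) (i - 1))\<^sup>T)"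
    "layer_grad \<alpha> X Y d L W i = \<alpha> \<cdot>\<^sub>m ((tail_chain W d L i)\<^sup>T * U * (chain W (d 0) (i - 1) * X)\<^sup>T)"
proof -
  let ?T = "(tail_chain W d L i)\<^sup>T" let ?C = "chain W (d 0) (i - 1)"
  have iL: "i - 1 \<le> L" using i by simp
  have T: "?T \<in> carrier_mat (d i) (d L)" using tail_chain_carrier[OF W i(2)] by simp
  have C: "?C \<in> carrier_mat (d (i - 1)) (d 0)" by (rule chain_carrier[OF chain_dims_le[OF W iL]])
  have CL: "\<alpha> \<cdot>\<^sub>m chain W (d 0) L * X \<in> carrier_mat (d L) n" using chain_carrier[OF W] X by auto
  have WX: "Ws * X \<in> carrier_mat (d L) n" using Ws X by auto
  have U: "U \<in> carrier_mat (d L) n" using WX by (simp add: U_def minus_carrier_mat)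
  have XT: "X\<^sup>T \<in> carrier_mat n (d 0)" using X by simp
  have assoc: "?T * Z * (?C * X)\<^sup>T = ?T * (Z * X\<^sup>T) * ?C\<^sup>T" if Z: "Z \<in> carrier_mat (d L) n" for Z
  proof -
    have CT: "?C\<^sup>T \<in> carrier_mat (d 0) (d (i - 1))" using C by simp
    have ZX: "Z * X\<^sup>T \<in> carrier_mat (d L) (d 0)" using Z XT by simp
    have "?T * Z * (?C * X)\<^sup>T = ?T * (Z * (X\<^sup>T * ?C\<^sup>T))"
      unfolding transpose_mult[OF C X] by (rule assoc_mult_mat[OF T Z mult_carrier_mat[OF XT CT]])
    also have "Z * (X\<^sup>T * ?C\<^sup>T) = Z * X\<^sup>T * ?C\<^sup>T" by (rule assoc_mult_mat[OF Z XT CT, symmetric])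
    also have "?T * (Z * X\<^sup>T * ?C\<^sup>T) = ?T * (Z * X\<^sup>T) * ?C\<^sup>T"
      by (rule assoc_mult_mat[OF T ZX CT, symmetric])
    finally show ?thesis .
  qed
  have UY: "\<alpha> \<cdot>\<^sub>m chain W (d 0) L * X - Y \<in> carrier_mat (d L) n" using Y by (simp add: minus_carrier_mat)
  have "\<alpha> \<cdot>\<^sub>m chain W (d 0) L * X - Y = U + (Ws * X - Y)"
    unfolding U_def by (rule mat_diff_split[OF CL WX Y])
  then have "(\<alpha> \<cdot>\<^sub>m chain W (d 0) L * X - Y) * X\<^sup>T = U * X\<^sup>T + (Ws * X - Y) * X\<^sup>T"
    using U WX Y XT by (simp add: add_mult_distrib_mat[of U "d L" n _ "X\<^sup>T" "d 0"] minus_carrier_mat)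
  then have UX: "(\<alpha> \<cdot>\<^sub>m chain W (d 0) L * X - Y) * X\<^sup>T = U * X\<^sup>T"
    unfolding opt using U XT by auto
  show "layer_grad \<alpha> X Y d L W i = \<alpha> \<cdot>\<^sub>m (?T * (U * X\<^sup>T) * ?C\<^sup>T)"
    unfolding layer_grad_def assoc[OF UY] UX ..
  then show "layer_grad \<alpha> X Y d L W i = \<alpha> \<cdot>\<^sub>m (?T * U * (?C * X)\<^sup>T)"
    unfolding assoc[OF U] .
qed

text \<open>With z = K h / a the power is at most a^K exp z, and exp z \<le> 1 + z + z^2 on the unit
  interval.\<close>

lemma power_second_order_le:
  fixes a h :: real
  assumes "0 < a" "0 \<le> h" "real K * h \<le> a"
  shows "(a + h) ^ K - a ^ K - real K * h * a ^ (K - 1) \<le> a ^ (K - 1) * (real K * h)\<^sup>2 / a"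
proof (cases K)
  case (Suc k)
  define z where "z = real K * h / a"
  have z: "0 \<le> z" "z \<le> 1" using assms by (auto simp: z_def)
  have "(1 + h / a) ^ K \<le> exp (h / a) ^ K"
    using assms by (intro power_mono) (auto simp: add_nonneg_nonneg)
  also have "\<dots> = exp z" by (simp add: z_def exp_of_nat_mult[symmetric])
  also have "\<dots> \<le> 1 + z + z\<^sup>2" using z by (rule exp_bound)
  finally have "a ^ K * (1 + h / a) ^ K \<le> a ^ K * (1 + z + z\<^sup>2)"
    using assms by (intro mult_left_mono) auto
  moreover have "a ^ K * (1 + h / a) ^ K = (a + h) ^ K"
    using assms by (simp add: power_mult_distrib[symmetric] field_simps)
  moreover have "a ^ K * z = real K * h * a ^ (K - 1)" using assms Suc by (simp add: z_def)
  moreover have "a ^ K * z\<^sup>2 = a ^ (K - 1) * (real K * h)\<^sup>2 / a"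
    using assms Suc by (simp add: z_def power2_eq_square)
  ultimately show ?thesis by (simp add: algebra_simps)
qed simp

text \<open>The first-order part of the step contracts the residual, because its inner
  product with the residual is minus \<open>\<eta>\<close> times the squared gradient norm; the rest is quadratic in the step.\<close>
lemma gd_step:
  assumes W: "chain_dims W d L" and L: "1 \<le> L"
    and X: "X \<in> carrier_mat (d 0) n" and Y: "Y \<in> carrier_mat (d L) n" and Ws: "Ws \<in> carrier_mat (d L) (d 0)"
    and opt: "(Ws * X - Y) * X\<^sup>T = 0\<^sub>m (d L) (d 0)"
    and a: "0 < a" "\<And>i. 1 \<le> i \<Longrightarrow> i \<le> L \<Longrightarrow> op_le (W i) a"
    and x: "op_le X x"
    and tail: "\<And>i. 1 \<le> i \<Longrightarrow> i \<le> L \<Longrightarrow> op_ge (tail_chain W d L i)\<^sup>T (l1 i)"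
    and head: "\<And>i. 1 \<le> i \<Longrightarrow> i \<le> L \<Longrightarrow> op_ge (chain W (d 0) (i - 1)) (l2 i)"
    and l: "\<And>i. 1 \<le> i \<Longrightarrow> i \<le> L \<Longrightarrow> 0 \<le> l1 i \<and> 0 \<le> l2 i \<and> c \<le> \<alpha> * l1 i * l2 i"
    and c: "0 \<le> c" and \<alpha>: "0 < \<alpha>" and s: "0 \<le> s"
    and low: "\<And>B. B \<in> carrier_mat (d L) (d 0) \<Longrightarrow> sqrt s * fro_norm (B * X) \<le> fro_norm (B * X * X\<^sup>T)"
    and b: "\<alpha> * a ^ (L - 1) * x \<le> b" and \<eta>: "0 < \<eta>" and \<eta>b: "\<eta> * real L * b\<^sup>2 \<le> 2"
  defines "U \<equiv> \<alpha> \<cdot>\<^sub>m chain W (d 0) L * X - Ws * X"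
  assumes small: "real L * (\<eta> * b * fro_norm U) \<le> a"
    and V: "\<And>i. 1 \<le> i \<Longrightarrow> i \<le> L \<Longrightarrow> V i = W i - \<eta> \<cdot>\<^sub>m layer_grad \<alpha> X Y d L W i"
  shows "chain_dims V d L"
    and "\<And>i. 1 \<le> i \<Longrightarrow> i \<le> L \<Longrightarrow> fro_norm (V i - W i) \<le> \<eta> * b * fro_norm U"
    and "fro_norm (\<alpha> \<cdot>\<^sub>m chain V (d 0) L * X - Ws * X)
      \<le> sqrt (1 - \<eta> * real L * c\<^sup>2 * s * (2 - \<eta> * real L * b\<^sup>2)) * fro_norm U
        + b * (real L * (\<eta> * b * fro_norm U))\<^sup>2 / a"
proof -
  let ?G = "layer_grad \<alpha> X Y d L W"
  let ?D = "\<lambda>i. V i - W i" and ?T = "\<lambda>i. (tail_chain W d L i)\<^sup>T" and ?C = "\<lambda>i. chain W (d 0) (i - 1)"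
  let ?u = "fro_norm U" and ?SG = "\<Sum>i=1..L. fro_norm (?G i)"
  have x0: "0 \<le> x" by (rule op_le_nonneg[OF x])
  have b0: "0 \<le> b" using b a \<alpha> x0 by (meson mult_nonneg_nonneg order_trans less_imp_le zero_le_power)
  note C = chain_carrier[OF W]
  have CX: "\<alpha> \<cdot>\<^sub>m chain W (d 0) L * X \<in> carrier_mat (d L) n" using C X by auto
  have WX: "Ws * X \<in> carrier_mat (d L) n" using Ws X by auto
  have U: "U \<in> carrier_mat (d L) n" using WX by (simp add: U_def minus_carrier_mat)
  have UX: "U * X\<^sup>T \<in> carrier_mat (d L) (d 0)" using U X by auto
  have G: "?G i \<in> carrier_mat (d i) (d (i - 1))" if "1 \<le> i" "i \<le> L" for i
    by (rule layer_grad_carrier[OF W that X])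
  have D: "?D i = (- \<eta>) \<cdot>\<^sub>m ?G i" if "1 \<le> i" "i \<le> L" for i
    unfolding V[OF that] using G[OF that] chain_dimsD[OF W that] by (intro eq_matI) auto
  have Vc: "V i \<in> carrier_mat (d i) (d (i - 1))" if "1 \<le> i" "i \<le> L" for i
    unfolding V[OF that] using G[OF that] by (intro minus_carrier_mat) auto
  then show dV: "chain_dims V d L" by (simp add: chain_dims_def)
  have dD: "chain_dims ?D d L"
    using chain_dimsD[OF W] by (auto simp: chain_dims_def intro!: minus_carrier_mat)
  have T: "?T i \<in> carrier_mat (d i) (d L)" if "i \<le> L" for i
    using tail_chain_carrier[OF W that] by simp
  have Ci: "?C i \<in> carrier_mat (d (i - 1)) (d 0)" if "i \<le> L" for i
    using that by (intro chain_carrier[OF chain_dims_le[OF W]]) auto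
  have UXx: "fro_norm (U * X\<^sup>T) \<le> x * ?u"
    using op_leD_right[OF op_le_transpose[OF x] _ U, of "d 0"] X by simp
  \<comment> \<open>\<open>U\<close> is a matrix times \<open>X\<close>, so \<open>low\<close>
    applies; a residual against \<open>Y\<close> would not have this form.\<close>
  have UXs: "sqrt s * ?u \<le> fro_norm (U * X\<^sup>T)"
  proof -
    have "U = (\<alpha> \<cdot>\<^sub>m chain W (d 0) L - Ws) * X"
      unfolding U_def using C X Ws by (intro minus_mult_distrib_mat[symmetric]) auto
    then show ?thesis using low[of "\<alpha> \<cdot>\<^sub>m chain W (d 0) L - Ws"] Ws by (simp add: minus_carrier_mat)
  qed
  note grad = layer_grad_residual[OF W _ _ X Y Ws opt, where \<alpha> = \<alpha>, folded U_def]
  have G_le: "fro_norm (?G i) \<le> b * ?u" if i: "1 \<le> i" "i \<le> L" for i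
  proof -
    have iL: "i - 1 \<le> L" using i by simp
    have opT: "op_le (?T i) (a ^ (L - i))"
      unfolding tail_chain_def
      using chain_op_le[OF chain_dims_shift[OF W, of i "L - i"], of a] a(2) i
      by (intro op_le_transpose) auto
    have opC: "op_le (?C i)\<^sup>T (a ^ (i - 1))"
      using a(2) i by (intro op_le_transpose chain_op_le[OF chain_dims_le[OF W iL]]) auto
    have "fro_norm (?T i * (U * X\<^sup>T) * (?C i)\<^sup>T)
      \<le> a ^ (i - 1) * fro_norm (?T i * (U * X\<^sup>T))"
      by (rule op_leD_right[OF opC, of "d 0" "d (i - 1)" _ "d i"]) (use Ci[OF i(2)] T[OF i(2)] UX in auto)
    also have "\<dots> \<le> a ^ (i - 1) * (a ^ (L - i) * (x * ?u))"
    proof (rule mult_left_mono)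
      have "fro_norm (?T i * (U * X\<^sup>T)) \<le> a ^ (L - i) * fro_norm (U * X\<^sup>T)"
        by (rule op_leD[OF opT T[OF i(2)] UX])
      also have "\<dots> \<le> a ^ (L - i) * (x * ?u)"
        using UXx a(1) by (intro mult_left_mono) auto
      finally show "fro_norm (?T i * (U * X\<^sup>T)) \<le> a ^ (L - i) * (x * ?u)" .
    qed (use a in simp)
    also have "\<dots> = a ^ (L - 1) * x * ?u"
      using i by (simp add: power_add[symmetric] mult.assoc[symmetric])
    finally have "fro_norm (?G i) \<le> (\<alpha> * a ^ (L - 1) * x) * ?u"
      unfolding grad(1)[OF i] fro_norm_smult using \<alpha> by (simp add: mult.assoc)
    also have "\<dots> \<le> b * ?u" using b by (intro mult_right_mono) auto
    finally show ?thesis .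
  qed
  have G_ge: "c * sqrt s * ?u \<le> fro_norm (?G i)" if i: "1 \<le> i" "i \<le> L" for i
  proof -
    have "c * (sqrt s * ?u) \<le> \<alpha> * l1 i * l2 i * (sqrt s * ?u)"
      using l[OF i] s by (intro mult_right_mono) auto
    also have "\<dots> \<le> \<alpha> * l1 i * l2 i * fro_norm (U * X\<^sup>T)"
      using UXs l[OF i] \<alpha> by (intro mult_left_mono) auto
    also have "\<dots> = \<alpha> * (l2 i * (l1 i * fro_norm (U * X\<^sup>T)))" by simp
    also have "\<dots> \<le> \<alpha> * (l2 i * fro_norm (?T i * (U * X\<^sup>T)))"
      using op_geD[OF tail[OF i] T[OF i(2)] UX] l[OF i] \<alpha> by (intro mult_left_mono) auto
    also have "\<dots> \<le> \<alpha> * fro_norm (?T i * (U * X\<^sup>T) * (?C i)\<^sup>T)"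
    proof (rule mult_left_mono)
      show "l2 i * fro_norm (?T i * (U * X\<^sup>T))
        \<le> fro_norm (?T i * (U * X\<^sup>T) * (?C i)\<^sup>T)"
        by (rule op_geD_right[of _ _ "d 0" "d (i - 1)" _ "d i"]) (use head[OF i] Ci[OF i(2)] T[OF i(2)] UX in auto)
    qed (use \<alpha> in simp)
    also have "\<dots> = fro_norm (?G i)" unfolding grad(1)[OF i] fro_norm_smult using \<alpha> by simp
    finally show ?thesis by (simp add: mult.assoc)
  qed
  show D_le: "fro_norm (?D i) \<le> \<eta> * b * ?u" if i: "1 \<le> i" "i \<le> L" for i
    unfolding D[OF i] fro_norm_smult using mult_left_mono[OF G_le[OF i], of \<eta>] \<eta> by (simp add: mult.assoc)
  define S where "S = (\<Sum>i=1..L. (fro_norm (?G i))\<^sup>2)"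
  define N where "N = \<alpha> \<cdot>\<^sub>m (dchain W ?D (d 0) L * X)"
  have DX: "dchain W ?D (d 0) L * X \<in> carrier_mat (d L) n" using dchain_carrier[OF W dD] X by auto
  have N: "N \<in> carrier_mat (d L) n" using DX by (simp add: N_def)
  have inner: "fro_inner U N = - \<eta> * S"
  proof -
    have "fro_inner U N = \<alpha> * fro_inner U (dchain W ?D (d 0) L * X)"
      unfolding N_def by (rule fro_inner_smult_right[OF U DX])
    also have "\<dots> = (\<Sum>i=1..L. \<alpha> * fro_inner (?T i * U * (?C i * X)\<^sup>T) (?D i))"
      unfolding fro_inner_dchain[OF W dD U X] by (rule sum_distrib_left)
    also have "\<dots> = (\<Sum>i=1..L. - \<eta> * (fro_norm (?G i))\<^sup>2)"
    proof (rule sum.cong[OF refl])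
      fix i assume "i \<in> {1..L}"
      then have i: "1 \<le> i" "i \<le> L" by auto
      have "\<alpha> * fro_inner (?T i * U * (?C i * X)\<^sup>T) (?D i) = fro_inner (?G i) (?D i)"
        by (simp add: grad(2)[OF i] fro_inner_smult_left)
      also have "\<dots> = - \<eta> * fro_inner (?G i) (?G i)"
        unfolding D[OF i] by (rule fro_inner_smult_right[OF G[OF i] G[OF i]])
      finally show "\<alpha> * fro_inner (?T i * U * (?C i * X)\<^sup>T) (?D i)
        = - \<eta> * (fro_norm (?G i))\<^sup>2" by (simp add: fro_norm_square)
    qed
    finally show ?thesis by (simp add: S_def sum_distrib_left)
  qed
  \<comment> \<open>Keeping \<open>S\<close> instead of bounding each gradient by
    \<open>b * ?u\<close> lets the quadratic term be absorbed by the linear decrease. Cauchy-Schwarz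
    over the layers costs the factor \<open>L\<close>.\<close>
  have N_le: "(fro_norm N)\<^sup>2 \<le> \<eta>\<^sup>2 * b\<^sup>2 * (real L * S)"
  proof -
    have "fro_norm N \<le> \<alpha> * (x * fro_norm (dchain W ?D (d 0) L))"
      unfolding N_def fro_norm_smult using op_leD_right[OF x X dchain_carrier[OF W dD]] \<alpha> by simp
    also have "\<dots> \<le> \<alpha> * (x * (a ^ (L - 1) * (\<Sum>i=1..L. fro_norm (?D i))))"
      using dchain_fro_norm_le[OF W dD a(2)] a(1) \<alpha> x0 by (intro mult_left_mono) auto
    also have "(\<Sum>i=1..L. fro_norm (?D i)) = (\<Sum>i=1..L. \<eta> * fro_norm (?G i))"
      using D \<eta> by (intro sum.cong) (auto simp: fro_norm_smult)
    also have "\<dots> = \<eta> * ?SG" by (simp add: sum_distrib_left)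
    also have "\<alpha> * (x * (a ^ (L - 1) * (\<eta> * ?SG)))
      = (\<alpha> * a ^ (L - 1) * x) * (\<eta> * ?SG)" by simp
    also have "\<dots> \<le> b * (\<eta> * ?SG)"
      using b \<eta> by (intro mult_right_mono) (auto intro!: mult_nonneg_nonneg sum_nonneg)
    finally have "(fro_norm N)\<^sup>2 \<le> (b * (\<eta> * ?SG))\<^sup>2"
      by (intro power_mono) auto
    also have "\<dots> = \<eta>\<^sup>2 * b\<^sup>2 * ?SG\<^sup>2" by (simp add: power_mult_distrib)
    also have "\<dots> \<le> \<eta>\<^sup>2 * b\<^sup>2 * (real L * S)"
    proof (rule mult_left_mono)
      have "(\<Sum>i=1..L. 1 * fro_norm (?G i))\<^sup>2 \<le> (\<Sum>i=1..L. 1\<^sup>2) * S"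
        unfolding S_def by (rule Cauchy_Schwarz_ineq_sum)
      then show "?SG\<^sup>2 \<le> real L * S" by simp
    qed simp
    finally show ?thesis .
  qed
  have S_ge: "real L * (c\<^sup>2 * s * (?u)\<^sup>2) \<le> S"
  proof -
    have "(\<Sum>i=1..L. c\<^sup>2 * s * (?u)\<^sup>2) \<le> S"
      unfolding S_def
    proof (rule sum_mono)
      fix i assume "i \<in> {1..L}"
      then have "(c * sqrt s * ?u)\<^sup>2 \<le> (fro_norm (?G i))\<^sup>2"
        using G_ge[of i] c s by (intro power_mono) auto
      then show "c\<^sup>2 * s * (?u)\<^sup>2 \<le> (fro_norm (?G i))\<^sup>2" using s by (simp add: power_mult_distrib)
    qed
    then show ?thesis by simp
  qed
  have first: "fro_norm (U + N) \<le> sqrt (1 - \<eta> * real L * c\<^sup>2 * s * (2 - \<eta> * real L * b\<^sup>2)) * ?u"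
  proof -
    have "(fro_norm (U + N))\<^sup>2 = (?u)\<^sup>2 + 2 * (- \<eta> * S) + (fro_norm N)\<^sup>2"
      unfolding fro_norm_add_square[OF U N] inner ..
    also have "\<dots> \<le> (?u)\<^sup>2 + 2 * (- \<eta> * S) + \<eta>\<^sup>2 * b\<^sup>2 * (real L * S)" using N_le by simp
    also have "\<dots> = (?u)\<^sup>2 - \<eta> * (2 - \<eta> * real L * b\<^sup>2) * S"
      by (simp add: algebra_simps power2_eq_square)
    \<comment> \<open>By \<open>\<eta>b\<close> the coefficient of \<open>S\<close> has a sign, so
      the lower bound on \<open>S\<close> may be inserted.\<close>
    also have "\<dots> \<le> (?u)\<^sup>2 - \<eta> * (2 - \<eta> * real L * b\<^sup>2) * (real L * (c\<^sup>2 * s * (?u)\<^sup>2))"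
      using S_ge \<eta> \<eta>b by (intro diff_left_mono mult_left_mono mult_nonneg_nonneg) auto
    also have "\<dots> = (1 - \<eta> * real L * c\<^sup>2 * s * (2 - \<eta> * real L * b\<^sup>2)) * (?u)\<^sup>2"
      by (simp add: algebra_simps)
    finally have "sqrt ((fro_norm (U + N))\<^sup>2) \<le> sqrt ((1 - \<eta> * real L * c\<^sup>2 * s * (2 - \<eta> * real L * b\<^sup>2)) * (?u)\<^sup>2)"
      by (rule real_sqrt_le_mono)
    then show ?thesis by (simp add: real_sqrt_mult)
  qed
  define R where "R = chain V (d 0) L - chain W (d 0) L - dchain W ?D (d 0) L"
  have R: "R \<in> carrier_mat (d L) (d 0)"
    using dchain_carrier[OF W dD] by (simp add: R_def minus_carrier_mat)
  have R_le: "fro_norm R \<le> a ^ (L - 1) * (real L * (\<eta> * b * ?u))\<^sup>2 / a"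
  proof -
    have "fro_norm R \<le> (a + \<eta> * b * ?u) ^ L - a ^ L - real L * (\<eta> * b * ?u) * a ^ (L - 1)"
      unfolding R_def using a(1) by (intro chain_second_order[OF dV W a(2) D_le]) auto
    also have "\<dots> \<le> a ^ (L - 1) * (real L * (\<eta> * b * ?u))\<^sup>2 / a"
      using a(1) small \<eta> b0 by (intro power_second_order_le) auto
    finally show ?thesis .
  qed
  have split: "\<alpha> \<cdot>\<^sub>m chain V (d 0) L * X - Ws * X = (U + N) + \<alpha> \<cdot>\<^sub>m (R * X)"
  proof -
    let ?V = "chain V (d 0) L * X" and ?W = "chain W (d 0) L * X" and ?D' = "dchain W ?D (d 0) L * X"
    note CV = chain_carrier[OF dV]
    have c: "?V \<in> carrier_mat (d L) n" "?W \<in> carrier_mat (d L) n" using CV C X by auto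
    have RX: "R * X = ?V - ?W - ?D'"
      unfolding R_def using CV C dchain_carrier[OF W dD] X
      by (simp add: minus_mult_distrib_mat[of _ "d L" "d 0" _ _ n] minus_carrier_mat)
    have 1: "\<alpha> \<cdot>\<^sub>m chain V (d 0) L * X = \<alpha> \<cdot>\<^sub>m ?V" "\<alpha> \<cdot>\<^sub>m chain W (d 0) L * X = \<alpha> \<cdot>\<^sub>m ?W"
      using CV C X by (auto intro: mult_smult_assoc_mat)
    define PV PW PD PS where P: "PV = ?V" "PW = ?W" "PD = ?D'" "PS = Ws * X"
    show ?thesis unfolding RX U_def N_def 1 P[symmetric]
      using c DX WX unfolding P[symmetric] by (intro eq_matI) (auto simp: algebra_simps)
  qed
  have "fro_norm (\<alpha> \<cdot>\<^sub>m (R * X)) \<le> \<alpha> * (x * fro_norm R)"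
    unfolding fro_norm_smult using op_leD_right[OF x X R] \<alpha> by simp
  also have "\<dots> \<le> \<alpha> * (x * (a ^ (L - 1) * (real L * (\<eta> * b * ?u))\<^sup>2 / a))"
    using R_le \<alpha> x0 by (intro mult_left_mono) auto
  also have "\<dots> = (\<alpha> * a ^ (L - 1) * x) * ((real L * (\<eta> * b * ?u))\<^sup>2 / a)" by simp
  also have "\<dots> \<le> b * ((real L * (\<eta> * b * ?u))\<^sup>2 / a)"
    using b a(1) by (intro mult_right_mono) auto
  finally have "fro_norm (\<alpha> \<cdot>\<^sub>m (R * X)) \<le> b * (real L * (\<eta> * b * ?u))\<^sup>2 / a" by simp
  moreover have "fro_norm ((U + N) + \<alpha> \<cdot>\<^sub>m (R * X)) \<le> fro_norm (U + N) + fro_norm (\<alpha> \<cdot>\<^sub>m (R * X))"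
    using U N R X by (intro fro_norm_triangle[of _ "d L" n]) auto
  ultimately show "fro_norm (\<alpha> \<cdot>\<^sub>m chain V (d 0) L * X - Ws * X)
      \<le> sqrt (1 - \<eta> * real L * c\<^sup>2 * s * (2 - \<eta> * real L * b\<^sup>2)) * ?u
        + b * (real L * (\<eta> * b * ?u))\<^sup>2 / a"
    unfolding split using first by linarith
qed

text \<open>Here \<open>x\<close> is the norm of the data, \<open>y\<close> the square root of the
  output dimension and \<open>l\<close> the depth. \<open>b\<close> bounds the gradient from above,
  \<open>c\<close> from below, the latter with a square since head and tail may both shrink. The
  budget: the first-order part removes 17/25 of \<open>q\<close>, the remainder gives back at most
  1/100, and more than half of \<open>q\<close> is left.\<close>

lemma gd_step_scalar:
  fixes x y s \<eta> \<mu> a u l :: real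
  assumes pos: "0 < x" "0 < y" "0 < s" "0 < \<eta>" "0 < \<mu>" "0 \<le> u" "0 < l"
    and sx: "s \<le> x\<^sup>2" and \<eta>: "\<eta> * l * x\<^sup>2 \<le> y\<^sup>2 / 2" and small: "x * y * u \<le> s * \<mu> / 250" and a: "\<mu> \<le> a"
  defines "b \<equiv> 51/50 * x / y" and "c \<equiv> (49/50)\<^sup>2 / y" and "q \<equiv> \<eta> * l * s / y\<^sup>2"
  shows "0 \<le> q" "q \<le> 1/2" "\<eta> * l * b\<^sup>2 \<le> 2" "l * (\<eta> * b * u) \<le> a"
    "sqrt (1 - \<eta> * l * c\<^sup>2 * s * (2 - \<eta> * l * b\<^sup>2)) * u + b * (l * (\<eta> * b * u))\<^sup>2 / a \<le> (1 - q / 2) * u"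
proof -
  define p where "p = \<eta> * l * x\<^sup>2 / y\<^sup>2"
  have p: "0 \<le> p" "p \<le> 1/2" using pos \<eta> by (auto simp: p_def field_simps)
  show q0: "0 \<le> q" using pos by (simp add: q_def)
  have "q \<le> p" unfolding q_def p_def using pos sx by (intro divide_right_mono mult_left_mono) auto
  then show q1: "q \<le> 1/2" using p by simp
  have b2: "\<eta> * l * b\<^sup>2 = 2601/2500 * p" by (simp add: b_def p_def power_divide power_mult_distrib)
  then show "\<eta> * l * b\<^sup>2 \<le> 2" using p by simp
  have b0: "0 < b" using pos by (simp add: b_def)
  have bx: "\<eta> * l * b * x \<le> 51/100 * y"
  proof -
    have "\<eta> * l * b * x = 51/50 * (\<eta> * l * x\<^sup>2) / y" by (simp add: b_def power2_eq_square)
    also have "\<dots> \<le> 51/50 * (y\<^sup>2 / 2) / y" using \<eta> pos by (intro divide_right_mono mult_left_mono) auto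
    also have "\<dots> = 51/100 * y" using pos by (simp add: power2_eq_square)
    finally show ?thesis .
  qed
  have yu: "x * (y * u) \<le> x * (x * \<mu> / 250)"
  proof -
    have "s * \<mu> / 250 \<le> x\<^sup>2 * \<mu> / 250" using sx pos by (intro divide_right_mono mult_right_mono) auto
    then show ?thesis using small by (simp add: power2_eq_square mult.assoc)
  qed
  then have yu: "y * u \<le> x * \<mu> / 250" using pos by (simp only: mult_le_cancel_left_pos)
  have "x * (l * (\<eta> * b * u)) = (\<eta> * l * b * x) * u" by simp
  also have "\<dots> \<le> 51/100 * y * u" using bx pos by (intro mult_right_mono) auto
  also have "51/100 * y * u \<le> x * \<mu>"
    using yu mult_nonneg_nonneg[of y u] mult_pos_pos[of x \<mu>] pos unfolding mult.assoc by linarith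
  finally show "l * (\<eta> * b * u) \<le> a" using pos a by (simp add: mult_le_cancel_left_pos)
  have z1: "\<eta> * l * c\<^sup>2 * s = (49/50)^4 * q"
    by (simp add: c_def q_def power_divide power2_eq_square)
  have zq: "34/25 * q \<le> \<eta> * l * c\<^sup>2 * s * (2 - \<eta> * l * b\<^sup>2)"
  proof -
    \<comment> \<open>The step size gives \<open>p \<le> 1/2\<close>, and (49/50)^4 * (2 - 0.5202)
      is about 1.365, just above 34/25, which is twice 17/25.\<close>
    have "34/25 * q \<le> ((49/50)^4 * q) * (2 - 2601/2500 * (1/2))" using q0 by (simp add: field_simps)
    also have "\<dots> \<le> ((49/50)^4 * q) * (2 - 2601/2500 * p)" using p q0 by (intro mult_left_mono) auto
    finally show ?thesis unfolding z1 b2 .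
  qed
  have "sqrt (1 - \<eta> * l * c\<^sup>2 * s * (2 - \<eta> * l * b\<^sup>2)) \<le> sqrt ((1 - 17/25 * q)\<^sup>2)"
  proof (rule real_sqrt_le_mono)
    show "1 - \<eta> * l * c\<^sup>2 * s * (2 - \<eta> * l * b\<^sup>2) \<le> (1 - 17/25 * q)\<^sup>2"
      using zq zero_le_power2[of "17/25 * q"] unfolding power2_diff one_power2 by linarith
  qed
  then have 1: "sqrt (1 - \<eta> * l * c\<^sup>2 * s * (2 - \<eta> * l * b\<^sup>2)) * u \<le> (1 - 17/25 * q) * u"
    using q1 pos by (intro mult_right_mono) auto
  \<comment> \<open>One factor is controlled by the step size, the other by the smallness condition;
    the latter supplies the \<open>s\<close> that turns a term quadratic in \<open>u\<close> into a
    multiple of \<open>q * u\<close>.\<close>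
  have prod: "(\<eta> * l * b * x) * (\<eta> * l * (x * y * u)) \<le> (51/100 * y) * (\<eta> * l * (s * \<mu> / 250))"
    by (rule mult_mono[OF bx mult_left_mono[OF small]]) (use pos b0 in auto)
  have "b * (l * (\<eta> * b * u))\<^sup>2 / a \<le> b * (l * (\<eta> * b * u))\<^sup>2 / \<mu>"
    using a pos b0 by (intro divide_left_mono) auto
  also have "\<dots> = (51/50)^2 * ((\<eta> * l * b * x) * (\<eta> * l * (x * y * u))) * u / (y^3 * \<mu>)"
    using pos by (simp add: b_def field_simps power2_eq_square power3_eq_cube)
  also have "\<dots> \<le> (51/50)^2 * ((51/100 * y) * (\<eta> * l * (s * \<mu> / 250))) * u / (y^3 * \<mu>)"
    using pos by (intro divide_right_mono mult_right_mono mult_left_mono prod) auto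
  also have "\<dots> = (51/50)^2 * (51/100) / 250 * q * u"
    using pos by (simp add: q_def field_simps power2_eq_square power3_eq_cube)
  also have "\<dots> \<le> 1/100 * q * u" using q0 pos by (intro mult_right_mono) (auto simp: power2_eq_square)
  finally have "b * (l * (\<eta> * b * u))\<^sup>2 / a \<le> 1/100 * q * u" .
  moreover have "0 \<le> q * u" using q0 pos by simp
  ultimately show "sqrt (1 - \<eta> * l * c\<^sup>2 * s * (2 - \<eta> * l * b\<^sup>2)) * u + b * (l * (\<eta> * b * u))\<^sup>2 / a \<le> (1 - q / 2) * u"
    using 1 unfolding left_diff_distrib by linarith
qed

text \<open>The growth factor is at most exp (1/100), hence at most 1.0101. Since the exponent
  multiplies \<open>R\<close>, deep networks tolerate a movement of order 1 / L in each
  layer.\<close>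

lemma power_perturb_le:
  fixes \<mu> R :: real
  assumes "0 < \<mu>" "0 \<le> R" "real k * R \<le> \<mu> / 100"
  shows "(\<mu> + R) ^ k \<le> 51/50 * \<mu> ^ k"
proof -
  have z: "real k * (R / \<mu>) \<le> 1 / 100" using assms by (simp add: field_simps)
  have "(1 + R / \<mu>) ^ k \<le> exp (R / \<mu>) ^ k"
    using assms by (intro power_mono) (auto simp: add_nonneg_nonneg)
  also have "\<dots> = exp (real k * (R / \<mu>))" by (simp add: exp_of_nat_mult[symmetric])
  also have "\<dots> \<le> exp (1/100)" using z by simp
  also have "\<dots> \<le> 1 + 1/100 + (1/100)\<^sup>2" by (rule exp_bound) auto
  also have "\<dots> \<le> (51/50 :: real)" by (simp add: power2_eq_square)
  finally have "\<mu> ^ k * (1 + R / \<mu>) ^ k \<le> \<mu> ^ k * (51/50)" using assms by (intro mult_left_mono) auto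
  moreover have "\<mu> ^ k * (1 + R / \<mu>) ^ k = (\<mu> + R) ^ k"
    using assms by (simp add: power_mult_distrib[symmetric] field_simps)
  ultimately show ?thesis by simp
qed

lemma op_ge_perturb:
  assumes "op_ge A a" "op_le (B - A) e" "A \<in> carrier_mat r c" "B \<in> carrier_mat r c"
  shows "op_ge B (a - e)"
proof -
  have "B = A + (B - A)" using assms by (intro eq_matI) auto
  then show ?thesis using op_ge_add[OF assms(1,2,3)] assms(3) by (simp add: minus_carrier_mat)
qed

text \<open>No probability enters: only isometric partial products and a small residual at the
  start. Decay of the residual and closeness to the start share one induction, since each uses the
  other at the same time.\<close>

theorem gd_linear_convergence:
  fixes \<eta> x s m :: real and d :: "nat \<Rightarrow> nat"
  assumes L: "1 \<le> L" and W0: "chain_dims W0 d L"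
    and X: "X \<in> carrier_mat (d 0) n" and Y: "Y \<in> carrier_mat (d L) n" and Ws: "Ws \<in> carrier_mat (d L) (d 0)"
    and opt: "(Ws * X - Y) * X\<^sup>T = 0\<^sub>m (d L) (d 0)"
    and m: "0 < m" and dL: "0 < d L"
    and op0: "\<And>i. 1 \<le> i \<Longrightarrow> i \<le> L \<Longrightarrow> op_le (W0 i) (sqrt m)"
    and tail0: "\<And>i. 1 \<le> i \<Longrightarrow> i \<le> L \<Longrightarrow> op_ge (tail_chain W0 d L i)\<^sup>T (sqrt m ^ (L - i))"
    and head0: "\<And>i. 1 \<le> i \<Longrightarrow> i \<le> L \<Longrightarrow> op_ge (chain W0 (d 0) (i - 1)) (sqrt m ^ (i - 1))"
    and x: "op_le X x" "0 < x" and s: "0 < s" "s \<le> x\<^sup>2"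
    and low: "\<And>B. B \<in> carrier_mat (d L) (d 0) \<Longrightarrow> sqrt s * fro_norm (B * X) \<le> fro_norm (B * X * X\<^sup>T)"
    and \<eta>: "0 < \<eta>" "\<eta> * real L * x\<^sup>2 \<le> real (d L) / 2"
  defines "\<alpha> \<equiv> 1 / sqrt (m ^ (L - 1) * real (d L))"
  defines "F \<equiv> net_loss \<alpha> X Y L"
  defines "u \<equiv> (\<lambda>t. fro_norm (\<alpha> \<cdot>\<^sub>m chain (gd F \<eta> L W0 t) (d 0) L * X - Ws * X))"
  defines "q \<equiv> \<eta> * real L * s / real (d L)"
  assumes small: "x * sqrt (real (d L)) * u 0 \<le> s * sqrt m / 250"
  shows "u t \<le> (1 - q / 2) ^ t * u 0"
proof -
  define y where "y = sqrt (real (d L))"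
  define \<mu> where "\<mu> = sqrt m"
  define b where "b = 51/50 * x / y"
  \<comment> \<open>\<open>R\<close> solves \<open>R * q / 2 = \<eta> * b * u 0\<close>, so it is
    the total length of all steps under geometric decay. The step size cancels.\<close>
  define R where "R = 2 * b * y\<^sup>2 * u 0 / (real L * s)"
  have y: "0 < y" "y\<^sup>2 = real (d L)" using dL by (auto simp: y_def)
  have \<mu>: "0 < \<mu>" using m by (simp add: \<mu>_def)
  have lpos: "0 < real L" using L by simp
  have u0: "0 \<le> u t" for t by (simp add: u_def)
  have R0: "0 \<le> R" using u0 x y s by (simp add: R_def b_def)
  have sy: "x * y * u 0 \<le> s * \<mu> / 250" using small by (simp add: y_def \<mu>_def)
  \<comment> \<open>The 250 in \<open>small\<close> is used here: 51/25 divided by 250 is 0.00816,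
    which is below 1/100.\<close>
  have LR: "real L * R \<le> \<mu> / 100"
  proof -
    have "real L * R = 51/25 * (x * y * u 0) / s"
      using lpos s(1) y(1) by (simp add: R_def b_def power2_eq_square)
    also have "\<dots> \<le> 51/25 * (s * \<mu> / 250) / s" using sy s by (intro divide_right_mono mult_left_mono) auto
    also have "\<dots> \<le> \<mu> / 100" using s \<mu> by simp
    finally show ?thesis .
  qed
  have pw: "(\<mu> + R) ^ k \<le> 51/50 * \<mu> ^ k" if "k \<le> L" for k
  proof (rule power_perturb_le[OF \<mu> R0])
    have "real k * R \<le> real L * R" using that R0 by (intro mult_right_mono) auto
    then show "real k * R \<le> \<mu> / 100" using LR by simp
  qed
  have \<alpha>\<mu>: "\<alpha> * \<mu> ^ (L - 1) = 1 / y"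
    using m by (simp add: \<alpha>_def \<mu>_def y_def real_sqrt_mult real_sqrt_power)
  have \<alpha>: "0 < \<alpha>" using m dL by (simp add: \<alpha>_def)
  have q_eq: "q = \<eta> * real L * s / y\<^sup>2" by (simp add: q_def y)
  have \<eta>y: "\<eta> * real L * x\<^sup>2 \<le> y\<^sup>2 / 2" using \<eta> y by simp
  note sc0 = gd_step_scalar[OF x(2) y(1) s(1) \<eta>(1) \<mu> _ lpos s(2) \<eta>y]
  have q: "0 \<le> q" "q \<le> 1/2"
    using sc0(1,2)[OF u0 sy order_refl] by (auto simp: q_eq)
  let ?W = "gd F \<eta> L W0"
  \<comment> \<open>The distance bound is the partial geometric sum rather than \<open>R\<close>;
    the next step then adds exactly the missing term.\<close>
  have inv: "chain_dims (?W t) d L \<and> u t \<le> (1 - q / 2) ^ t * u 0 \<and>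
      (\<forall>i. 1 \<le> i \<longrightarrow> i \<le> L \<longrightarrow> fro_norm (?W t i - W0 i) \<le> R * (1 - (1 - q / 2) ^ t))" for t
  proof (induction t)
    case 0
    have "fro_norm (W0 i - W0 i) = 0" if "1 \<le> i" "i \<le> L" for i
      using chain_dimsD[OF W0 that] minus_r_inv_mat[of "W0 i"] by simp
    then show ?case using W0 by simp
  next
    case (Suc t)
    have W: "chain_dims (?W t) d L" and ut: "u t \<le> (1 - q / 2) ^ t * u 0"
      and dist: "\<And>i. 1 \<le> i \<Longrightarrow> i \<le> L \<Longrightarrow> fro_norm (?W t i - W0 i) \<le> R * (1 - (1 - q / 2) ^ t)"
      using Suc by auto
    have pq: "0 \<le> (1 - q / 2) ^ t" "(1 - q / 2) ^ t \<le> 1" using q by (auto intro!: power_le_one)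
    have distR: "op_le (?W t i - W0 i) R" if "1 \<le> i" "i \<le> L" for i
    proof (rule op_le_fro_bound)
      have "R * (1 - (1 - q / 2) ^ t) \<le> R * 1" using R0 pq by (intro mult_left_mono) auto
      then show "fro_norm (?W t i - W0 i) \<le> R" using dist[OF that] by simp
    qed
    have opW: "op_le (?W t i) (\<mu> + R)" if "1 \<le> i" "i \<le> L" for i
      using op_le_of_diff[OF op0[OF that] distR[OF that] chain_dimsD[OF W that] chain_dimsD[OF W0 that]]
      by (simp add: \<mu>_def)
    have ut0: "u t \<le> u 0" using ut mult_right_mono[OF pq(2) u0[of 0]] by simp
    have sut: "x * y * u t \<le> s * \<mu> / 250"
      using order_trans[OF mult_left_mono[OF ut0, of "x * y"] sy] x(2) y(1) by simp
    note sc = sc0[OF u0 sut, of "\<mu> + R", folded b_def q_eq]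
    have tail: "op_ge (tail_chain (?W t) d L i)\<^sup>T (49/50 * \<mu> ^ (L - i))" if i: "1 \<le> i" "i \<le> L" for i
    proof -
      note T0 = tail_chain_carrier[OF W0 i(2)] and T = tail_chain_carrier[OF W i(2)]
      have "op_le (tail_chain (?W t) d L i - tail_chain W0 d L i) ((\<mu> + R) ^ (L - i) - \<mu> ^ (L - i))"
        unfolding tail_chain_def
        using chain_diff_op_le[OF chain_dims_shift[OF W, of i "L - i"] chain_dims_shift[OF W0, of i "L - i"], of \<mu> R]
          op0 distR i by (simp add: \<mu>_def)
      then have "op_le (tail_chain (?W t) d L i - tail_chain W0 d L i)\<^sup>T (1/50 * \<mu> ^ (L - i))"
        using pw[of "L - i"] by (intro op_le_transpose) (erule op_le_mono, simp)
      moreover have "(tail_chain (?W t) d L i - tail_chain W0 d L i)\<^sup>T = (tail_chain (?W t) d L i)\<^sup>T - (tail_chain W0 d L i)\<^sup>T"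
        using T T0 by (intro eq_matI) auto
      ultimately have "op_ge (tail_chain (?W t) d L i)\<^sup>T (\<mu> ^ (L - i) - 1/50 * \<mu> ^ (L - i))"
        using op_ge_perturb[OF tail0[OF i], of "(tail_chain (?W t) d L i)\<^sup>T" "1/50 * \<mu> ^ (L - i)" "d i" "d L"] T T0
        by (simp add: \<mu>_def)
      then show ?thesis by simp
    qed
    have head: "op_ge (chain (?W t) (d 0) (i - 1)) (49/50 * \<mu> ^ (i - 1))" if i: "1 \<le> i" "i \<le> L" for i
    proof -
      have iL: "i - 1 \<le> L" using i by simp
      note C0 = chain_carrier[OF chain_dims_le[OF W0 iL]] and C = chain_carrier[OF chain_dims_le[OF W iL]]
      have "op_le (chain (?W t) (d 0) (i - 1) - chain W0 (d 0) (i - 1)) ((\<mu> + R) ^ (i - 1) - \<mu> ^ (i - 1))"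
        using chain_diff_op_le[OF chain_dims_le[OF W iL] chain_dims_le[OF W0 iL], of \<mu> R] op0 distR i
        by (simp add: \<mu>_def)
      then have "op_le (chain (?W t) (d 0) (i - 1) - chain W0 (d 0) (i - 1)) (1/50 * \<mu> ^ (i - 1))"
        by (rule op_le_mono) (use pw[OF iL] in simp)
      then have "op_ge (chain (?W t) (d 0) (i - 1)) (\<mu> ^ (i - 1) - 1/50 * \<mu> ^ (i - 1))"
        by (rule op_ge_perturb[OF head0[OF i, folded \<mu>_def] _ C0 C])
      then show ?thesis by simp
    qed
    have lc: "0 \<le> 49/50 * \<mu> ^ (L - i) \<and> 0 \<le> 49/50 * \<mu> ^ (i - 1) \<and>
        (49/50)\<^sup>2 / y \<le> \<alpha> * (49/50 * \<mu> ^ (L - i)) * (49/50 * \<mu> ^ (i - 1))" if "1 \<le> i" "i \<le> L" for i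
    proof -
      have "\<mu> ^ (L - i) * \<mu> ^ (i - 1) = \<mu> ^ (L - 1)" using that by (simp add: power_add[symmetric])
      then have e: "\<alpha> * (49/50 * \<mu> ^ (L - i)) * (49/50 * \<mu> ^ (i - 1)) = (49/50)\<^sup>2 * (\<alpha> * \<mu> ^ (L - 1))"
        by (simp add: power2_eq_square mult_ac)
      show ?thesis unfolding e \<alpha>\<mu> using \<mu> by simp
    qed
    have bb: "\<alpha> * (\<mu> + R) ^ (L - 1) * x \<le> b"
    proof -
      have "\<alpha> * (\<mu> + R) ^ (L - 1) * x \<le> \<alpha> * (51/50 * \<mu> ^ (L - 1)) * x"
        using pw[of "L - 1"] \<alpha> x(2) by (intro mult_right_mono mult_left_mono) auto
      also have "\<dots> = 51/50 * (\<alpha> * \<mu> ^ (L - 1)) * x" by simp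
      also have "\<dots> = b" unfolding \<alpha>\<mu> by (simp add: b_def)
      finally show ?thesis .
    qed
    have Vt: "?W (Suc t) i = ?W t i - \<eta> \<cdot>\<^sub>m layer_grad \<alpha> X Y d L (?W t) i" if "1 \<le> i" "i \<le> L" for i
      using that partial_grad_net_loss[OF W that X Y, of \<alpha>] by (simp add: F_def)
    have aR: "\<mu> \<le> \<mu> + R" "0 < \<mu> + R" using R0 \<mu> by auto
    have y0: "0 \<le> (49/50)\<^sup>2 / y" using y by simp
    have ut_eq: "fro_norm (\<alpha> \<cdot>\<^sub>m chain (?W t) (d 0) L * X - Ws * X) = u t" by (simp add: u_def)
    have small': "real L * (\<eta> * b * fro_norm (\<alpha> \<cdot>\<^sub>m chain (?W t) (d 0) L * X - Ws * X)) \<le> \<mu> + R"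
      unfolding ut_eq by (rule sc(4)[OF aR(1)])
    have dims': "chain_dims (?W (Suc t)) d L"
      by (rule gd_step(1)[OF W L X Y Ws opt aR(2) opW x(1) tail head lc y0 \<alpha> less_imp_le[OF s(1)] low bb \<eta>(1)
        sc(3)[OF aR(1)] small' Vt])
    have move: "fro_norm (?W (Suc t) i - ?W t i) \<le> \<eta> * b * u t" if i: "1 \<le> i" "i \<le> L" for i
      unfolding ut_eq[symmetric]
      by (rule gd_step(2)[OF W L X Y Ws opt aR(2) opW x(1) tail head lc y0 \<alpha> less_imp_le[OF s(1)] low bb \<eta>(1)
        sc(3)[OF aR(1)] small' Vt]) (assumption | rule i)+
    have "u (Suc t) \<le> (1 - q / 2) * u t"
    proof -
      have "u (Suc t) = fro_norm (\<alpha> \<cdot>\<^sub>m chain (?W (Suc t)) (d 0) L * X - Ws * X)" by (simp only: u_def)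
      also have "\<dots> \<le> sqrt (1 - \<eta> * real L * ((49/50)\<^sup>2 / y)\<^sup>2 * s * (2 - \<eta> * real L * b\<^sup>2)) * u t
        + b * (real L * (\<eta> * b * u t))\<^sup>2 / (\<mu> + R)" unfolding ut_eq[symmetric]
        by (rule gd_step(3)[OF W L X Y Ws opt aR(2) opW x(1) tail head lc y0 \<alpha> less_imp_le[OF s(1)] low bb \<eta>(1)
        sc(3)[OF aR(1)] small' Vt])
      also have "\<dots> \<le> (1 - q / 2) * u t" by (rule sc(5)[OF aR(1)])
      finally show ?thesis .
    qed
    also have "\<dots> \<le> (1 - q / 2) * ((1 - q / 2) ^ t * u 0)" using ut q by (intro mult_left_mono) auto
    finally have uS: "u (Suc t) \<le> (1 - q / 2) ^ Suc t * u 0" by simp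
    have dS: "fro_norm (?W (Suc t) i - W0 i) \<le> R * (1 - (1 - q / 2) ^ Suc t)" if i: "1 \<le> i" "i \<le> L" for i
    proof -
      have "fro_norm (?W (Suc t) i - W0 i) \<le> fro_norm (?W (Suc t) i - ?W t i) + fro_norm (?W t i - W0 i)"
        by (rule fro_norm_triangle_diff[OF chain_dimsD[OF dims' i] chain_dimsD[OF W i] chain_dimsD[OF W0 i]])
      also have "\<dots> \<le> \<eta> * b * u t + R * (1 - (1 - q / 2) ^ t)"
        using move[OF i] dist[OF i] by (rule add_mono)
      also have "\<eta> * b * u t \<le> \<eta> * b * ((1 - q / 2) ^ t * u 0)"
        using ut \<eta> x y by (intro mult_left_mono) (auto simp: b_def)
      also have "\<eta> * b * ((1 - q / 2) ^ t * u 0) = R * (q / 2) * (1 - q / 2) ^ t"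
        using lpos s(1) y(1) by (simp add: R_def q_eq)
      finally show ?thesis by (simp add: algebra_simps)
    qed
    show ?case using dims' uS dS by blast
  qed
  then show ?thesis by blast
qed

subsection \<open>Exponential moments\<close>

text \<open>The power series compare term by term, because 2^n n! \<le> (2n)!. This is the
  exponential moment of a single random sign.\<close>

lemma cosh_le_exp_half_square: "cosh (x :: real) \<le> exp (x\<^sup>2 / 2)"
proof -
  have fact_ge: "2 ^ n * fact n \<le> (fact (2 * n) :: real)" for n
  proof (induction n)
    case (Suc n)
    have "(2 :: real) ^ Suc n * fact (Suc n) = (2 * real n + 2) * (2 ^ n * fact n)" by (simp add: algebra_simps)
    also have "\<dots> \<le> (2 * real n + 2) * ((2 * real n + 1) * fact (2 * n))"
    proof (rule mult_left_mono)
      have "2 ^ n * fact n \<le> 1 * (fact (2 * n) :: real)" using Suc.IH by simp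
      also have "\<dots> \<le> (2 * real n + 1) * fact (2 * n)" by (intro mult_right_mono) auto
      finally show "2 ^ n * fact n \<le> (2 * real n + 1) * (fact (2 * n) :: real)" .
    qed simp
    also have "\<dots> = fact (2 * Suc n)" by (simp add: algebra_simps)
    finally show ?case .
  qed simp
  have "(\<lambda>n. (\<lambda>n. if even n then x ^ n /\<^sub>R fact n else 0) (2 * n)) sums cosh x"
    by (subst sums_mono_reindex[of "\<lambda>n. 2 * n"]) (auto intro!: cosh_converges strict_monoI elim!: evenE)
  then have 1: "(\<lambda>n. x ^ (2 * n) / fact (2 * n)) sums cosh x" by (simp add: field_simps)
  have 2: "(\<lambda>n. (x\<^sup>2 / 2) ^ n / fact n) sums exp (x\<^sup>2 / 2)"
    using exp_converges[of "x\<^sup>2 / 2"] by (simp add: field_simps)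
  show ?thesis
  proof (rule sums_le[OF _ 1 2])
    fix n
    have "x ^ (2 * n) / fact (2 * n) \<le> x ^ (2 * n) / (2 ^ n * fact n)"
      using fact_ge[of n] by (intro divide_left_mono) auto
    also have "\<dots> = (x\<^sup>2 / 2) ^ n / fact n" by (simp add: power_divide power_mult)
    finally show "x ^ (2 * n) / fact (2 * n) \<le> (x\<^sup>2 / 2) ^ n / fact n" .
  qed
qed

text \<open>Extensional functions keep the set finite, with 2^m members, so that expectations over
  random signs become finite sums.\<close>

definition signs :: "nat \<Rightarrow> (nat \<Rightarrow> real) set" where
  "signs m = PiE {..<m} (\<lambda>_. {-1, 1})"

lemma card_signs: "card (signs m) = 2 ^ m"
  by (simp add: signs_def card_PiE numeral_2_eq_2)

lemma sum_signs_square: "e \<in> signs m \<Longrightarrow> (\<Sum>i<m. (e i)\<^sup>2) = real m"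
proof -
  assume "e \<in> signs m"
  then have "(e i)\<^sup>2 = 1" if "i < m" for i using that by (auto simp: signs_def PiE_def Pi_def power2_eq_1_iff)
  then show ?thesis by simp
qed

lemma rademacher_mgf:
  "(\<Sum>e\<in>signs m. exp (\<Sum>i<m. a i * e i)) \<le> 2 ^ m * exp ((\<Sum>i<m. (a i)\<^sup>2) / 2)"
proof -
  have "(\<Sum>e\<in>signs m. exp (\<Sum>i<m. a i * e i)) = (\<Sum>e\<in>signs m. \<Prod>i<m. exp (a i * e i))"
    by (simp add: exp_sum)
  also have "\<dots> = (\<Prod>i<m. \<Sum>x\<in>{-1, 1}. exp (a i * x))"
    unfolding signs_def by (subst prod_sum_PiE) auto
  also have "\<dots> = (\<Prod>i<m. 2 * cosh (a i))" by (intro prod.cong) (auto simp: cosh_field_def field_simps)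
  also have "\<dots> \<le> (\<Prod>i<m. 2 * exp ((a i)\<^sup>2 / 2))"
    using cosh_le_exp_half_square by (intro prod_mono) (auto simp: cosh_real_nonneg)
  also have "\<dots> = 2 ^ m * exp ((\<Sum>i<m. (a i)\<^sup>2) / 2)"
    by (simp add: prod.distrib exp_sum sum_divide_distrib)
  finally show ?thesis .
qed

text \<open>Completing the square makes the integrand a multiple of a shifted normal
  density.\<close>

lemma normal_mgf:
  assumes "0 < \<sigma>"
  shows "has_bochner_integral lborel (\<lambda>g. normal_density 0 \<sigma> g * exp (c * g)) (exp (c\<^sup>2 * \<sigma>\<^sup>2 / 2))"
proof -
  have "normal_density 0 \<sigma> g * exp (c * g) = exp (c\<^sup>2 * \<sigma>\<^sup>2 / 2) * normal_density (c * \<sigma>\<^sup>2) \<sigma> g" for g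
  proof -
    have "- g\<^sup>2 / (2 * \<sigma>\<^sup>2) + c * g = c\<^sup>2 * \<sigma>\<^sup>2 / 2 + - (g - c * \<sigma>\<^sup>2)\<^sup>2 / (2 * \<sigma>\<^sup>2)"
      using assms by (simp add: field_simps power2_eq_square)
    then have "exp (- g\<^sup>2 / (2 * \<sigma>\<^sup>2)) * exp (c * g) = exp (c\<^sup>2 * \<sigma>\<^sup>2 / 2) * exp (- (g - c * \<sigma>\<^sup>2)\<^sup>2 / (2 * \<sigma>\<^sup>2))"
      by (simp only: exp_add[symmetric])
    then show ?thesis by (simp add: normal_density_def)
  qed
  moreover have "has_bochner_integral lborel (\<lambda>g. exp (c\<^sup>2 * \<sigma>\<^sup>2 / 2) * normal_density (c * \<sigma>\<^sup>2) \<sigma> g) (exp (c\<^sup>2 * \<sigma>\<^sup>2 / 2) * 1)"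
    using assms by (intro has_bochner_integral_mult_right) (auto simp: has_bochner_integral_iff)
  ultimately show ?thesis by simp
qed

text \<open>Each square is linearised by a Gaussian: \<open>exp (t\<^sup>2 / 4)\<close> is the mean of \<open>exp (g t / sqrt 2)\<close>
  over a standard normal \<open>g\<close>, which only shifts the linear coefficient \<open>a\<close>.\<close>
lemma rademacher_chaos_mgf:
  fixes v :: "nat \<Rightarrow> nat \<Rightarrow> real"
  assumes "\<And>j l. j < k \<Longrightarrow> l < k \<Longrightarrow> (\<Sum>i<m. v j i * v l i) = (if j = l then 1 else 0)"
  shows "(\<Sum>e\<in>signs m. exp ((\<Sum>j<k. (\<Sum>i<m. v j i * e i)\<^sup>2) / 4 + (\<Sum>i<m. a i * e i)))
    \<le> 2 ^ m * sqrt 2 ^ k * exp (((\<Sum>i<m. (a i)\<^sup>2) + (\<Sum>j<k. (\<Sum>i<m. v j i * a i)\<^sup>2)) / 2)"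
  using assms
proof (induction k arbitrary: a)
  case 0
  then show ?case using rademacher_mgf[where a = a and m = m] by simp
next
  case (Suc k)
  define w where "w = v k"
  define \<rho> where "\<rho> = sqrt (2 :: real)"
  have \<rho>: "0 < \<rho>" "\<rho>\<^sup>2 = 2" by (auto simp: \<rho>_def)
  define E where "E = (\<lambda>a e. exp ((\<Sum>j<k. (\<Sum>i<m. v j i * e i)\<^sup>2) / 4 + (\<Sum>i<m. a i * e i)))"
  define x where "x = (\<lambda>e. \<Sum>i<m. w i * e i)"
  have wv: "(\<Sum>i<m. v j i * w i) = 0" if "j < k" for j
    using Suc.prems[of j k] that by (simp add: w_def)
  have ww: "(\<Sum>i<m. w i * w i) = 1" using Suc.prems[of k k] by (simp add: w_def)
  have shift: "E (\<lambda>i. a i + g / \<rho> * w i) e = E a e * exp (x e / \<rho> * g)" for g e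
    by (simp add: E_def x_def exp_add[symmetric] algebra_simps sum.distrib sum_distrib_left sum_divide_distrib)
  have lhs: "has_bochner_integral lborel (\<lambda>g. normal_density 0 1 g * (\<Sum>e\<in>signs m. E (\<lambda>i. a i + g / \<rho> * w i) e))
     (\<Sum>e\<in>signs m. E a e * exp ((x e)\<^sup>2 / 4))"
  proof -
    have "has_bochner_integral lborel (\<lambda>g. \<Sum>e\<in>signs m. E a e * (normal_density 0 1 g * exp (x e / \<rho> * g)))
      (\<Sum>e\<in>signs m. E a e * exp ((x e / \<rho>)\<^sup>2 * 1\<^sup>2 / 2))"
      by (intro has_bochner_integral_sum has_bochner_integral_mult_right normal_mgf) simp
    then show ?thesis unfolding shift sum_distrib_left by (simp add: mult_ac power_divide \<rho>)
  qed
  define K where "K = 2 ^ m * sqrt 2 ^ k * exp (((\<Sum>i<m. (a i)\<^sup>2) + (\<Sum>j<k. (\<Sum>i<m. v j i * a i)\<^sup>2)) / 2)"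
  have IH: "(\<Sum>e\<in>signs m. E (\<lambda>i. a i + g / \<rho> * w i) e) \<le> K * exp (x a / \<rho> * g + g\<^sup>2 / 4)" for g
  proof -
    have "(\<Sum>e\<in>signs m. E (\<lambda>i. a i + g / \<rho> * w i) e) \<le> 2 ^ m * sqrt 2 ^ k *
      exp (((\<Sum>i<m. (a i + g / \<rho> * w i)\<^sup>2) + (\<Sum>j<k. (\<Sum>i<m. v j i * (a i + g / \<rho> * w i))\<^sup>2)) / 2)"
      unfolding E_def using Suc.prems by (intro Suc.IH) simp
    \<comment> \<open>The direction \<open>w\<close> is orthogonal to the remaining rows, so the
      shift of \<open>a\<close> along it leaves their squares unchanged.\<close>
    also have "(\<Sum>j<k. (\<Sum>i<m. v j i * (a i + g / \<rho> * w i))\<^sup>2) = (\<Sum>j<k. (\<Sum>i<m. v j i * a i)\<^sup>2)"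
    proof (rule sum.cong[OF refl])
      fix j assume "j \<in> {..<k}"
      then have "(\<Sum>i<m. v j i * w i) = 0" using wv by simp
      moreover have "(\<Sum>i<m. v j i * (g / \<rho> * w i)) = g / \<rho> * (\<Sum>i<m. v j i * w i)"
        unfolding sum_distrib_left by (intro sum.cong) auto
      ultimately have "(\<Sum>i<m. v j i * (g / \<rho> * w i)) = 0" by simp
      then show "(\<Sum>i<m. v j i * (a i + g / \<rho> * w i))\<^sup>2 = (\<Sum>i<m. v j i * a i)\<^sup>2"
        by (simp add: distrib_left sum.distrib)
    qed
    also have "(\<Sum>i<m. (a i + g / \<rho> * w i)\<^sup>2) = (\<Sum>i<m. (a i)\<^sup>2 + 2 * g / \<rho> * (w i * a i) + g\<^sup>2 / 2 * (w i * w i))"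
      using \<rho> by (intro sum.cong) (auto simp: power2_sum power_mult_distrib power_divide power2_eq_square[of "w _"])
    also have "\<dots> = (\<Sum>i<m. (a i)\<^sup>2) + 2 * g / \<rho> * x a + g\<^sup>2 / 2"
      unfolding sum.distrib sum_distrib_left[symmetric] ww x_def by simp
    also have "((\<Sum>i<m. (a i)\<^sup>2) + 2 * g / \<rho> * x a + g\<^sup>2 / 2 + (\<Sum>j<k. (\<Sum>i<m. v j i * a i)\<^sup>2)) / 2
      = ((\<Sum>i<m. (a i)\<^sup>2) + (\<Sum>j<k. (\<Sum>i<m. v j i * a i)\<^sup>2)) / 2 + (x a / \<rho> * g + g\<^sup>2 / 4)"
      by (simp add: field_simps)
    finally show ?thesis by (simp add: K_def exp_add mult.assoc)
  qed
  \<comment> \<open>The shift has squared length g^2 / 2 and costs exp (g^2 / 4), half of the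
    Gaussian decay. What remains is a normal density of variance 2 and a factor sqrt 2 per row. With
    exponent t^2 / 2 in place of t^2 / 4 all decay would be used up.\<close>
  have dens: "normal_density 0 1 g * exp (g\<^sup>2 / 4) = \<rho> * normal_density 0 \<rho> g" for g
  proof -
    have "exp (- g\<^sup>2 / 2) * exp (g\<^sup>2 / 4) = exp (- g\<^sup>2 / 4)" by (simp add: exp_add[symmetric])
    moreover have "1 / \<rho> = \<rho> / 2" using \<rho> by (simp add: field_simps power2_eq_square)
    ultimately show ?thesis using \<rho>
      by (simp add: normal_density_def real_sqrt_mult \<rho>_def[symmetric] field_simps power2_eq_square)
  qed
  have rhs: "has_bochner_integral lborel (\<lambda>g. normal_density 0 1 g * (K * exp (x a / \<rho> * g + g\<^sup>2 / 4)))
     (K * (\<rho> * exp ((x a)\<^sup>2 / 2)))"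
  proof -
    have hb: "has_bochner_integral lborel (\<lambda>g. K * (\<rho> * (normal_density 0 \<rho> g * exp (x a / \<rho> * g))))
      (K * (\<rho> * exp ((x a / \<rho>)\<^sup>2 * \<rho>\<^sup>2 / 2)))"
      using \<rho> by (intro has_bochner_integral_mult_right normal_mgf)
    have eq: "K * (\<rho> * (normal_density 0 \<rho> g * exp (x a / \<rho> * g)))
       = normal_density 0 1 g * (K * exp (x a / \<rho> * g + g\<^sup>2 / 4))" for g
      unfolding exp_add using arg_cong[OF dens[of g, symmetric], of "\<lambda>y. K * exp (x a / \<rho> * g) * y"] by (simp add: mult_ac)
    have val: "(x a / \<rho>)\<^sup>2 * \<rho>\<^sup>2 / 2 = (x a)\<^sup>2 / 2" using \<rho> by (simp add: power_divide)
    show ?thesis using hb unfolding eq val .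
  qed
  have "(\<Sum>e\<in>signs m. exp ((\<Sum>j<Suc k. (\<Sum>i<m. v j i * e i)\<^sup>2) / 4 + (\<Sum>i<m. a i * e i)))
     = (\<Sum>e\<in>signs m. E a e * exp ((x e)\<^sup>2 / 4))"
    by (simp add: E_def x_def w_def exp_add[symmetric] add_divide_distrib add_ac)
  also have "\<dots> \<le> K * (\<rho> * exp ((x a)\<^sup>2 / 2))"
    unfolding has_bochner_integral_integral_eq[OF lhs, symmetric] has_bochner_integral_integral_eq[OF rhs, symmetric]
    using lhs rhs by (intro integral_mono mult_left_mono IH) (auto simp: has_bochner_integral_iff)
  also have "\<dots> = 2 ^ m * sqrt 2 ^ Suc k * exp (((\<Sum>i<m. (a i)\<^sup>2) + (\<Sum>j<Suc k. (\<Sum>i<m. v j i * a i)\<^sup>2)) / 2)"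
    by (simp add: K_def \<rho>_def x_def w_def exp_add[symmetric] add_divide_distrib mult_ac)
  finally show ?case .
qed

subsection \<open>Measurability of matrix-valued maps\<close>

text \<open>The matrix type does not fix dimensions, so the carrier condition belongs to the notion.
  Working with entries makes closure under matrix operations a matter of finite sums and products;
  \<open>mat_meas_measurable\<close> leads back to \<open>mat_borel\<close>.\<close>

definition mat_meas :: "'a measure \<Rightarrow> nat \<Rightarrow> nat \<Rightarrow> ('a \<Rightarrow> real mat) \<Rightarrow> bool" where
  "mat_meas N r c f \<longleftrightarrow> (\<forall>w\<in>space N. f w \<in> carrier_mat r c) \<and>
     (\<forall>i<r. \<forall>j<c. (\<lambda>w. f w $$ (i, j)) \<in> borel_measurable N)"

lemma mat_meas_carrier: "mat_meas N r c f \<Longrightarrow> w \<in> space N \<Longrightarrow> f w \<in> carrier_mat r c"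
  by (simp add: mat_meas_def)

lemma mat_meas_entry: "mat_meas N r c f \<Longrightarrow> i < r \<Longrightarrow> j < c \<Longrightarrow> (\<lambda>w. f w $$ (i, j)) \<in> borel_measurable N"
  by (simp add: mat_meas_def)

lemma mat_meas_cong:
  assumes "\<And>w. w \<in> space N \<Longrightarrow> f w = g w" "mat_meas N r c g"
  shows "mat_meas N r c f"
proof -
  have "(\<lambda>w. f w $$ (i, j)) \<in> borel_measurable N \<longleftrightarrow> (\<lambda>w. g w $$ (i, j)) \<in> borel_measurable N" for i j
    using assms(1) by (intro measurable_cong) simp
  then show ?thesis using assms by (simp add: mat_meas_def)
qed

lemma mat_meas_const: "A \<in> carrier_mat r c \<Longrightarrow> mat_meas N r c (\<lambda>_. A)"
  by (simp add: mat_meas_def)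

lemma mat_meas_mult:
  assumes f: "mat_meas N r k f" and g: "mat_meas N k c g"
  shows "mat_meas N r c (\<lambda>w. f w * g w)"
  unfolding mat_meas_def
proof (intro conjI ballI allI impI)
  show "f w * g w \<in> carrier_mat r c" if "w \<in> space N" for w
    using mat_meas_carrier[OF f that] mat_meas_carrier[OF g that] by simp
  fix i j assume ij: "i < r" "j < c"
  have "(\<lambda>w. (f w * g w) $$ (i, j)) \<in> borel_measurable N
    \<longleftrightarrow> (\<lambda>w. \<Sum>l<k. f w $$ (i, l) * g w $$ (l, j)) \<in> borel_measurable N"
    by (intro measurable_cong mat_mult_entry[OF mat_meas_carrier[OF f] mat_meas_carrier[OF g] ij])
  also have "\<dots>" using mat_meas_entry[OF f ij(1)] mat_meas_entry[OF g _ ij(2)]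
    by (intro borel_measurable_sum borel_measurable_times) auto
  finally show "(\<lambda>w. (f w * g w) $$ (i, j)) \<in> borel_measurable N" .
qed

lemma mat_meas_entrywise:
  assumes "\<And>w. w \<in> space N \<Longrightarrow> h w \<in> carrier_mat r c"
    and "\<And>w i j. w \<in> space N \<Longrightarrow> i < r \<Longrightarrow> j < c \<Longrightarrow> h w $$ (i, j) = H i j w"
    and "\<And>i j. i < r \<Longrightarrow> j < c \<Longrightarrow> H i j \<in> borel_measurable N"
  shows "mat_meas N r c h"
  unfolding mat_meas_def
proof (intro conjI ballI allI impI)
  fix i j assume ij: "i < r" "j < c"
  have "(\<lambda>w. h w $$ (i, j)) \<in> borel_measurable N \<longleftrightarrow> H i j \<in> borel_measurable N"
    using assms(2) ij by (intro measurable_cong) auto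
  then show "(\<lambda>w. h w $$ (i, j)) \<in> borel_measurable N" using assms(3)[OF ij] by simp
qed (use assms in auto)

lemma mat_meas_transpose:
  assumes f: "mat_meas N r c f"
  shows "mat_meas N c r (\<lambda>w. (f w)\<^sup>T)"
  by (rule mat_meas_entrywise[where H = "\<lambda>i j w. f w $$ (j, i)"])
    (use mat_meas_carrier[OF f] carrier_matD[OF mat_meas_carrier[OF f]] mat_meas_entry[OF f] in auto)

lemma mat_meas_smult:
  assumes f: "mat_meas N r c f"
  shows "mat_meas N r c (\<lambda>w. a \<cdot>\<^sub>m f w)"
  by (rule mat_meas_entrywise[where H = "\<lambda>i j w. a * f w $$ (i, j)"])
    (use mat_meas_carrier[OF f] carrier_matD[OF mat_meas_carrier[OF f]] mat_meas_entry[OF f] in auto)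

lemma mat_meas_minus:
  assumes f: "mat_meas N r c f" and g: "mat_meas N r c g"
  shows "mat_meas N r c (\<lambda>w. f w - g w)"
  by (rule mat_meas_entrywise[where H = "\<lambda>i j w. f w $$ (i, j) - g w $$ (i, j)"])
    (use mat_meas_carrier[OF f] mat_meas_entry[OF f] mat_meas_carrier[OF g] mat_meas_entry[OF g]
      carrier_matD[OF mat_meas_carrier[OF f]] carrier_matD[OF mat_meas_carrier[OF g]]
      in \<open>auto intro: minus_carrier_mat\<close>)

lemma mat_meas_chain:
  assumes "\<And>i. 1 \<le> i \<Longrightarrow> i \<le> K \<Longrightarrow> mat_meas N (d i) (d (i - 1)) (\<lambda>w. V w i)"
  shows "mat_meas N (d K) (d 0) (\<lambda>w. chain (V w) (d 0) K)"
  using assms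
proof (induction K)
  case (Suc K)
  show ?case
    using mat_meas_mult[of N "d (Suc K)" "d K" "\<lambda>w. V w (Suc K)" "d 0" "\<lambda>w. chain (V w) (d 0) K"]
      Suc.IH Suc.prems Suc.prems[of "Suc K"] by simp
qed (simp add: mat_meas_const)

lemma mat_meas_tail_chain:
  assumes "\<And>i. 1 \<le> i \<Longrightarrow> i \<le> L \<Longrightarrow> mat_meas N (d i) (d (i - 1)) (\<lambda>w. V w i)" "k \<le> L"
  shows "mat_meas N (d L) (d k) (\<lambda>w. tail_chain (V w) d L k)"
proof -
  have "mat_meas N (d (k + (L - k))) (d (k + 0)) (\<lambda>w. chain (\<lambda>j. V w (k + j)) (d (k + 0)) (L - k))"
    by (rule mat_meas_chain[where d = "\<lambda>j. d (k + j)"])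
      (use assms(1)[of "k + _"] assms(2) in auto)
  then show ?thesis using assms(2) by (simp add: tail_chain_def)
qed

lemma mat_meas_fro_norm:
  assumes f: "mat_meas N r c f"
  shows "(\<lambda>w. fro_norm (f w)) \<in> borel_measurable N"
proof -
  have "(\<lambda>w. fro_norm (f w)) \<in> borel_measurable N
    \<longleftrightarrow> (\<lambda>w. sqrt (\<Sum>i<r. \<Sum>j<c. (f w $$ (i, j))\<^sup>2)) \<in> borel_measurable N"
    using mat_meas_carrier[OF f] by (intro measurable_cong) (auto simp: fro_norm_def)
  also have "\<dots>" using mat_meas_entry[OF f]
    by (intro measurable_compose[OF _ borel_measurable_sqrt] borel_measurable_sum borel_measurable_power) auto
  finally show ?thesis .
qed

lemma space_mat_borel: "space (mat_borel r c) = carrier_mat r c"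
  by (simp add: mat_borel_def)

lemma mat_meas_id_mat_borel:
  assumes "sets \<mu> = sets (mat_borel r c)"
  shows "mat_meas \<mu> r c (\<lambda>A. A)"
  unfolding mat_meas_def
proof (intro conjI ballI allI impI)
  show "A \<in> carrier_mat r c" if "A \<in> space \<mu>" for A
    using that sets_eq_imp_space_eq[OF assms] by (simp add: space_mat_borel)
  fix i j assume ij: "i < r" "j < c"
  have "mat_entries r c \<in> borel_measurable (mat_borel r c)"
    unfolding mat_borel_def by (rule measurable_vimage_algebra1) auto
  then have "(\<lambda>A. mat_entries r c A (i, j)) \<in> borel_measurable (mat_borel r c)"
    by (rule measurable_compose[OF _ measurable_product_coordinates])
  then have "(\<lambda>A. A $$ (i, j)) \<in> borel_measurable (mat_borel r c)"
    using ij by (simp add: mat_entries_def)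
  then show "(\<lambda>A. A $$ (i, j)) \<in> borel_measurable \<mu>"
    using measurable_cong_sets[OF assms refl] by blast
qed

lemma mat_meas_measurable:
  assumes f: "mat_meas N r c f" and \<mu>: "sets \<mu> = sets (mat_borel r c)"
  shows "f \<in> measurable N \<mu>"
proof -
  have "f \<in> measurable N (mat_borel r c)"
    unfolding mat_borel_def
  proof (rule measurable_vimage_algebra2)
    show "f \<in> space N \<rightarrow> carrier_mat r c" using mat_meas_carrier[OF f] by auto
    show "(\<lambda>w. mat_entries r c (f w)) \<in> borel_measurable N"
    proof (rule measurable_coordinatewise_then_product)
      fix p :: "nat \<times> nat"
      show "(\<lambda>w. mat_entries r c (f w) p) \<in> borel_measurable N"
        using mat_meas_entry[OF f, of "fst p" "snd p"]
        by (cases "fst p < r \<and> snd p < c") (auto simp: mat_entries_def case_prod_unfold)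
    qed
  qed
  then show ?thesis using measurable_cong_sets[OF refl \<mu>] by blast
qed

lemma mat_meas_PiM_component:
  assumes "i \<in> I" "sets (\<mu> i) = sets (mat_borel r c)"
  shows "mat_meas (PiM I \<mu>) r c (\<lambda>W. W i)"
proof -
  note id = mat_meas_id_mat_borel[OF assms(2)]
  have proj: "(\<lambda>W. W i) \<in> measurable (PiM I \<mu>) (\<mu> i)" using assms(1) by simp
  show ?thesis
    unfolding mat_meas_def
    using mat_meas_carrier[OF id] measurable_space[OF proj] measurable_compose[OF proj mat_meas_entry[OF id]] by auto
qed

subsection \<open>Concentration of the last layer\<close>

text \<open>The definition states invariance for events. Read as equality of the measure with its
  image under right multiplication, it extends to integrals.\<close>

lemma uniform_rows_invariant:
  assumes \<mu>: "uniform_rows k m s \<mu>" and Q: "orthogonal_mat m Q" and f: "f \<in> borel_measurable \<mu>"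
  shows "(\<integral>\<^sup>+A. f (A * Q) \<partial>\<mu>) = (\<integral>\<^sup>+A. f A \<partial>\<mu>)"
proof -
  interpret prob_space \<mu> using \<mu> by (simp add: uniform_rows_def)
  have sets: "sets \<mu> = sets (mat_borel k m)" using \<mu> by (simp add: uniform_rows_def)
  have Qc: "Q \<in> carrier_mat m m" using Q by (simp add: orthogonal_mat_def)
  have meas: "(\<lambda>A. A * Q) \<in> measurable \<mu> \<mu>"
    by (rule mat_meas_measurable[OF mat_meas_mult[OF mat_meas_id_mat_borel[OF sets] mat_meas_const[OF Qc]] sets])
  have "distr \<mu> \<mu> (\<lambda>A. A * Q) = \<mu>"
  proof (rule measure_eqI)
    fix B assume "B \<in> sets (distr \<mu> \<mu> (\<lambda>A. A * Q))"
    then have B: "B \<in> sets \<mu>" by simp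
    have "emeasure (distr \<mu> \<mu> (\<lambda>A. A * Q)) B = emeasure \<mu> ((\<lambda>A. A * Q) -` B \<inter> space \<mu>)"
      by (rule emeasure_distr[OF meas B])
    also have "(\<lambda>A. A * Q) -` B \<inter> space \<mu> = {A \<in> space \<mu>. A * Q \<in> B}" by auto
    also have "emeasure \<mu> \<dots> = emeasure \<mu> B"
      using \<mu> Q B by (simp add: uniform_rows_def emeasure_eq_measure)
    finally show "emeasure (distr \<mu> \<mu> (\<lambda>A. A * Q)) B = emeasure \<mu> B" .
  qed simp
  then have "(\<integral>\<^sup>+A. f A \<partial>\<mu>) = (\<integral>\<^sup>+A. f A \<partial>distr \<mu> \<mu> (\<lambda>A. A * Q))" by simp
  also have "\<dots> = (\<integral>\<^sup>+A. f (A * Q) \<partial>\<mu>)" by (rule nn_integral_distr[OF meas]) (simp add: f)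
  finally show ?thesis by simp
qed

text \<open>By invariance the unit vector \<open>z\<close> may be replaced by the random vector \<open>e / sqrt m\<close> with
  independent random signs \<open>e\<close>, for which the mean is bounded for every fixed matrix.\<close>
lemma uniform_rows_exp_vec:
  assumes \<mu>: "uniform_rows k m (real m) \<mu>" and m: "0 < m" and z: "(\<Sum>i<m. (z i)\<^sup>2) = 1"
  shows "(\<integral>\<^sup>+A. ennreal (exp ((\<Sum>j<k. (\<Sum>i<m. A $$ (j, i) * z i)\<^sup>2) / 4)) \<partial>\<mu>) \<le> ennreal (sqrt 2 ^ k)"
proof -
  interpret prob_space \<mu> using \<mu> by (simp add: uniform_rows_def)
  have sets: "sets \<mu> = sets (mat_borel k m)" using \<mu> by (simp add: uniform_rows_def)
  note id = mat_meas_id_mat_borel[OF sets]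
  define f where "f = (\<lambda>y A. ennreal (exp ((\<Sum>j<k. (\<Sum>i<m. A $$ (j, i) * y i)\<^sup>2) / 4)))"
  define e' where "e' = (\<lambda>e (i :: nat). e i / sqrt (real m))"
  have f_meas: "f y \<in> borel_measurable \<mu>" for y
  proof -
    have "(\<lambda>A. exp ((\<Sum>j<k. (\<Sum>i<m. A $$ (j, i) * y i)\<^sup>2) / 4)) \<in> borel_measurable \<mu>"
      using mat_meas_entry[OF id]
      by (intro measurable_compose[OF _ borel_measurable_exp] borel_measurable_divide borel_measurable_sum borel_measurable_power borel_measurable_times) auto
    then show ?thesis by (simp add: f_def)
  qed
  \<comment> \<open>\<open>z\<close> and \<open>e' e\<close> are unit vectors, so a reflection
    \<open>Q\<close> carries one to the other, and (A Q) z = A (Q z). Hence all 2^m integrals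
    coincide.\<close>
  have rot: "(\<integral>\<^sup>+A. f (e' e) A \<partial>\<mu>) = (\<integral>\<^sup>+A. f z A \<partial>\<mu>)" if e: "e \<in> signs m" for e
  proof -
    have "(\<Sum>i<m. (e' e i)\<^sup>2) = 1"
      using sum_signs_square[OF e] m by (simp add: e'_def power_divide sum_divide_distrib[symmetric])
    then have "(\<Sum>i<m. (z i)\<^sup>2) = (\<Sum>i<m. (e' e i)\<^sup>2)" using z by simp
    then obtain Q where Q: "orthogonal_mat m Q" and Qz: "\<And>i. i < m \<Longrightarrow> (\<Sum>j<m. Q $$ (i, j) * z j) = e' e i"
      by (rule orthogonal_mat_transitive) blast
    have Qc: "Q \<in> carrier_mat m m" using Q by (simp add: orthogonal_mat_def)
    have "f z (A * Q) = f (e' e) A" if A: "A \<in> space \<mu>" for A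
    proof -
      have Ac: "A \<in> carrier_mat k m" by (rule mat_meas_carrier[OF id A])
      have "(\<Sum>i<m. (A * Q) $$ (j, i) * z i) = (\<Sum>i<m. A $$ (j, i) * e' e i)" if j: "j < k" for j
      proof -
        have "(\<Sum>i<m. (A * Q) $$ (j, i) * z i) = (\<Sum>i<m. \<Sum>l<m. A $$ (j, l) * (Q $$ (l, i) * z i))"
          using j by (intro sum.cong) (auto simp: mat_mult_entry[OF Ac Qc] sum_distrib_right mult.assoc simp del: index_mult_mat(1))
        also have "\<dots> = (\<Sum>l<m. A $$ (j, l) * (\<Sum>i<m. Q $$ (l, i) * z i))"
          by (subst sum.swap) (simp add: sum_distrib_left)
        finally show ?thesis using Qz by simp
      qed
      then show ?thesis by (simp add: f_def)
    qed
    then have "(\<integral>\<^sup>+A. f (e' e) A \<partial>\<mu>) = (\<integral>\<^sup>+A. f z (A * Q) \<partial>\<mu>)" by (intro nn_integral_cong) simp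
    also have "\<dots> = (\<integral>\<^sup>+A. f z A \<partial>\<mu>)" by (rule uniform_rows_invariant[OF \<mu> Q f_meas])
    finally show ?thesis .
  qed
  \<comment> \<open>For almost every \<open>A\<close> the rows divided by sqrt m are orthonormal,
    which is what the moment bound for signs asks of a fixed matrix.\<close>
  have avg: "AE A in \<mu>. (\<Sum>e\<in>signs m. f (e' e) A) \<le> ennreal (2 ^ m * sqrt 2 ^ k)"
  proof -
    have "AE A in \<mu>. A * A\<^sup>T = real m \<cdot>\<^sub>m 1\<^sub>m k" using \<mu> by (simp add: uniform_rows_def)
    then show ?thesis
    proof (rule AE_mp, intro AE_I2 impI)
      fix A assume A: "A \<in> space \<mu>" and AA: "A * A\<^sup>T = real m \<cdot>\<^sub>m 1\<^sub>m k"
      have Ac: "A \<in> carrier_mat k m" by (rule mat_meas_carrier[OF id A])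
      define v where "v = (\<lambda>j i. A $$ (j, i) / sqrt (real m))"
      have orth: "(\<Sum>i<m. v j i * v l i) = (if j = l then 1 else 0)" if jl: "j < k" "l < k" for j l
      proof -
        have "(\<Sum>i<m. A $$ (j, i) * A $$ (l, i)) = (A * A\<^sup>T) $$ (j, l)"
          using Ac jl by (subst mat_mult_entry[OF Ac, of _ k]) auto
        also have "\<dots> = (if j = l then real m else 0)" unfolding AA using jl by simp
        finally show ?thesis using m by (simp add: v_def sum_divide_distrib[symmetric])
      qed
      have "(\<Sum>e\<in>signs m. f (e' e) A)
        = ennreal (\<Sum>e\<in>signs m. exp ((\<Sum>j<k. (\<Sum>i<m. v j i * e i)\<^sup>2) / 4 + (\<Sum>i<m. 0 * e i)))"
        by (simp add: f_def e'_def v_def)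
      also have "\<dots> \<le> ennreal (2 ^ m * sqrt 2 ^ k)"
        using rademacher_chaos_mgf[OF orth, where a = "\<lambda>_. 0"] by (intro ennreal_leI) simp
      finally show "(\<Sum>e\<in>signs m. f (e' e) A) \<le> ennreal (2 ^ m * sqrt 2 ^ k)" .
    qed
  qed
  have "ennreal (2 ^ m) * (\<integral>\<^sup>+A. f z A \<partial>\<mu>) = (\<Sum>e\<in>signs m. \<integral>\<^sup>+A. f (e' e) A \<partial>\<mu>)"
    by (simp add: rot card_signs ennreal_of_nat_eq_real_of_nat ennreal_power[symmetric] ennreal_numeral)
  also have "\<dots> = (\<integral>\<^sup>+A. (\<Sum>e\<in>signs m. f (e' e) A) \<partial>\<mu>)"
    by (rule nn_integral_sum[symmetric]) (rule f_meas)
  also have "\<dots> \<le> (\<integral>\<^sup>+A. ennreal (2 ^ m * sqrt 2 ^ k) \<partial>\<mu>)" by (rule nn_integral_mono_AE[OF avg])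
  also have "\<dots> = ennreal (2 ^ m) * ennreal (sqrt 2 ^ k)" by (simp add: emeasure_space_1 ennreal_mult)
  finally have "ennreal (2 ^ m) * (\<integral>\<^sup>+A. f z A \<partial>\<mu>) \<le> ennreal (2 ^ m) * ennreal (sqrt 2 ^ k)" .
  then have "(\<integral>\<^sup>+A. f z A \<partial>\<mu>) \<le> ennreal (sqrt 2 ^ k)"
    by (subst (asm) ennreal_mult_le_mult_iff) auto
  then show ?thesis by (simp add: f_def)
qed

text \<open>Jensen's inequality over the columns replaces a union bound.\<close>
lemma uniform_rows_exp_mat:
  assumes \<mu>: "uniform_rows k m (real m) \<mu>" and m: "0 < m" and M: "M \<in> carrier_mat m n"
  shows "(\<integral>\<^sup>+A. ennreal (exp ((fro_norm (A * M))\<^sup>2 / (fro_norm M)\<^sup>2 / 4)) \<partial>\<mu>) \<le> ennreal (sqrt 2 ^ k)"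
proof (cases "fro_norm M = 0")
  case True
  interpret prob_space \<mu> using \<mu> by (simp add: uniform_rows_def)
  \<comment> \<open>Division by zero makes the exponent 0, so the integrand is 1.\<close>
  show ?thesis using True by (simp add: emeasure_space_1 one_le_power)
next
  case False
  interpret prob_space \<mu> using \<mu> by (simp add: uniform_rows_def)
  have sets: "sets \<mu> = sets (mat_borel k m)" using \<mu> by (simp add: uniform_rows_def)
  note id = mat_meas_id_mat_borel[OF sets]
  define c where "c = (\<lambda>j. \<Sum>i<m. (M $$ (i, j))\<^sup>2)"
  \<comment> \<open>A zero column has no direction \<open>z j\<close>, but its weight is zero too;
    restricting to \<open>J\<close> keeps the weights summing to 1 and makes every
    \<open>z j\<close> a unit vector.\<close>
  define J where "J = {j. j < n \<and> c j \<noteq> 0}"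
  define p where "p = (\<lambda>j. c j / (fro_norm M)\<^sup>2)"
  define z where "z = (\<lambda>j i. M $$ (i, j) / sqrt (c j))"
  define g where "g = (\<lambda>j A. exp ((\<Sum>l<k. (\<Sum>i<m. A $$ (l, i) * z j i)\<^sup>2) / 4))"
  have finJ: "finite J" by (simp add: J_def)
  have c0: "0 \<le> c j" for j by (auto simp: c_def intro: sum_nonneg)
  have cM: "(fro_norm M)\<^sup>2 = (\<Sum>j<n. c j)"
    unfolding fro_norm_square_sum[OF M] c_def by (rule sum.swap)
  have cJ: "(\<Sum>j<n. c j * h j) = (\<Sum>j\<in>J. c j * h j)" for h :: "nat \<Rightarrow> real"
    by (rule sum.mono_neutral_right) (auto simp: J_def)
  have "(\<Sum>j\<in>J. c j) = (fro_norm M)\<^sup>2" unfolding cM using cJ[of "\<lambda>_. 1"] by simp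
  then have psum: "(\<Sum>j\<in>J. p j) = 1" using False by (simp add: p_def sum_divide_distrib[symmetric])
  then have J0: "J \<noteq> {}" by auto
  have p0: "0 \<le> p j" for j using c0 by (simp add: p_def)
  have zero: "M $$ (i, j) = 0" if "c j = 0" "i < m" for i j
    using that by (simp add: c_def sum_nonneg_eq_0_iff)
  have conv: "exp ((fro_norm (A * M))\<^sup>2 / (fro_norm M)\<^sup>2 / 4) \<le> (\<Sum>j\<in>J. p j * g j A)" if A: "A \<in> space \<mu>" for A
  proof -
    have Ac: "A \<in> carrier_mat k m" by (rule mat_meas_carrier[OF id A])
    define y where "y = (\<lambda>j. \<Sum>l<k. (\<Sum>i<m. A $$ (l, i) * z j i)\<^sup>2)"
    have AMc: "A * M \<in> carrier_mat k n" using Ac M by simp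
    have "(fro_norm (A * M))\<^sup>2 = (\<Sum>l<k. \<Sum>j<n. (\<Sum>i<m. A $$ (l, i) * M $$ (i, j))\<^sup>2)"
      unfolding fro_norm_square_sum[OF AMc]
      by (intro sum.cong refl) (auto simp: mat_mult_entry[OF Ac M] simp del: index_mult_mat(1))
    also have "\<dots> = (\<Sum>j<n. \<Sum>l<k. (\<Sum>i<m. A $$ (l, i) * M $$ (i, j))\<^sup>2)" by (rule sum.swap)
    also have "\<dots> = (\<Sum>j<n. c j * y j)"
    proof (rule sum.cong[OF refl])
      fix j assume "j \<in> {..<n}"
      show "(\<Sum>l<k. (\<Sum>i<m. A $$ (l, i) * M $$ (i, j))\<^sup>2) = c j * y j"
      proof (cases "c j = 0")
        case True
        then show ?thesis using zero[of j] by simp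
      next
        case False
        have "(\<Sum>i<m. A $$ (l, i) * z j i) = (\<Sum>i<m. A $$ (l, i) * M $$ (i, j)) / sqrt (c j)" for l
          by (simp add: z_def sum_divide_distrib)
        then have "c j * y j = (\<Sum>l<k. c j * ((\<Sum>i<m. A $$ (l, i) * M $$ (i, j))\<^sup>2 / c j))"
          using c0[of j] by (simp add: y_def power_divide sum_distrib_left)
        then show ?thesis using False by simp
      qed
    qed
    also have "\<dots> = (\<Sum>j\<in>J. c j * y j)" by (rule cJ)
    finally have "(fro_norm (A * M))\<^sup>2 / (fro_norm M)\<^sup>2 / 4 = (\<Sum>j\<in>J. p j *\<^sub>R (y j / 4))"
      by (simp add: p_def sum_divide_distrib)
    then have "exp ((fro_norm (A * M))\<^sup>2 / (fro_norm M)\<^sup>2 / 4) = exp (\<Sum>j\<in>J. p j *\<^sub>R (y j / 4))" by simp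
    also have "\<dots> \<le> (\<Sum>j\<in>J. p j * exp (y j / 4))"
      by (rule convex_on_sum[OF finJ J0 exp_convex psum]) (use p0 in auto)
    finally show ?thesis by (simp add: g_def y_def)
  qed
  have g_meas: "g j \<in> borel_measurable \<mu>" for j
    unfolding g_def using mat_meas_entry[OF id]
    by (intro measurable_compose[OF _ borel_measurable_exp] borel_measurable_divide borel_measurable_sum borel_measurable_power borel_measurable_times) auto
  have "(\<integral>\<^sup>+A. ennreal (exp ((fro_norm (A * M))\<^sup>2 / (fro_norm M)\<^sup>2 / 4)) \<partial>\<mu>)
      \<le> (\<integral>\<^sup>+A. (\<Sum>j\<in>J. ennreal (p j) * ennreal (g j A)) \<partial>\<mu>)"
  proof (rule nn_integral_mono)
    fix A assume "A \<in> space \<mu>"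
    have "(\<Sum>j\<in>J. ennreal (p j) * ennreal (g j A)) = ennreal (\<Sum>j\<in>J. p j * g j A)"
      using p0 by (simp add: ennreal_mult[symmetric] g_def)
    then show "ennreal (exp ((fro_norm (A * M))\<^sup>2 / (fro_norm M)\<^sup>2 / 4)) \<le> (\<Sum>j\<in>J. ennreal (p j) * ennreal (g j A))"
      using conv[OF \<open>A \<in> space \<mu>\<close>] by (simp add: ennreal_leI)
  qed
  also have "\<dots> = (\<Sum>j\<in>J. ennreal (p j) * (\<integral>\<^sup>+A. ennreal (g j A) \<partial>\<mu>))"
    using g_meas by (subst nn_integral_sum) (auto simp: nn_integral_cmult)
  also have "\<dots> \<le> (\<Sum>j\<in>J. ennreal (p j) * ennreal (sqrt 2 ^ k))"
  proof (intro sum_mono mult_left_mono)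
    fix j assume "j \<in> J"
    have "(\<Sum>i<m. (z j i)\<^sup>2) = (\<Sum>i<m. (M $$ (i, j))\<^sup>2) / c j"
      using c0[of j] by (simp add: z_def power_divide sum_divide_distrib)
    then have "(\<Sum>i<m. (z j i)\<^sup>2) = 1" using \<open>j \<in> J\<close> by (simp add: J_def c_def)
    then show "(\<integral>\<^sup>+A. ennreal (g j A) \<partial>\<mu>) \<le> ennreal (sqrt 2 ^ k)"
      unfolding g_def by (rule uniform_rows_exp_vec[OF \<mu> m])
  qed simp
  also have "\<dots> = ennreal (\<Sum>j\<in>J. p j) * ennreal (sqrt 2 ^ k)"
    using p0 by (simp add: sum_distrib_right[symmetric])
  finally show ?thesis by (simp add: psum)
qed

subsection \<open>The random initialization\<close>

lemma fro_norm_head_isometry: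
  assumes W: "chain_dims W d k" and m: "0 \<le> (m :: real)"
    and iso: "\<And>i. 1 \<le> i \<Longrightarrow> i \<le> k \<Longrightarrow> (W i)\<^sup>T * W i = m \<cdot>\<^sub>m 1\<^sub>m (d (i - 1))"
    and B: "B \<in> carrier_mat (d 0) n"
  shows "fro_norm (chain W (d 0) k * B) = sqrt m ^ k * fro_norm B"
  using W iso
proof (induction k)
  case 0
  then show ?case using B by simp
next
  case (Suc k)
  note dW = chain_dims_le[OF Suc.prems(1) le_SucI[OF order_refl]]
  note Wk = chain_dims_Suc[OF Suc.prems(1) order_refl] and C = chain_carrier[OF dW]
  have "fro_norm (chain W (d 0) (Suc k) * B) = fro_norm (W (Suc k) * (chain W (d 0) k * B))"
    using assoc_mult_mat[OF Wk C B] by simp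
  also have "\<dots> = sqrt m * fro_norm (chain W (d 0) k * B)"
    using Suc.prems(2)[of "Suc k"] C B by (intro fro_norm_scaled_isometry[OF Wk _ m]) auto
  also have "\<dots> = sqrt m ^ Suc k * fro_norm B" using Suc.IH[OF dW Suc.prems(2)] by simp
  finally show ?case .
qed

text \<open>The transposed product applies the last layer first, so the induction varies
  \<open>B\<close>: adding a layer on top replaces \<open>B\<close> by its image under the transpose
  of that layer.\<close>

lemma fro_norm_tail_isometry:
  assumes W: "chain_dims W d K" and m: "0 \<le> (m :: real)" and iK: "i \<le> K"
    and iso: "\<And>j. i < j \<Longrightarrow> j \<le> K \<Longrightarrow> W j * (W j)\<^sup>T = m \<cdot>\<^sub>m 1\<^sub>m (d j)"
    and B: "B \<in> carrier_mat (d K) n"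
  shows "fro_norm ((tail_chain W d K i)\<^sup>T * B) = sqrt m ^ (K - i) * fro_norm B"
  using iK W iso B
proof (induction K arbitrary: B rule: dec_induct)
  case base
  then show ?case by (simp add: tail_chain_self)
next
  case (step K)
  note dW = chain_dims_le[OF step.prems(1) le_SucI[OF order_refl]]
  note Wk = chain_dims_Suc[OF step.prems(1) order_refl] and T = tail_chain_carrier[OF dW step.hyps(1)]
  have WT: "(W (Suc K))\<^sup>T \<in> carrier_mat (d K) (d (Suc K))" using Wk by simp
  have WB: "(W (Suc K))\<^sup>T * B \<in> carrier_mat (d K) n" using WT step.prems(3) by simp
  have TT: "(tail_chain W d K i)\<^sup>T \<in> carrier_mat (d i) (d K)" using T by simp
  have "(tail_chain W d (Suc K) i)\<^sup>T * B = (tail_chain W d K i)\<^sup>T * ((W (Suc K))\<^sup>T * B)"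
    unfolding tail_chain_Suc[OF step.hyps(1)] transpose_mult[OF Wk T]
    by (rule assoc_mult_mat[OF TT WT step.prems(3)])
  then have "fro_norm ((tail_chain W d (Suc K) i)\<^sup>T * B) = sqrt m ^ (K - i) * fro_norm ((W (Suc K))\<^sup>T * B)"
    using step.IH[OF dW step.prems(2) WB] by simp
  also have "fro_norm ((W (Suc K))\<^sup>T * B) = sqrt m * fro_norm B"
    using step.prems(2)[of "Suc K"] step.hyps(1) step.prems(3)
    by (intro fro_norm_scaled_isometry[OF WT _ m]) auto
  finally show ?case using step.hyps(1) by (simp add: Suc_diff_le)
qed

section \<open>Least squares and the excess loss\<close>

lemma least_squares_normal_equation:
  assumes X: "X \<in> carrier_mat p n" and Y: "Y \<in> carrier_mat k n" and Ws: "Ws \<in> carrier_mat k p"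
    and min: "\<And>W. W \<in> carrier_mat k p \<Longrightarrow> fro_norm (Ws * X - Y) \<le> fro_norm (W * X - Y)"
  shows "(Ws * X - Y) * X\<^sup>T = 0\<^sub>m k p"
proof -
  define E where "E = Ws * X - Y"
  define G where "G = E * X\<^sup>T"
  have E: "E \<in> carrier_mat k n" using Y by (simp add: E_def minus_carrier_mat)
  have G: "G \<in> carrier_mat k p" using E X by (simp add: G_def)
  have GX: "G * X \<in> carrier_mat k n" using G X by simp
  have WX: "Ws * X \<in> carrier_mat k n" using Ws X by simp
  have inner: "fro_inner E (G * X) = (fro_norm G)\<^sup>2"
    using fro_inner_mult_right[OF X G E] fro_inner_sym[OF E GX] by (simp add: fro_norm_square G_def)
  \<comment> \<open>Minimality is tested along the line from \<open>Ws\<close> in direction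
    \<open>- G\<close>, the steepest descent of the squared error.\<close>
  have quad: "0 \<le> - (2 * t * (fro_norm G)\<^sup>2) + t\<^sup>2 * (fro_norm (G * X))\<^sup>2" for t
  proof -
    have "(Ws + (- t) \<cdot>\<^sub>m G) * X - Y = E + (- t) \<cdot>\<^sub>m (G * X)"
    proof -
      have "(Ws + (- t) \<cdot>\<^sub>m G) * X = Ws * X + (- t) \<cdot>\<^sub>m (G * X)"
        using Ws G X by (simp add: add_mult_distrib_mat[of _ k p _ _ n] mult_smult_assoc_mat[of _ k p _ n])
      moreover have "A + (- t) \<cdot>\<^sub>m B - Y = (A - Y) + (- t) \<cdot>\<^sub>m B"
        if "A \<in> carrier_mat k n" "B \<in> carrier_mat k n" for A B
        using that Y by (intro eq_matI) auto
      ultimately show ?thesis unfolding E_def using WX GX by simp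
    qed
    then have "(fro_norm E)\<^sup>2 \<le> (fro_norm (E + (- t) \<cdot>\<^sub>m (G * X)))\<^sup>2"
      using min[of "Ws + (- t) \<cdot>\<^sub>m G"] Ws G by (intro power_mono) (auto simp: E_def)
    also have "\<dots> = (fro_norm E)\<^sup>2 + 2 * ((- t) * (fro_norm G)\<^sup>2) + t\<^sup>2 * (fro_norm (G * X))\<^sup>2"
      using GX by (simp add: fro_norm_add_square[OF E, of "(- t) \<cdot>\<^sub>m (G * X)"] fro_norm_smult power_mult_distrib
          fro_inner_smult_right[OF E GX] inner)
    finally show ?thesis by simp
  qed
  have "(fro_norm G)\<^sup>2 \<le> 0"
  proof (rule ccontr)
    assume "\<not> (fro_norm G)\<^sup>2 \<le> 0"
    then have g: "0 < (fro_norm G)\<^sup>2" by simp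
    \<comment> \<open>The added 1 keeps the divisor positive when \<open>G * X\<close> vanishes. For
      t = |G|^2 / N the quadratic is at most - t |G|^2, a contradiction.\<close>
    define N where "N = (fro_norm (G * X))\<^sup>2 + 1"
    have N: "0 < N" "(fro_norm (G * X))\<^sup>2 \<le> N" by (auto simp: N_def add_nonneg_pos)
    define t where "t = (fro_norm G)\<^sup>2 / N"
    have t: "0 < t" "t * N = (fro_norm G)\<^sup>2" using g N by (auto simp: t_def)
    have "t\<^sup>2 * (fro_norm (G * X))\<^sup>2 \<le> t\<^sup>2 * N" using N by (intro mult_left_mono) auto
    also have "\<dots> = t * (fro_norm G)\<^sup>2" using t by (simp add: power2_eq_square mult.assoc)
    finally have "0 \<le> - (t * (fro_norm G)\<^sup>2)" using quad[of t] by simp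
    then show False using mult_pos_pos[OF t(1) g] by linarith
  qed
  then have "fro_norm G = 0" by simp
  then show ?thesis using fro_norm_eq_0D[OF G] by (simp add: G_def E_def)
qed

text \<open>Pythagoras: network output minus best fit is a matrix times \<open>X\<close>, and by
  \<open>opt\<close> the least-squares error is orthogonal to all of these.\<close>

lemma net_loss_excess:
  assumes W: "chain_dims W d L" and X: "X \<in> carrier_mat (d 0) n" and Y: "Y \<in> carrier_mat (d L) n"
    and Ws: "Ws \<in> carrier_mat (d L) (d 0)" and opt: "(Ws * X - Y) * X\<^sup>T = 0\<^sub>m (d L) (d 0)"
  shows "net_loss \<alpha> X Y L W - (1/2) * (fro_norm (Ws * X - Y))\<^sup>2
    = (1/2) * (fro_norm (\<alpha> \<cdot>\<^sub>m chain W (d 0) L * X - Ws * X))\<^sup>2"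
proof -
  define A where "A = \<alpha> \<cdot>\<^sub>m chain W (d 0) L"
  define E where "E = Ws * X - Y"
  have A: "A \<in> carrier_mat (d L) (d 0)" using chain_carrier[OF W] by (simp add: A_def)
  have AX: "A * X \<in> carrier_mat (d L) n" and WX: "Ws * X \<in> carrier_mat (d L) n" using A Ws X by auto
  have E: "E \<in> carrier_mat (d L) n" using Y by (simp add: E_def minus_carrier_mat)
  have U: "A * X - Ws * X \<in> carrier_mat (d L) n" using WX by (simp add: minus_carrier_mat)
  have B: "A - Ws \<in> carrier_mat (d L) (d 0)" using Ws by (simp add: minus_carrier_mat)
  have UB: "A * X - Ws * X = (A - Ws) * X" by (rule minus_mult_distrib_mat[OF A Ws X, symmetric])
  have "fro_inner (A * X - Ws * X) E = fro_inner (A - Ws) (E * X\<^sup>T)"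
    unfolding UB by (rule fro_inner_mult_right[OF X B E])
  also have "\<dots> = 0" unfolding E_def opt by (rule fro_inner_zero_right[OF B])
  finally have 0: "fro_inner (A * X - Ws * X) E = 0" .
  have "A * X - Y = (A * X - Ws * X) + E" unfolding E_def by (rule mat_diff_split[OF AX WX Y])
  then have "(fro_norm (A * X - Y))\<^sup>2 = (fro_norm (A * X - Ws * X))\<^sup>2 + (fro_norm E)\<^sup>2"
    using fro_norm_add_square[OF U E] 0 by simp
  then show ?thesis using X by (simp add: net_loss_def A_def E_def algebra_simps)
qed

section \<open>Measurability along gradient descent\<close>

lemma gd_chain_dims:
  assumes "chain_dims W d L" "X \<in> carrier_mat (d 0) n" "Y \<in> carrier_mat (d L) n"
  shows "chain_dims (gd (net_loss \<alpha> X Y L) \<eta> L W t) d L"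
proof (induction t)
  case (Suc t)
  show ?case
    unfolding chain_dims_def
  proof (intro allI impI)
    fix i assume "1 \<le> i \<and> i \<le> L"
    then show "gd (net_loss \<alpha> X Y L) \<eta> L W (Suc t) i \<in> carrier_mat (d i) (d (i - 1))"
      using layer_grad_carrier[OF Suc.IH, of i X n \<alpha> Y] partial_grad_net_loss[OF Suc.IH, of i X n Y \<alpha>] assms
      by (simp add: minus_carrier_mat)
  qed
qed (simp add: assms)

text \<open>Each step is rewritten with the closed form of the gradient, which is polynomial in the
  entries, instead of the pointwise derivative in \<open>partial_grad\<close>.\<close>

lemma gd_mat_meas:
  assumes V: "\<And>i. 1 \<le> i \<Longrightarrow> i \<le> L \<Longrightarrow> mat_meas N (d i) (d (i - 1)) (\<lambda>w. V w i)"
    and X: "X \<in> carrier_mat (d 0) n" and Y: "Y \<in> carrier_mat (d L) n" and i: "1 \<le> i" "i \<le> L"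
  shows "mat_meas N (d i) (d (i - 1)) (\<lambda>w. gd (net_loss \<alpha> X Y L) \<eta> L (V w) t i)"
  using i
proof (induction t arbitrary: i)
  case 0
  then show ?case using V by simp
next
  case (Suc t)
  let ?W = "\<lambda>w. gd (net_loss \<alpha> X Y L) \<eta> L (V w) t"
  have dims: "chain_dims (?W w) d L" if "w \<in> space N" for w
    using mat_meas_carrier[OF V that] by (intro gd_chain_dims[OF _ X Y]) (auto simp: chain_dims_def)
  have chain_m: "mat_meas N (d k) (d 0) (\<lambda>w. chain (?W w) (d 0) k)" if "k \<le> L" for k
    using that by (intro mat_meas_chain Suc.IH) auto
  have tail_m: "mat_meas N (d L) (d i) (\<lambda>w. tail_chain (?W w) d L i)"
    using Suc.prems by (intro mat_meas_tail_chain Suc.IH) auto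
  have res_m: "mat_meas N (d L) n (\<lambda>w. \<alpha> \<cdot>\<^sub>m chain (?W w) (d 0) L * X - Y)"
    by (rule mat_meas_minus[OF mat_meas_mult[OF mat_meas_smult[OF chain_m[OF order_refl]] mat_meas_const[OF X]] mat_meas_const[OF Y]])
  have "i - 1 \<le> L" using Suc.prems by simp
  then have grad_m: "mat_meas N (d i) (d (i - 1)) (\<lambda>w. layer_grad \<alpha> X Y d L (?W w) i)"
    unfolding layer_grad_def
    by (intro mat_meas_smult mat_meas_mult[OF mat_meas_mult[OF mat_meas_transpose[OF tail_m] res_m]]
        mat_meas_transpose mat_meas_mult[OF _ mat_meas_const[OF X]] chain_m)
  show ?case
  proof (rule mat_meas_cong)
    show "mat_meas N (d i) (d (i - 1)) (\<lambda>w. ?W w i - \<eta> \<cdot>\<^sub>m layer_grad \<alpha> X Y d L (?W w) i)"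
      by (rule mat_meas_minus[OF Suc.IH[OF Suc.prems] mat_meas_smult[OF grad_m]])
    show "gd (net_loss \<alpha> X Y L) \<eta> L (V w) (Suc t) i = ?W w i - \<eta> \<cdot>\<^sub>m layer_grad \<alpha> X Y d L (?W w) i"
      if "w \<in> space N" for w
      using partial_grad_net_loss[OF dims[OF that] Suc.prems X Y, of \<alpha>] Suc.prems by simp
  qed
qed

lemma net_loss_measurable:
  assumes V: "\<And>i. 1 \<le> i \<Longrightarrow> i \<le> L \<Longrightarrow> mat_meas N (d i) (d (i - 1)) (\<lambda>w. V w i)"
    and X: "X \<in> carrier_mat (d 0) n" and Y: "Y \<in> carrier_mat (d L) n"
  shows "(\<lambda>w. net_loss \<alpha> X Y L (V w)) \<in> borel_measurable N"
proof -
  have chain_m: "mat_meas N (d L) (d 0) (\<lambda>w. chain (V w) (d 0) L)" by (rule mat_meas_chain) (rule V)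
  have "mat_meas N (d L) n (\<lambda>w. \<alpha> \<cdot>\<^sub>m chain (V w) (d 0) L * X - Y)"
    by (rule mat_meas_minus[OF mat_meas_mult[OF mat_meas_smult[OF chain_m] mat_meas_const[OF X]] mat_meas_const[OF Y]])
  from mat_meas_fro_norm[OF this] have "(\<lambda>w. (1/2) * (fro_norm (\<alpha> \<cdot>\<^sub>m chain (V w) (d 0) L * X - Y))\<^sup>2) \<in> borel_measurable N"
    by (intro borel_measurable_times borel_measurable_power) auto
  then show ?thesis using X by (simp add: net_loss_def)
qed

section \<open>From the random start to the good event\<close>

definition layer_dim :: "nat \<Rightarrow> nat \<Rightarrow> nat \<Rightarrow> nat \<Rightarrow> nat \<Rightarrow> nat" where
  "layer_dim dx dy m L k = (if k = 0 then dx else if k = L then dy else m)"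

lemma sqrt2_power_le_exp: "sqrt 2 ^ k \<le> exp (real k / 2)"
proof -
  have "sqrt 2 \<le> sqrt (exp 1)" using exp_ge_add_one_self[of 1] by (intro real_sqrt_le_mono) simp
  also have "\<dots> = exp (1 / 2)" by (rule real_sqrt_unique) (auto simp: power2_eq_square exp_add[symmetric])
  finally have "sqrt 2 ^ k \<le> exp (1 / 2) ^ k" by (intro power_mono) auto
  then show ?thesis by (simp add: exp_of_nat_mult[symmetric])
qed

lemma initial_output_tail:
  fixes \<mu> :: "nat \<Rightarrow> real mat measure" and d :: "nat \<Rightarrow> nat"
  assumes L: "2 \<le> L" and prob: "\<And>i. i \<in> {1..L} \<Longrightarrow> prob_space (\<mu> i)"
    and sets: "\<And>i. i \<in> {1..L} \<Longrightarrow> sets (\<mu> i) = sets (mat_borel (d i) (d (i - 1)))"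
    and uni: "uniform_rows (d L) (d (L - 1)) (real (d (L - 1))) (\<mu> L)" and m: "0 < d (L - 1)"
    and X: "X \<in> carrier_mat (d 0) n" and \<delta>: "0 < \<delta>"
  defines "P \<equiv> PiM {1..L} \<mu>"
  defines "\<psi> \<equiv> (\<lambda>W. (fro_norm (chain W (d 0) L * X))\<^sup>2 / (fro_norm (chain W (d 0) (L - 1) * X))\<^sup>2)"
  shows "\<psi> \<in> borel_measurable P"
    and "measure P {W \<in> space P. 2 * real (d L) + 4 * ln (1 / \<delta>) \<le> \<psi> W} \<le> \<delta>"
proof -
  \<comment> \<open>The Fubini theorem for products wants a sigma-finite measure at every index,
    while \<open>\<mu>\<close> is constrained only on \<open>{1..L}\<close>. Filling in
    \<open>\<mu> 1\<close> elsewhere leaves the product unchanged.\<close>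
  define \<nu> where "\<nu> = (\<lambda>i. if i \<in> {1..L} then \<mu> i else \<mu> 1)"
  have P: "P = PiM {1..L} \<nu>" unfolding P_def by (rule PiM_cong) (auto simp: \<nu>_def)
  have prob\<nu>: "prob_space (\<nu> i)" for i using prob[of i] prob[of 1] L by (simp add: \<nu>_def)
  interpret product_sigma_finite \<nu>
    by (rule product_sigma_finite.intro) (rule prob_space_imp_sigma_finite[OF prob\<nu>])
  interpret PP: prob_space P unfolding P_def by (rule prob_space_PiM) (rule prob)
  have comp: "mat_meas P (d i) (d (i - 1)) (\<lambda>W. W i)" if "1 \<le> i" "i \<le> L" for i
    unfolding P_def using that by (intro mat_meas_PiM_component sets) auto
  have chain_m: "mat_meas P (d k) n (\<lambda>W. chain W (d 0) k * X)" if "k \<le> L" for k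
    by (rule mat_meas_mult[OF mat_meas_chain[where d = d and V = "\<lambda>W. W"] mat_meas_const[OF X]]) (use that comp in auto)
  show \<psi>_meas: "\<psi> \<in> borel_measurable P"
    unfolding \<psi>_def using mat_meas_fro_norm[OF chain_m[of L]] mat_meas_fro_norm[OF chain_m[of "L - 1"]]
    by (intro borel_measurable_divide borel_measurable_power) auto
  define f where "f = (\<lambda>W. ennreal (exp (\<psi> W / 4)))"
  have f_meas: "f \<in> borel_measurable P"
  proof -
    have "(\<lambda>W. exp (\<psi> W / 4)) \<in> borel_measurable P"
      using \<psi>_meas by (intro measurable_compose[OF _ borel_measurable_exp] borel_measurable_divide) auto
    then show ?thesis by (simp add: f_def)
  qed
  have ins: "{1..L} = insert L {1..<L}" using L by auto
  have "(\<integral>\<^sup>+W. f W \<partial>P) = (\<integral>\<^sup>+x. (\<integral>\<^sup>+A. f (x(L := A)) \<partial>\<nu> L) \<partial>PiM {1..<L} \<nu>)"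
    using f_meas unfolding P ins by (intro product_nn_integral_insert) auto
  also have "\<dots> \<le> (\<integral>\<^sup>+x. ennreal (sqrt 2 ^ d L) \<partial>PiM {1..<L} \<nu>)"
  proof (rule nn_integral_mono)
    fix x assume x: "x \<in> space (PiM {1..<L} \<nu>)"
    have xi: "x i \<in> carrier_mat (d i) (d (i - 1))" if "1 \<le> i" "i \<le> L - 1" for i
    proof -
      have iL: "i \<in> {1..<L}" "i \<in> {1..L}" using that L by auto
      then have "x i \<in> space (\<nu> i)" using x by (auto simp: space_PiM PiE_def Pi_def)
      moreover have "space (\<nu> i) = carrier_mat (d i) (d (i - 1))"
        using sets_eq_imp_space_eq[OF sets[OF iL(2)]] iL(2) by (simp add: \<nu>_def space_mat_borel)
      ultimately show ?thesis by simp
    qed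
    then have dx: "chain_dims x d (L - 1)" by (simp add: chain_dims_def)
    note C = chain_carrier[OF dx]
    let ?M = "chain x (d 0) (L - 1) * X"
    have M: "?M \<in> carrier_mat (d (L - 1)) n" using C X by simp
    have \<nu>L: "\<nu> L = \<mu> L" using L by (simp add: \<nu>_def)
    have "(\<integral>\<^sup>+A. f (x(L := A)) \<partial>\<nu> L) = (\<integral>\<^sup>+A. ennreal (exp ((fro_norm (A * ?M))\<^sup>2 / (fro_norm ?M)\<^sup>2 / 4)) \<partial>\<mu> L)"
      unfolding \<nu>L
    proof (rule nn_integral_cong)
      fix A assume "A \<in> space (\<mu> L)"
      then have A: "A \<in> carrier_mat (d L) (d (L - 1))"
        using sets_eq_imp_space_eq[OF sets[of L]] L by (simp add: space_mat_borel)
      have 1: "chain (x(L := A)) (d 0) (L - 1) = chain x (d 0) (L - 1)"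
        using L by (intro chain_cong) auto
      have "chain (x(L := A)) (d 0) (Suc (L - 1)) = A * chain x (d 0) (L - 1)"
        unfolding chain.simps 1 using L by simp
      then have 2: "chain (x(L := A)) (d 0) L = A * chain x (d 0) (L - 1)" using L by simp
      have 3: "A * chain x (d 0) (L - 1) * X = A * ?M" by (rule assoc_mult_mat[OF A C X])
      show "f (x(L := A)) = ennreal (exp ((fro_norm (A * ?M))\<^sup>2 / (fro_norm ?M)\<^sup>2 / 4))"
        unfolding f_def \<psi>_def 1 2 3 ..
    qed
    also have "\<dots> \<le> ennreal (sqrt 2 ^ d L)" by (rule uniform_rows_exp_mat[OF uni m M])
    finally show "(\<integral>\<^sup>+A. f (x(L := A)) \<partial>\<nu> L) \<le> ennreal (sqrt 2 ^ d L)" .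
  qed
  also have "\<dots> = ennreal (sqrt 2 ^ d L)"
  proof -
    interpret Q: prob_space "PiM {1..<L} \<nu>" by (rule prob_space_PiM) (rule prob\<nu>)
    show ?thesis by (simp only: nn_integral_const Q.emeasure_space_1 mult_1_right)
  qed
  also have "\<dots> \<le> ennreal (exp (real (d L) / 2))" by (intro ennreal_leI sqrt2_power_le_exp)
  finally have int: "(\<integral>\<^sup>+W. f W \<partial>P) \<le> ennreal (exp (real (d L) / 2))" .
  \<comment> \<open>The threshold on \<open>\<psi>\<close> is four times \<open>s0\<close>, and
    \<open>s0\<close> exceeds the exponent of the moment bound by ln (1 / \<delta>), so that Markov
    yields exactly \<delta>.\<close>
  define s0 where "s0 = real (d L) / 2 + ln (1 / \<delta>)"
  have "{W \<in> space P. 2 * real (d L) + 4 * ln (1 / \<delta>) \<le> \<psi> W} = {W \<in> space P. 1 \<le> ennreal (exp (- s0)) * f W}"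
  proof (intro Collect_cong conj_cong refl)
    fix W
    have "1 \<le> ennreal (exp (- s0)) * f W \<longleftrightarrow> ennreal 1 \<le> ennreal (exp (\<psi> W / 4 - s0))"
      by (simp add: f_def ennreal_mult[symmetric] exp_add[symmetric])
    also have "\<dots> \<longleftrightarrow> 2 * real (d L) + 4 * ln (1 / \<delta>) \<le> \<psi> W"
      by (subst ennreal_le_iff) (auto simp: s0_def one_le_exp_iff)
    finally show "2 * real (d L) + 4 * ln (1 / \<delta>) \<le> \<psi> W \<longleftrightarrow> 1 \<le> ennreal (exp (- s0)) * f W" by simp
  qed
  also have "emeasure P \<dots> \<le> ennreal (exp (- s0)) * (\<integral>\<^sup>+W. f W * indicator (space P) W \<partial>P)"
    using f_meas by (intro nn_integral_Markov_inequality) auto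
  also have "(\<integral>\<^sup>+W. f W * indicator (space P) W \<partial>P) = (\<integral>\<^sup>+W. f W \<partial>P)"
    by (intro nn_integral_cong) simp
  also have "ennreal (exp (- s0)) * (\<integral>\<^sup>+W. f W \<partial>P) \<le> ennreal (exp (- s0)) * ennreal (exp (real (d L) / 2))"
    by (intro mult_left_mono int) simp
  also have "\<dots> = ennreal \<delta>"
    using \<delta> by (simp add: ennreal_mult[symmetric] exp_add[symmetric] s0_def ln_div)
  finally show "measure P {W \<in> space P. 2 * real (d L) + 4 * ln (1 / \<delta>) \<le> \<psi> W} \<le> \<delta>"
    using \<delta> by (simp add: PP.emeasure_eq_measure)
qed

text \<open>The width hypothesis is exactly what makes the initial residual small compared with the
  least nonzero singular value of the data.\<close>
lemma initial_residual_small: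
  fixes x s m dy S f u \<kappa> :: real
  assumes pos: "0 < x" "0 < s" "0 < m" "0 < dy" "0 \<le> S" "0 \<le> u"
    and \<kappa>: "x\<^sup>2 / s \<le> \<kappa>" and width: "500000 * (f\<^sup>2 / x\<^sup>2) * \<kappa>\<^sup>2 * (dy * S) \<le> m"
    and u: "(1/2) * u\<^sup>2 \<le> 4 * S * f\<^sup>2"
  shows "x * sqrt dy * u \<le> s * sqrt m / 250"
proof (rule power2_le_imp_le)
  have "(x * sqrt dy * u)\<^sup>2 = x\<^sup>2 * dy * u\<^sup>2" using pos by (simp add: power_mult_distrib)
  also have "\<dots> \<le> x\<^sup>2 * dy * (8 * S * f\<^sup>2)" using u pos by (intro mult_left_mono) auto
  \<comment> \<open>62500 is 250^2, and 8 * 62500 = 500000 is the constant of the width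
    condition.\<close>
  also have "\<dots> = s\<^sup>2 / 62500 * (500000 * (f\<^sup>2 / x\<^sup>2) * (x\<^sup>2 / s)\<^sup>2 * (dy * S))"
    using pos by (simp add: field_simps power2_eq_square)
  also have "\<dots> \<le> s\<^sup>2 / 62500 * (500000 * (f\<^sup>2 / x\<^sup>2) * \<kappa>\<^sup>2 * (dy * S))"
    using \<kappa> pos by (intro mult_left_mono mult_right_mono power_mono) auto
  also have "\<dots> \<le> s\<^sup>2 / 62500 * m" using width by (intro mult_left_mono) auto
  also have "\<dots> = (s * sqrt m / 250)\<^sup>2" using pos by (simp add: power_mult_distrib power_divide)
  finally show "(x * sqrt dy * u)\<^sup>2 \<le> (s * sqrt m / 250)\<^sup>2" .
qed (use pos in simp)

text \<open>The first layer may lack orthogonal rows and the last one orthogonal columns. But the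
  heads considered stop before layer L and the tails start after layer 1, so each uses only layers
  isometric in the direction it needs. The upper bound for the last layer comes from its
  transpose.\<close>

lemma orthogonal_init_bounds:
  fixes d :: "nat \<Rightarrow> nat" and m :: real
  assumes W: "chain_dims W d L" and L: "2 \<le> L" and m: "0 < m"
    and cols: "\<And>i. 1 \<le> i \<Longrightarrow> i < L \<Longrightarrow> (W i)\<^sup>T * W i = m \<cdot>\<^sub>m 1\<^sub>m (d (i - 1))"
    and rows: "\<And>i. 1 < i \<Longrightarrow> i \<le> L \<Longrightarrow> W i * (W i)\<^sup>T = m \<cdot>\<^sub>m 1\<^sub>m (d i)"
    and i: "1 \<le> i" "i \<le> L"
  shows "op_le (W i) (sqrt m)" "op_ge (tail_chain W d L i)\<^sup>T (sqrt m ^ (L - i))"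
    "op_ge (chain W (d 0) (i - 1)) (sqrt m ^ (i - 1))"
proof -
  note Wi = chain_dimsD[OF W i]
  have iL: "i - 1 \<le> L" using i by simp
  show "op_ge (tail_chain W d L i)\<^sup>T (sqrt m ^ (L - i))"
    unfolding op_ge_def
  proof (intro allI ballI)
    fix k and B :: "real mat" assume "B \<in> carrier_mat (dim_col (tail_chain W d L i)\<^sup>T) k"
    then have "B \<in> carrier_mat (d L) k" using tail_chain_carrier[OF W i(2)] by simp
    then show "sqrt m ^ (L - i) * fro_norm B \<le> fro_norm ((tail_chain W d L i)\<^sup>T * B)"
      using fro_norm_tail_isometry[OF W less_imp_le[OF m] i(2) rows] i by simp
  qed
  show "op_ge (chain W (d 0) (i - 1)) (sqrt m ^ (i - 1))"
    unfolding op_ge_def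
  proof (intro allI ballI)
    fix k and B :: "real mat" assume "B \<in> carrier_mat (dim_col (chain W (d 0) (i - 1))) k"
    then have "B \<in> carrier_mat (d 0) k" using chain_carrier[OF chain_dims_le[OF W iL]] by simp
    then show "sqrt m ^ (i - 1) * fro_norm B \<le> fro_norm (chain W (d 0) (i - 1) * B)"
      using fro_norm_head_isometry[OF chain_dims_le[OF W iL] less_imp_le[OF m] cols] i by simp
  qed
  show "op_le (W i) (sqrt m)"
  proof (cases "i < L")
    case True
    then show ?thesis
      using fro_norm_scaled_isometry[OF Wi cols[OF i(1) True] less_imp_le[OF m]] Wi m by (simp add: op_le_def)
  next
    case False
    then have 1: "1 < i" using i L by simp
    have WT: "(W i)\<^sup>T \<in> carrier_mat (d (i - 1)) (d i)" using Wi by simp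
    have "op_le (W i)\<^sup>T (sqrt m)"
      using fro_norm_scaled_isometry[OF WT, of m] rows[OF 1 i(2)] Wi m by (simp add: op_le_def)
    then show ?thesis using op_le_transpose[of "(W i)\<^sup>T"] by simp
  qed
qed

theorem orthogonal_init_good_event:
  fixes X Y Ws :: "real mat" and \<mu> :: "nat \<Rightarrow> real mat measure" and \<delta> \<eta> :: real
  assumes X: "X \<in> carrier_mat dx n" and Y: "Y \<in> carrier_mat dy n" and L: "2 \<le> L" and m: "max dx dy \<le> m"
    and Ws: "Ws \<in> carrier_mat dy dx"
    and min: "\<forall>W \<in> carrier_mat dy dx. fro_norm (Ws * X - Y) \<le> fro_norm (W * X - Y)"
    and \<delta>: "0 < \<delta>" "\<delta> < 1"
    and \<eta>: "0 < \<eta>" "\<eta> \<le> real dy / (2 * real L * (spec_norm X)\<^sup>2)"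
    and uc: "uniform_cols m dx (real m) (\<mu> 1)"
    and us: "\<And>i. 2 \<le> i \<Longrightarrow> i \<le> L - 1 \<Longrightarrow> uniform_square m (real m) (\<mu> i)"
    and ur: "uniform_rows dy m (real m) (\<mu> L)"
  defines "r \<equiv> mat_rank X"
  defines "lr \<equiv> lambda_i (X\<^sup>T * X) r"
  defines "\<kappa> \<equiv> lambda_max (X\<^sup>T * X) / lr"
  assumes width: "500000 * ((fro_norm X)\<^sup>2 / (spec_norm X)\<^sup>2) * \<kappa>\<^sup>2
      * (real dy * (1 + (spec_norm Ws)\<^sup>2) + ln (real r / \<delta>)) \<le> real m"
  defines "F \<equiv> net_loss (net_alpha m L dy) X Y L"
  defines "ls \<equiv> (1/2) * (fro_norm (Ws * X - Y))\<^sup>2"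
  defines "P \<equiv> PiM {1..L} \<mu>"
  shows "1 - \<delta> \<le> measure P {W \<in> space P.
          F W - ls \<le> 4 * (1 + ln (real r / \<delta>) / real dy + (spec_norm Ws)\<^sup>2) * (fro_norm X)\<^sup>2 \<and>
          (\<forall>t. F (gd F \<eta> L W t) - ls \<le> (1 - (1/2) * \<eta> * real L * lr / real dy) ^ t * (F W - ls))}"
proof -
  define d where "d = layer_dim dx dy m L"
  define x where "x = spec_norm X"
  define \<alpha> where "\<alpha> = net_alpha m L dy"
  define S where "S = 1 + ln (real r / \<delta>) / real dy + (spec_norm Ws)\<^sup>2"
  define q where "q = \<eta> * real L * lr / real dy"
  have d: "d 0 = dx" "d L = dy" and dm: "\<And>i. 0 < i \<Longrightarrow> i < L \<Longrightarrow> d i = m"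
    using L by (auto simp: d_def layer_dim_def)
  \<comment> \<open>Division by zero gives 0, so a positive step size below this quotient rules out
    \<open>dy = 0\<close> and data of norm zero.\<close>
  have rpos: "0 < real dy / (2 * real L * x\<^sup>2)" using \<eta> by (simp add: x_def)
  then have dy: "0 < dy" and x0: "x \<noteq> 0" by (auto simp: zero_less_divide_iff)
  have "0 \<le> x" by (simp add: x_def)
  then have x: "0 < x" using x0 by linarith
  have m0: "0 < m" using m dy by simp
  have \<eta>x: "\<eta> * real L * x\<^sup>2 \<le> real dy / 2"
    using \<eta>(2) x L by (simp add: x_def[symmetric] field_simps)
  note gram = gram_lambda_rank[OF X, folded r_def, folded lr_def x_def, OF x0]
  have \<kappa>: "x\<^sup>2 / lr \<le> \<kappa>" unfolding \<kappa>_def using gram(2,4) by (intro divide_right_mono) auto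
  \<comment> \<open>The tail bound yields ln (1 / \<delta>); the rank is at least 1, so the quantity
    in the statement is larger.\<close>
  have lnr: "ln (1 / \<delta>) \<le> ln (real r / \<delta>)" "0 \<le> ln (1 / \<delta>)"
    using \<delta> gram(1) by (auto simp: divide_right_mono)
  have S1: "0 \<le> S" using lnr by (simp add: S_def)
  have dyS: "real dy * (1 + (spec_norm Ws)\<^sup>2) + ln (real r / \<delta>) = real dy * S"
    using dy by (simp add: S_def field_simps)
  have X': "X \<in> carrier_mat (d 0) n" and Y': "Y \<in> carrier_mat (d L) n" and Ws': "Ws \<in> carrier_mat (d L) (d 0)"
    using X Y Ws by (auto simp: d)
  have opt: "(Ws * X - Y) * X\<^sup>T = 0\<^sub>m (d L) (d 0)"
    using least_squares_normal_equation[OF X Y Ws] min by (simp add: d)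
  have excess: "F W - ls = (1/2) * (fro_norm (\<alpha> \<cdot>\<^sub>m chain W (d 0) L * X - Ws * X))\<^sup>2" if "chain_dims W d L" for W
    unfolding F_def ls_def \<alpha>_def by (rule net_loss_excess[OF that X' Y' Ws' opt])
  \<comment> \<open>One formulation for all layers: orthogonal columns except for the last,
    orthogonal rows except for the first. For \<open>L = 2\<close> the middle case is empty.\<close>
  have layer: "prob_space (\<mu> i) \<and> sets (\<mu> i) = sets (mat_borel (d i) (d (i - 1))) \<and>
      (AE A in \<mu> i. (i < L \<longrightarrow> A\<^sup>T * A = real m \<cdot>\<^sub>m 1\<^sub>m (d (i - 1))) \<and> (1 < i \<longrightarrow> A * A\<^sup>T = real m \<cdot>\<^sub>m 1\<^sub>m (d i)))"
    if i: "i \<in> {1..L}" for i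
  proof -
    consider "i = 1" | "2 \<le> i" "i \<le> L - 1" | "i = L" using i by fastforce
    then show ?thesis
    proof cases
      case 1
      have "AE A in \<mu> 1. A\<^sup>T * A = real m \<cdot>\<^sub>m 1\<^sub>m dx" using uc unfolding uniform_cols_def by blast
      then have "AE A in \<mu> 1. (1 < L \<longrightarrow> A\<^sup>T * A = real m \<cdot>\<^sub>m 1\<^sub>m (d (1 - 1))) \<and> (1 < (1::nat) \<longrightarrow> A * A\<^sup>T = real m \<cdot>\<^sub>m 1\<^sub>m (d 1))"
        by (rule AE_mp) (auto simp: d)
      then show ?thesis unfolding 1 using uc dm[of 1] L d by (auto simp: uniform_cols_def)
    next
      case 2
      then show ?thesis using us[OF 2] dm[of i] dm[of "i - 1"] L by (auto simp: uniform_square_def)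
    next
      case 3
      have "AE A in \<mu> L. A * A\<^sup>T = real m \<cdot>\<^sub>m 1\<^sub>m dy" using ur unfolding uniform_rows_def by blast
      then show ?thesis unfolding 3 using ur dm[of "L - 1"] L d by (auto simp: uniform_rows_def)
    qed
  qed
  interpret P: prob_space P unfolding P_def by (rule prob_space_PiM) (use layer in blast)
  have comp: "mat_meas P (d i) (d (i - 1)) (\<lambda>W. W i)" if "1 \<le> i" "i \<le> L" for i
    unfolding P_def using that layer by (intro mat_meas_PiM_component) auto
  have dims: "chain_dims W d L" if "W \<in> space P" for W
    using mat_meas_carrier[OF comp that] by (simp add: chain_dims_def)
  have F_meas: "(\<lambda>W. F (gd F \<eta> L W t)) \<in> borel_measurable P" for t
    unfolding F_def by (rule net_loss_measurable[OF gd_mat_meas[OF comp X' Y'] X' Y'])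
  have F_meas0: "F \<in> borel_measurable P" using F_meas[of 0] by simp
  define good where "good = {W \<in> space P. F W - ls \<le> 4 * S * (fro_norm X)\<^sup>2 \<and>
     (\<forall>t. F (gd F \<eta> L W t) - ls \<le> (1 - (1/2) * \<eta> * real L * lr / real dy) ^ t * (F W - ls))}"
  \<comment> \<open>A nonmeasurable set has \<open>measure\<close> 0, so a lower bound on the
    probability requires this.\<close>
  have good_meas: "good \<in> sets P"
    unfolding good_def
    by (intro sets.sets_Collect_conj sets.sets_Collect_countable_All borel_measurable_le
        borel_measurable_diff borel_measurable_times borel_measurable_const F_meas F_meas0)
  define \<psi> where "\<psi> = (\<lambda>W. (fro_norm (chain W (d 0) L * X))\<^sup>2 / (fro_norm (chain W (d 0) (L - 1) * X))\<^sup>2)"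
  define bad where "bad = {W \<in> space P. 2 * real (d L) + 4 * ln (1 / \<delta>) \<le> \<psi> W}"
  have dL1: "d (L - 1) = m" using dm[of "L - 1"] L by simp
  have tail_asm: "uniform_rows (d L) (d (L - 1)) (real (d (L - 1))) (\<mu> L)" "0 < d (L - 1)"
    unfolding dL1 d using ur m0 by auto
  have tail: "\<psi> \<in> borel_measurable P" "measure P bad \<le> \<delta>"
    unfolding bad_def \<psi>_def P_def
    by (rule initial_output_tail[where d = d and \<mu> = \<mu>, OF L _ _ tail_asm X' \<delta>(1)]; use layer in blast)+
  have bad_meas: "bad \<in> sets P"
    unfolding bad_def by (intro borel_measurable_le borel_measurable_const tail(1))
  have orth: "AE W in P. (\<forall>i. 1 \<le> i \<longrightarrow> i < L \<longrightarrow> (W i)\<^sup>T * W i = real m \<cdot>\<^sub>m 1\<^sub>m (d (i - 1)))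
      \<and> (\<forall>i. 1 < i \<longrightarrow> i \<le> L \<longrightarrow> W i * (W i)\<^sup>T = real m \<cdot>\<^sub>m 1\<^sub>m (d i))"
  proof -
    have "AE W in P. \<forall>i\<in>{1..L}. (i < L \<longrightarrow> (W i)\<^sup>T * W i = real m \<cdot>\<^sub>m 1\<^sub>m (d (i - 1)))
      \<and> (1 < i \<longrightarrow> W i * (W i)\<^sup>T = real m \<cdot>\<^sub>m 1\<^sub>m (d i))"
      unfolding P_def by (intro AE_finite_allI AE_PiM_component) (use layer in auto)
    then show ?thesis by (rule AE_mp) (intro AE_I2 impI, auto)
  qed
  have incl: "AE W in P. W \<in> space P - bad \<longrightarrow> W \<in> good"
    using orth
  proof (rule AE_mp, intro AE_I2 impI)
    fix W assume W: "W \<in> space P" "W \<in> space P - bad"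
      and O: "(\<forall>i. 1 \<le> i \<longrightarrow> i < L \<longrightarrow> (W i)\<^sup>T * W i = real m \<cdot>\<^sub>m 1\<^sub>m (d (i - 1)))
      \<and> (\<forall>i. 1 < i \<longrightarrow> i \<le> L \<longrightarrow> W i * (W i)\<^sup>T = real m \<cdot>\<^sub>m 1\<^sub>m (d i))"
    note dW = dims[OF W(1)]
    have mr: "0 < real m" using m0 by simp
    have cols: "\<And>i. 1 \<le> i \<Longrightarrow> i < L \<Longrightarrow> (W i)\<^sup>T * W i = real m \<cdot>\<^sub>m 1\<^sub>m (d (i - 1))"
      and rows: "\<And>i. 1 < i \<Longrightarrow> i \<le> L \<Longrightarrow> W i * (W i)\<^sup>T = real m \<cdot>\<^sub>m 1\<^sub>m (d i)" using O by blast+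
    note ob = orthogonal_init_bounds[OF dW L mr cols rows]
    define u where "u = (\<lambda>t. fro_norm (\<alpha> \<cdot>\<^sub>m chain (gd F \<eta> L W t) (d 0) L * X - Ws * X))"
    have head: "fro_norm (chain W (d 0) (L - 1) * X) = sqrt (real m) ^ (L - 1) * fro_norm X"
      using cols L by (intro fro_norm_head_isometry[OF chain_dims_le[OF dW] less_imp_le[OF mr] _ X']) auto
    have C: "chain W (d 0) L \<in> carrier_mat (d L) (d 0)" by (rule chain_carrier[OF dW])
    let ?A = "\<alpha> \<cdot>\<^sub>m chain W (d 0) L * X" and ?M = "chain W (d 0) (L - 1) * X"
    have CX: "chain W (d 0) L * X \<in> carrier_mat (d L) n" and WX: "Ws * X \<in> carrier_mat (d L) n"
      using C X' Ws' by auto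
    have out: "(fro_norm (?A))\<^sup>2 \<le> (2 + 4 * (ln (real r / \<delta>) / real dy)) * (fro_norm X)\<^sup>2"
    proof -
      have "?A = \<alpha> \<cdot>\<^sub>m (chain W (d 0) L * X)" by (rule mult_smult_assoc_mat[OF C X'])
      then have "(fro_norm (?A))\<^sup>2 = \<alpha>\<^sup>2 * (fro_norm (chain W (d 0) L * X))\<^sup>2"
        by (simp add: fro_norm_smult power_mult_distrib)
      \<comment> \<open>When the denominator of \<open>\<psi>\<close> vanishes, division by zero
        makes \<open>\<psi> W\<close> zero; then \<open>X\<close> vanishes and so does the left
        side.\<close>
      also have "\<dots> = \<psi> W * (\<alpha>\<^sup>2 * (fro_norm (?M))\<^sup>2)"
      proof (cases "fro_norm (?M) = 0")
        case True
        then have "fro_norm X = 0" using head m0 by simp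
        then have "X = 0\<^sub>m (d 0) n" by (rule fro_norm_eq_0D[OF X'])
        then have "chain W (d 0) L * X = 0\<^sub>m (d L) n" using C by simp
        then show ?thesis using True by simp
      qed (simp add: \<psi>_def)
      also have "\<alpha>\<^sup>2 * (fro_norm (?M))\<^sup>2 = (fro_norm X)\<^sup>2 / real dy"
      proof -
        have "(sqrt (real m) ^ (L - 1))\<^sup>2 = real m ^ (L - 1)"
          by (simp add: power_mult[symmetric] mult.commute) (simp add: power_mult)
        moreover have "\<alpha>\<^sup>2 = 1 / (real m ^ (L - 1) * real dy)"
          by (simp add: \<alpha>_def net_alpha_def power_divide)
        ultimately show ?thesis unfolding head using m0 by (simp add: power_mult_distrib)
      qed
      also have "\<psi> W * ((fro_norm X)\<^sup>2 / real dy) \<le> (2 * real dy + 4 * ln (real r / \<delta>)) * ((fro_norm X)\<^sup>2 / real dy)"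
        using W lnr by (intro mult_right_mono) (auto simp: bad_def d)
      also have "\<dots> = (2 + 4 * (ln (real r / \<delta>) / real dy)) * (fro_norm X)\<^sup>2" using dy by (simp add: field_simps)
      finally show ?thesis .
    qed
    \<comment> \<open>Half of (p + q)^2 is at most p^2 + q^2. The resulting coefficients 2, 4 and 1
      are all at most 4, which is where C' = 4 comes from.\<close>
    have init: "(1/2) * (u 0)\<^sup>2 \<le> 4 * S * (fro_norm X)\<^sup>2"
    proof -
      have AX: "?A \<in> carrier_mat (d L) n" using C X' by auto
      have "u 0 \<le> fro_norm (?A) + fro_norm (Ws * X)"
      proof -
        have "?A - Ws * X = ?A + - (Ws * X)"
          by (rule minus_add_uminus_mat[OF AX WX])
        then show ?thesis
          using fro_norm_triangle[OF AX, of "- (Ws * X)"] WX by (simp add: u_def fro_norm_uminus)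
      qed
      then have "(u 0)\<^sup>2 \<le> (fro_norm (?A) + fro_norm (Ws * X))\<^sup>2"
        by (intro power_mono) (auto simp: u_def)
      also have "\<dots> \<le> 2 * (fro_norm (?A))\<^sup>2 + 2 * (fro_norm (Ws * X))\<^sup>2"
        using zero_le_power2[of "fro_norm (?A) - fro_norm (Ws * X)"]
        unfolding power2_sum power2_diff by linarith
      also have "(fro_norm (Ws * X))\<^sup>2 \<le> (spec_norm Ws)\<^sup>2 * (fro_norm X)\<^sup>2"
        using power_mono[OF op_leD[OF op_le_spec_norm Ws X], of 2] by (simp add: power_mult_distrib)
      finally have "(1/2) * (u 0)\<^sup>2 \<le> (2 + 4 * (ln (real r / \<delta>) / real dy)) * (fro_norm X)\<^sup>2 + (spec_norm Ws)\<^sup>2 * (fro_norm X)\<^sup>2"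
        using out by simp
      also have "\<dots> = (2 + 4 * (ln (real r / \<delta>) / real dy) + (spec_norm Ws)\<^sup>2) * (fro_norm X)\<^sup>2" by (simp add: distrib_right)
      also have "\<dots> \<le> 4 * S * (fro_norm X)\<^sup>2"
        by (intro mult_right_mono) (auto simp: S_def)
      finally show ?thesis .
    qed
    have small: "x * sqrt (real (d L)) * u 0 \<le> lr * sqrt (real m) / 250"
    proof (rule initial_residual_small[OF x gram(2) mr _ S1 _ \<kappa> _ init])
      show "500000 * ((fro_norm X)\<^sup>2 / x\<^sup>2) * \<kappa>\<^sup>2 * (real (d L) * S) \<le> real m"
        using width by (simp add: dyS x_def d)
    qed (use dy d in \<open>auto simp: u_def\<close>)
    have q_eq: "q = \<eta> * real L * lr / real (d L)" by (simp add: q_def d)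
    have \<alpha>_eq: "\<alpha> = 1 / sqrt (real m ^ (L - 1) * real (d L))" by (simp add: \<alpha>_def net_alpha_def d)
    have F_eq: "F = net_loss \<alpha> X Y L" by (simp add: F_def \<alpha>_def)
    have conv: "u t \<le> (1 - q / 2) ^ t * u 0" for t
      unfolding u_def q_eq F_eq \<alpha>_eq
    proof (rule gd_linear_convergence[OF _ dW X' Y' Ws' opt mr _ ob _ x gram(2,3) _ \<eta>(1)])
      show "1 \<le> L" "0 < d L" using L dy d by auto
      show "op_le X x" unfolding x_def by (rule op_le_spec_norm)
      show "\<eta> * real L * x\<^sup>2 \<le> real (d L) / 2" using \<eta>x by (simp add: d)
      show "sqrt lr * fro_norm (B * X) \<le> fro_norm (B * X * X\<^sup>T)" if "B \<in> carrier_mat (d L) (d 0)" for B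
        using gram(5)[of B dy] that by (simp add: d)
      show "x * sqrt (real (d L)) * fro_norm (1 / sqrt (real m ^ (L - 1) * real (d L)) \<cdot>\<^sub>m chain
          (gd (net_loss (1 / sqrt (real m ^ (L - 1) * real (d L))) X Y L) \<eta> L W 0) (d 0) L * X - Ws * X)
        \<le> lr * sqrt (real m) / 250"
        using small unfolding u_def F_eq \<alpha>_eq .
    qed
    have q01: "0 \<le> 1 - q / 2" "1 - q / 2 \<le> 1"
    proof -
      have "\<eta> * real L * lr \<le> \<eta> * real L * x\<^sup>2" using gram(3) \<eta>(1) by (intro mult_left_mono) auto
      then have "q \<le> 1 / 2" unfolding q_def using \<eta>x dy by (simp add: field_simps)
      moreover have "0 \<le> q" using \<eta>(1) gram(2) by (simp add: q_def)
      ultimately show "0 \<le> 1 - q / 2" "1 - q / 2 \<le> 1" by auto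
    qed
    \<comment> \<open>Squaring the residual bound gives the factor (1 - q / 2)^(2t); half of the
      exponent is given away, since the base lies between 0 and 1.\<close>
    have rate: "F (gd F \<eta> L W t) - ls \<le> (1 - (1/2) * \<eta> * real L * lr / real dy) ^ t * (F W - ls)" for t
    proof -
      have gd_dims: "chain_dims (gd F \<eta> L W t) d L" unfolding F_def by (rule gd_chain_dims[OF dW X' Y'])
      have "(u t)\<^sup>2 \<le> ((1 - q / 2) ^ t * u 0)\<^sup>2" using conv by (intro power_mono) (auto simp: u_def)
      also have "\<dots> = (1 - q / 2) ^ t * ((1 - q / 2) ^ t * (u 0)\<^sup>2)" by (simp add: power_mult_distrib power2_eq_square)
      also have "\<dots> \<le> (1 - q / 2) ^ t * (1 * (u 0)\<^sup>2)"
        using q01 by (intro mult_left_mono mult_right_mono power_le_one) auto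
      finally have "(1/2) * (u t)\<^sup>2 \<le> (1 - q / 2) ^ t * ((1/2) * (u 0)\<^sup>2)" by simp
      moreover have "1 - (1/2) * \<eta> * real L * lr / real dy = 1 - q / 2" by (simp add: q_def)
      moreover have "F (gd F \<eta> L W t) - ls = (1/2) * (u t)\<^sup>2" unfolding u_def by (rule excess[OF gd_dims])
      moreover have "F W - ls = (1/2) * (u 0)\<^sup>2" unfolding u_def gd.simps by (rule excess[OF dW])
      ultimately show ?thesis by (simp only:)
    qed
    have "F W - ls \<le> 4 * S * (fro_norm X)\<^sup>2"
      unfolding excess[OF dW] using init unfolding u_def gd.simps .
    then show "W \<in> good" unfolding good_def using W(1) rate by blast
  qed
  have "1 - \<delta> \<le> 1 - measure P bad" using tail(2) by simp
  also have "\<dots> = measure P (space P - bad)" by (rule P.prob_compl[OF bad_meas, symmetric])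
  also have "\<dots> \<le> measure P good" by (rule P.finite_measure_mono_AE[OF incl good_meas])
  finally show ?thesis unfolding good_def S_def .
qed

theorem theorem4p1:
  "\<exists>C > 0. \<exists>C' > 0. \<forall>(n::nat) (dx::nat) (dy::nat) (L::nat) (m::nat)
      (X::real mat) (Y::real mat) (Wstar::real mat) (\<delta>::real) (\<eta>::real)
      (\<mu>::nat \<Rightarrow> real mat measure).
    X \<in> carrier_mat dx n \<and> Y \<in> carrier_mat dy n \<and> L \<ge> 2 \<and> m \<ge> max dx dy \<and>
    Wstar \<in> carrier_mat dy dx \<and>
    (\<forall>W \<in> carrier_mat dy dx. fro_norm (Wstar * X - Y) \<le> fro_norm (W * X - Y)) \<and>
    0 < \<delta> \<and> \<delta> < 1 \<and>
    (let r = mat_rank X;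
         \<kappa> = lambda_max (X\<^sup>T * X) / lambda_i (X\<^sup>T * X) r;
         rt = (fro_norm X)^2 / (spec_norm X)^2
     in real m \<ge> C * rt * \<kappa>^2 * (real dy * (1 + (spec_norm Wstar)^2) + ln (real r / \<delta>))) \<and>
    m \<ge> dx \<and>
    0 < \<eta> \<and> \<eta> \<le> real dy / (2 * real L * (spec_norm X)^2) \<and>
    uniform_cols m dx (real m) (\<mu> 1) \<and>
    (\<forall>i. 2 \<le> i \<and> i \<le> L - 1 \<longrightarrow> uniform_square m (real m) (\<mu> i)) \<and>
    uniform_rows dy m (real m) (\<mu> L)
    \<longrightarrow>
    (let lossf = net_loss (net_alpha m L dy) X Y L;
         lstar = (1/2) * (fro_norm (Wstar * X - Y))^2;
         r = mat_rank X;
         P = PiM {1..L} \<mu>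
     in measure P {W \<in> space P.
          lossf W - lstar \<le> C' * (1 + ln (real r / \<delta>) / real dy + (spec_norm Wstar)^2) * (fro_norm X)^2 \<and>
          (\<forall>t::nat. lossf (gd lossf \<eta> L W t) - lstar \<le>
              (1 - (1/2) * \<eta> * real L * lambda_i (X\<^sup>T * X) r / real dy) ^ t * (lossf W - lstar))}
        \<ge> 1 - \<delta>)"
  by (rule exI[of _ 500000], rule conjI, simp, rule exI[of _ 4], rule conjI, simp,
      unfold Let_def, intro allI impI, elim conjE, rule orthogonal_init_good_event) (assumption | blast)+

end
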